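(* Let $k$ be a field and let $A$ be any one of the following $k$-algebras (defined in the context): the coordinate ring of odd-dimensional quantum Euclidean space $\mathcal O_q(\mathfrak ok^{2n+1})$; the multiparameter quantized Weyl algebra $A_n^{Q,\Gamma}(k)$; the multiparameter coordinate ring of quantum $n\times n$ matrices $\mathcal O_{\lambda,\boldsymbol p}(M_n(k))$; or the algebra $K_{n,\Gamma}^{P,Q}(k)$. Let $I$ be a completely prime ideal of $A$. Then there exist a positive integer $N$, a multiplicatively antisymmetric $N\times N$ matrix $\boldsymbol\lambda$ over $k$, and a completely prime ideal $J$ of $\mathcal O_{\boldsymbol\lambda}(k^N)$ such that $$\operatorname{Fract}A/I\cong\operatorname{Fract}\mathcal O_{\boldsymbol\lambda}(k^N)/J.$$
   Context: $k$ is a field of arbitrary characteristic, $n$ a positive integer. A matrix $(\lambda_{ij})$ over $k^\times$ is multiplicatively antisymmetric if $\lambda_{ii}=1$ and $\lambda_{ji}=\lambda_{ij}^{-1}$. $\mathcal O_{\boldsymbol\lambda}(k^N)$ is the $k$-algebra with generators $x_1,\dots,x_N$ and relations $x_ix_j=\lambda_{ij}x_jx_i$. An ideal is completely prime if the factor ring is a domain; $\operatorname{Fract}$ is the division ring of fractions. In $R[x;\tau,\delta]$ one has $xr=\tau(r)x+\delta(r)$, with $\tau$ a $k$-algebra automorphism and $\delta$ a $k$-linear $\tau$-derivation ($\delta(rs)=\tau(r)\delta(s)+\delta(r)s$). (i) $\mathcal O_q(\mathfrak ok^{2n+1})$, for $q\in k^\times$ with a fixed square root $q^{1/2}\in k$,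 is the iterated skew polynomial ring $k[w][y_1;\sigma_1][x_1;\tau_1,\delta_1]\cdots[y_n;\sigma_n][x_n;\tau_n,\delta_n]$ with $\sigma_i(w)=q^{-1}w$, $\tau_i(w)=qw$; $\sigma_i(y_j)=q^{-1}y_j$, $\sigma_i(x_j)=q^{-1}x_j$, $\tau_i(y_j)=qy_j$, $\tau_i(x_j)=qx_j$ for $j<i$; $\tau_i(y_i)=y_i$; $\delta_i(w)=\delta_i(x_j)=\delta_i(y_j)=0$ for $j<i$; $\delta_i(y_i)=(q^{1/2}-q^{3/2})w^2+(1-q^2)\sum_{\ell<i}y_\ell x_\ell$. (ii) $A_n^{Q,\Gamma}(k)$, for $Q=(q_1,\dots,q_n)\in(k^\times)^n$ and $\Gamma=(\gamma_{ij})\in M_n(k^\times)$ multiplicatively antisymmetric, is $k[y_1][x_1;\tau_1,\delta_1][y_2;\sigma_2][x_2;\tau_2,\delta_2]\cdots[y_n;\sigma_n][x_n;\tau_n,\delta_n]$ with, for $j<i$, $\sigma_i(y_j)=\gamma_{ij}y_j$, $\sigma_i(x_j)=\gamma_{ji}x_j$, $\tau_i(y_j)=q_j\gamma_{ji}y_j$, $\tau_i(x_j)=q_j^{-1}\gamma_{ij}x_j$, $\delta_i(x_j)=\delta_i(y_j)=0$, and, for all $i$, $\tau_i(y_i)=q_iy_i$, $\delta_i(y_i)=1+\sum_{\ell<i}(q_\ell-1)y_\ell x_\ell$. (iii) $\mathcal O_{\lambda,\boldsymbol p}(M_n(k))$, for $\lambda\in k^\times$ and $\boldsymbol p=(p_{ij})\in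 M_n(k^\times)$ multiplicatively antisymmetric, has generators $x_{ij}$ ($1\le i,j\le n$) and relations: $x_{\ell m}x_{ij}=p_{\ell i}p_{jm}x_{ij}x_{\ell m}+(\lambda-1)p_{\ell i}x_{im}x_{\ell j}$ if $\ell>i$, $m>j$; $x_{\ell m}x_{ij}=\lambda p_{\ell i}p_{jm}x_{ij}x_{\ell m}$ if $\ell>i$, $m\le j$; $x_{\ell m}x_{ij}=p_{jm}x_{ij}x_{\ell m}$ if $\ell=i$, $m>j$. (iv) $K_{n,\Gamma}^{P,Q}(k)$, for $P=(p_1,\dots,p_n)$, $Q=(q_1,\dots,q_n)\in(k^\times)^n$ with $p_i\ne q_i$ for all $i$ and $\Gamma=(\gamma_{ij})\in M_n(k^\times)$ multiplicatively antisymmetric, has generators $x_i,y_i$ ($1\le i\le n$) and relations $y_iy_j=\gamma_{ij}y_jy_i$ (all $i,j$); $x_ix_j=q_ip_j^{-1}\gamma_{ij}x_jx_i$ ($i<j$); $x_iy_j=p_j\gamma_{ji}y_jx_i$ ($i<j$); $x_iy_j=q_j\gamma_{ji}y_jx_i$ ($i>j$); $x_iy_i=q_iy_ix_i+\sum_{\ell<i}(q_\ell-p_\ell)y_\ell x_\ell$ (all $i$).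
   Formalization: Two conditions are added, as the claim fails without them for I = 0: for the quantum Euclidean space, q = -1 is excluded unless -1 = 1 in k; for the quantized Weyl algebra, every q_i is assumed different from 1 (the first Weyl algebra, q_1 = 1, is a counterexample). *)

theory Defs
  imports
    "HOL-Algebra.QuotRing"
    "HOL-Algebra.Subrings"
    "HOL-Algebra.Algebraic_Closure_Type"
    "HOL-Library.Poly_Mapping"
begin

section \<open>Algebras over a field\<close>

text \<open>
  The locale \<open>algebra\<close> of HOL-Algebra only covers commutative algebras. Here an algebra is
  associative and unital but not necessarily commutative. The ground field is a type of class
  \<^class>\<open>field\<close>.
\<close>

locale k_algebra = module "ring_of_type_algebra :: 'k::field ring" A + ring A
  for A :: "('k::field, 'a) module" (structure) +
  assumes smult_mult_left:
      "\<lbrakk>x \<in> carrier A; y \<in> carrier A\<rbrakk> \<Longrightarrow> (c \<odot> x) \<otimes> y = c \<odot> (x \<otimes> y)"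
    and smult_mult_right:
      "\<lbrakk>x \<in> carrier A; y \<in> carrier A\<rbrakk> \<Longrightarrow> x \<otimes> (c \<odot> y) = c \<odot> (x \<otimes> y)"

definition alg_hom :: "('k, 'a) module \<Rightarrow> ('k, 'b) module \<Rightarrow> ('a \<Rightarrow> 'b) set"
  where "alg_hom A B =
    {f \<in> ring_hom A B. \<forall>c. \<forall>x \<in> carrier A. f (c \<odot>\<^bsub>A\<^esub> x) = c \<odot>\<^bsub>B\<^esub> f x}"

definition alg_iso :: "('k, 'a) module \<Rightarrow> ('k, 'b) module \<Rightarrow> ('a \<Rightarrow> 'b) set"
  where "alg_iso A B = {f \<in> alg_hom A B. bij_betw f (carrier A) (carrier B)}"

definition alg_isomorphic :: "('k, 'a) module \<Rightarrow> ('k, 'b) module \<Rightarrow> bool"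
  where "alg_isomorphic A B \<longleftrightarrow> alg_iso A B \<noteq> {}"

definition subalg :: "'a set \<Rightarrow> ('k, 'a) module \<Rightarrow> bool"
  where "subalg R A \<longleftrightarrow> subring R A \<and> (\<forall>c. \<forall>r \<in> R. c \<odot>\<^bsub>A\<^esub> r \<in> R)"

definition alg_quot :: "('k, 'a) module \<Rightarrow> 'a set \<Rightarrow> ('k, 'a set) module"
  where "alg_quot A I =
    \<lparr>carrier = carrier (A Quot I), monoid.mult = monoid.mult (A Quot I), one = one (A Quot I),
     zero = zero (A Quot I), add = add (A Quot I),
     module.smult = (\<lambda>c B. \<Union>x\<in>B. I +>\<^bsub>A\<^esub> (c \<odot>\<^bsub>A\<^esub> x))\<rparr>"

text \<open>The locale \<open>domain\<close> of HOL-Algebra is commutative; this one is not.\<close>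

definition nc_domain :: "('a, 'm) ring_scheme \<Rightarrow> bool"
  where "nc_domain R \<longleftrightarrow> ring R \<and> \<one>\<^bsub>R\<^esub> \<noteq> \<zero>\<^bsub>R\<^esub> \<and>
    (\<forall>a \<in> carrier R. \<forall>b \<in> carrier R. a \<otimes>\<^bsub>R\<^esub> b = \<zero>\<^bsub>R\<^esub> \<longrightarrow> a = \<zero>\<^bsub>R\<^esub> \<or> b = \<zero>\<^bsub>R\<^esub>)"

definition completely_prime :: "'a set \<Rightarrow> ('k, 'a) module \<Rightarrow> bool"
  where "completely_prime I A \<longleftrightarrow> ideal I A \<and> nc_domain (alg_quot A I)"

definition division_algebra :: "('k::field, 'a) module \<Rightarrow> bool"
  where "division_algebra D \<longleftrightarrow>
    k_algebra D \<and> \<one>\<^bsub>D\<^esub> \<noteq> \<zero>\<^bsub>D\<^esub> \<and> Units D = carrier D - {\<zero>\<^bsub>D\<^esub>}"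

text \<open>
  \<open>D\<close>, with the embedding \<open>\<phi>\<close>, is the division ring of fractions \<open>Fract R\<close> of the domain \<open>R\<close>:
  every element has the form \<open>a b\<^sup>-\<^sup>1\<close>. Such a \<open>D\<close> exists iff \<open>R\<close> is a right Ore domain, it is
  unique up to isomorphism over \<open>R\<close>, and it is also the ring of left fractions if \<open>R\<close> is a left
  Ore domain as well.
\<close>

definition is_Fract ::
    "('k::field, 'd) module \<Rightarrow> ('a \<Rightarrow> 'd) \<Rightarrow> ('k, 'a) module \<Rightarrow> bool"
  where "is_Fract D \<phi> R \<longleftrightarrow>
    division_algebra D \<and> \<phi> \<in> alg_hom R D \<and> inj_on \<phi> (carrier R) \<and>
    (\<forall>d \<in> carrier D. \<exists>a \<in> carrier R. \<exists>b \<in> carrier R - {\<zero>\<^bsub>R\<^esub>}.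
       d = \<phi> a \<otimes>\<^bsub>D\<^esub> inv\<^bsub>D\<^esub> (\<phi> b))"

text \<open>
  \<open>Fract R\<close> and \<open>Fract T\<close> exist and are isomorphic as \<open>k\<close>-algebras. The carrier types are
  those of the Ore localizations, whose elements are equivalence classes of pairs
  (numerator, denominator); so fixing these types is no restriction.
\<close>

definition isomorphic_Fract ::
    "('k::field, 'a) module \<Rightarrow> ('k, 'b) module \<Rightarrow> bool"
  where "isomorphic_Fract R T \<longleftrightarrow>
    (\<exists>(D :: ('k, ('a \<times> 'a) set) module) \<phi> (E :: ('k, ('b \<times> 'b) set) module) \<psi>.
       is_Fract D \<phi> R \<and> is_Fract E \<psi> T \<and> alg_isomorphic D E)"


section \<open>Skew polynomial rings\<close>

definition skew_derivation ::
    "('k, 'a) module \<Rightarrow> ('a \<Rightarrow> 'a) \<Rightarrow> ('a \<Rightarrow> 'a) \<Rightarrow> bool"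
  where "skew_derivation R \<tau> \<delta> \<longleftrightarrow>
    \<delta> \<in> carrier R \<rightarrow> carrier R \<and>
    (\<forall>c. \<forall>r \<in> carrier R. \<delta> (c \<odot>\<^bsub>R\<^esub> r) = c \<odot>\<^bsub>R\<^esub> \<delta> r) \<and>
    (\<forall>r \<in> carrier R. \<forall>s \<in> carrier R. \<delta> (r \<oplus>\<^bsub>R\<^esub> s) = \<delta> r \<oplus>\<^bsub>R\<^esub> \<delta> s) \<and>
    (\<forall>r \<in> carrier R. \<forall>s \<in> carrier R.
       \<delta> (r \<otimes>\<^bsub>R\<^esub> s) = \<tau> r \<otimes>\<^bsub>R\<^esub> \<delta> s \<oplus>\<^bsub>R\<^esub> \<delta> r \<otimes>\<^bsub>R\<^esub> s)"

text \<open>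
  \<open>S = R[x; \<tau>, \<delta>]\<close> for subalgebras \<open>R \<subseteq> S\<close> of \<open>A\<close>: the powers of \<open>x\<close> are a basis of \<open>S\<close>
  as a left \<open>R\<close>-module, and \<open>x r = \<tau>(r) x + \<delta>(r)\<close> on \<open>R\<close>. Only the restrictions of \<open>\<tau>\<close>
  and \<open>\<delta>\<close> to \<open>R\<close> matter.
\<close>

definition skew_polynomial_ring ::
    "('k, 'a) module \<Rightarrow> 'a set \<Rightarrow> 'a \<Rightarrow> ('a \<Rightarrow> 'a) \<Rightarrow> ('a \<Rightarrow> 'a) \<Rightarrow> 'a set \<Rightarrow> bool"
  where "skew_polynomial_ring A R x \<tau> \<delta> S \<longleftrightarrow>
    subalg R A \<and> subalg S A \<and> R \<subseteq> S \<and> x \<in> S \<and>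
    \<tau> \<in> alg_iso (A\<lparr>carrier := R\<rparr>) (A\<lparr>carrier := R\<rparr>) \<and>
    skew_derivation (A\<lparr>carrier := R\<rparr>) \<tau> \<delta> \<and>
    (\<forall>r \<in> R. x \<otimes>\<^bsub>A\<^esub> r = \<tau> r \<otimes>\<^bsub>A\<^esub> x \<oplus>\<^bsub>A\<^esub> \<delta> r) \<and>
    (\<forall>s \<in> S. \<exists>!c :: nat \<Rightarrow> 'a.
       range c \<subseteq> R \<and> finite {i. c i \<noteq> \<zero>\<^bsub>A\<^esub>} \<and>
       s = (\<Oplus>\<^bsub>A\<^esub>i \<in> {i. c i \<noteq> \<zero>\<^bsub>A\<^esub>}. c i \<otimes>\<^bsub>A\<^esub> x [^]\<^bsub>A\<^esub> i))"

definition scalars :: "('k, 'a) module \<Rightarrow> 'a set"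
  where "scalars A = range (\<lambda>c. c \<odot>\<^bsub>A\<^esub> \<one>\<^bsub>A\<^esub>)"

text \<open>
  \<open>A = R\<^sub>0[y\<^sub>1; \<sigma>\<^sub>1][x\<^sub>1; \<tau>\<^sub>1, \<delta>\<^sub>1] \<dots> [y\<^sub>n; \<sigma>\<^sub>n][x\<^sub>n; \<tau>\<^sub>n, \<delta>\<^sub>n]\<close>, with \<open>S i\<close> and \<open>R i\<close> the subalgebras reached
  after adjoining \<open>y\<^sub>i\<close> and \<open>x\<^sub>i\<close>.
\<close>

definition skew_tower ::
    "('k, 'a) module \<Rightarrow> nat \<Rightarrow> 'a set \<Rightarrow> (nat \<Rightarrow> 'a) \<Rightarrow> (nat \<Rightarrow> 'a) \<Rightarrow>
     (nat \<Rightarrow> 'a \<Rightarrow> 'a) \<Rightarrow> (nat \<Rightarrow> 'a \<Rightarrow> 'a) \<Rightarrow> (nat \<Rightarrow> 'a \<Rightarrow> 'a) \<Rightarrow> bool"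
  where "skew_tower A n R0 y x \<sigma> \<tau> \<delta> \<longleftrightarrow>
    (\<exists>R S. R 0 = R0 \<and> R n = carrier A \<and>
      (\<forall>i \<in> {1..n}.
         skew_polynomial_ring A (R (i - 1)) (y i) (\<sigma> i) (\<lambda>_. \<zero>\<^bsub>A\<^esub>) (S i) \<and>
         skew_polynomial_ring A (S i) (x i) (\<tau> i) (\<delta> i) (R i)))"

definition mult_antisym :: "nat \<Rightarrow> (nat \<Rightarrow> nat \<Rightarrow> 'k::field) \<Rightarrow> bool"
  where "mult_antisym N lam \<longleftrightarrow>
    (\<forall>i \<in> {1..N}. \<forall>j \<in> {1..N}. lam i j \<noteq> 0 \<and> lam j i = inverse (lam i j)) \<and>
    (\<forall>i \<in> {1..N}. lam i i = 1)"

text \<open>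
  \<open>A\<close> is the coordinate ring of quantum Euclidean space \<open>O\<^sub>q(ok\<^sup>2\<^sup>n\<^sup>+\<^sup>1)\<close>, where \<open>q = s\<^sup>2\<close> and \<open>s\<close> is
  the chosen square root of \<open>q\<close>. The ring \<open>W = k[w]\<close> is the skew polynomial ring over the scalars
  with trivial automorphism and derivation.

  For \<open>q = -1 \<noteq> 1\<close> the elements \<open>u = w\<^sup>-\<^sup>1 y\<^sub>1\<close> and \<open>v = w\<^sup>-\<^sup>1 x\<^sub>1\<close> of \<open>Fract A\<close> satisfy \<open>v u - u v = -2s \<noteq> 0\<close>,
  as in a classical Weyl algebra, whose division ring of fractions is not one of a factor of a
  quantum affine space. This \<open>q\<close> has to be excluded when \<open>Fract A\<close> is compared with such
  division rings.
\<close>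

definition is_quantum_euclidean :: "nat \<Rightarrow> 'k::field \<Rightarrow> 'k \<Rightarrow> ('k, 'a) module \<Rightarrow> bool"
  where "is_quantum_euclidean n q s A \<longleftrightarrow> \<one>\<^bsub>A\<^esub> \<noteq> \<zero>\<^bsub>A\<^esub> \<and>
    (\<exists>w W y x \<sigma> \<tau> \<delta>.
      skew_polynomial_ring A (scalars A) w id (\<lambda>_. \<zero>\<^bsub>A\<^esub>) W \<and>
      skew_tower A n W y x \<sigma> \<tau> \<delta> \<and>
      (\<forall>i \<in> {1..n}.
         \<sigma> i w = inverse q \<odot>\<^bsub>A\<^esub> w \<and> \<tau> i w = q \<odot>\<^bsub>A\<^esub> w \<and> \<delta> i w = \<zero>\<^bsub>A\<^esub> \<and>
         (\<forall>j \<in> {1..<i}.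
            \<sigma> i (y j) = inverse q \<odot>\<^bsub>A\<^esub> y j \<and> \<sigma> i (x j) = inverse q \<odot>\<^bsub>A\<^esub> x j \<and>
            \<tau> i (y j) = q \<odot>\<^bsub>A\<^esub> y j \<and> \<tau> i (x j) = q \<odot>\<^bsub>A\<^esub> x j \<and>
            \<delta> i (y j) = \<zero>\<^bsub>A\<^esub> \<and> \<delta> i (x j) = \<zero>\<^bsub>A\<^esub>) \<and>
         \<tau> i (y i) = y i \<and>
         \<delta> i (y i) = (s - s ^ 3) \<odot>\<^bsub>A\<^esub> (w \<otimes>\<^bsub>A\<^esub> w) \<oplus>\<^bsub>A\<^esub>
           (1 - q\<^sup>2) \<odot>\<^bsub>A\<^esub> (\<Oplus>\<^bsub>A\<^esub>l \<in> {1..<i}. y l \<otimes>\<^bsub>A\<^esub> x l)))"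

text \<open>
  \<open>A\<close> is the multiparameter quantized Weyl algebra \<open>A\<^sub>n\<^sup>Q\<^sup>,\<^sup>\<Gamma>(k)\<close>. The tower starts from the scalars,
  on which \<open>\<sigma> 1\<close>, being an algebra automorphism, is the identity; so its first step is the
  ordinary polynomial ring \<open>k[y\<^sub>1]\<close>. If \<open>Q i = 1\<close> for all \<open>i\<close> and \<open>\<Gamma>\<close> is trivial, then \<open>A\<close> is the classical
  Weyl algebra, so the values \<open>Q i = 1\<close> also have to be excluded in such a comparison.
\<close>

definition is_quantized_weyl_algebra ::
    "nat \<Rightarrow> (nat \<Rightarrow> 'k::field) \<Rightarrow> (nat \<Rightarrow> nat \<Rightarrow> 'k) \<Rightarrow> ('k, 'a) module \<Rightarrow> bool"
  where "is_quantized_weyl_algebra n Q \<Gamma> A \<longleftrightarrow> \<one>\<^bsub>A\<^esub> \<noteq> \<zero>\<^bsub>A\<^esub> \<and>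
    (\<exists>y x \<sigma> \<tau> \<delta>.
      skew_tower A n (scalars A) y x \<sigma> \<tau> \<delta> \<and>
      (\<forall>i \<in> {1..n}.
         (\<forall>j \<in> {1..<i}.
            \<sigma> i (y j) = \<Gamma> i j \<odot>\<^bsub>A\<^esub> y j \<and> \<sigma> i (x j) = \<Gamma> j i \<odot>\<^bsub>A\<^esub> x j \<and>
            \<tau> i (y j) = (Q j * \<Gamma> j i) \<odot>\<^bsub>A\<^esub> y j \<and>
            \<tau> i (x j) = (inverse (Q j) * \<Gamma> i j) \<odot>\<^bsub>A\<^esub> x j \<and>
            \<delta> i (y j) = \<zero>\<^bsub>A\<^esub> \<and> \<delta> i (x j) = \<zero>\<^bsub>A\<^esub>) \<and>
         \<tau> i (y i) = Q i \<odot>\<^bsub>A\<^esub> y i \<and>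
         \<delta> i (y i) = \<one>\<^bsub>A\<^esub> \<oplus>\<^bsub>A\<^esub> (\<Oplus>\<^bsub>A\<^esub>l \<in> {1..<i}. (Q l - 1) \<odot>\<^bsub>A\<^esub> (y l \<otimes>\<^bsub>A\<^esub> x l))))"


section \<open>Algebras given by generators and relations\<close>

text \<open>
  The free algebra is the monoid algebra of the free monoid. The latter is a copy of the type of
  lists, written additively because multiplication of \<^type>\<open>poly_mapping\<close> is convolution over an
  additive monoid.
\<close>

datatype 'x free_word = Word (letters: "'x list")

instantiation free_word :: (type) monoid_add
begin

definition zero_free_word :: "'a free_word"
  where "0 = Word []"

definition plus_free_word :: "'a free_word \<Rightarrow> 'a free_word \<Rightarrow> 'a free_word"
  where "u + v = Word (letters u @ letters v)"

instance
  by standard (simp_all add: zero_free_word_def plus_free_word_def)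

end

type_synonym ('k, 'x) free_poly = "'x free_word \<Rightarrow>\<^sub>0 'k"

definition const :: "'k \<Rightarrow> ('k::field, 'x) free_poly"
  where "const c = Poly_Mapping.single 0 c"

definition gen :: "'x \<Rightarrow> ('k::field, 'x) free_poly"
  where "gen x = Poly_Mapping.single (Word [x]) 1"

definition free_algebra :: "'x set \<Rightarrow> ('k::field, ('k, 'x) free_poly) module"
  where "free_algebra G =
    \<lparr>carrier = {f. \<forall>u \<in> Poly_Mapping.keys f. set (letters u) \<subseteq> G},
     monoid.mult = (*), one = 1, zero = 0, add = (+), module.smult = (\<lambda>c f. const c * f)\<rparr>"

text \<open>A relation \<open>f = g\<close> is represented by the element \<open>f - g\<close>.\<close>

definition presented_algebra ::
    "'x set \<Rightarrow> ('k::field, 'x) free_poly set \<Rightarrow> ('k, ('k, 'x) free_poly set) module"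
  where "presented_algebra G R = alg_quot (free_algebra G) (Idl\<^bsub>free_algebra G\<^esub> R)"

definition quantum_affine_space ::
    "nat \<Rightarrow> (nat \<Rightarrow> nat \<Rightarrow> 'k::field) \<Rightarrow> ('k, ('k, nat) free_poly set) module"
  where "quantum_affine_space N lam = presented_algebra {1..N}
    {gen i * gen j - const (lam i j) * gen j * gen i | i j. i \<in> {1..N} \<and> j \<in> {1..N}}"

definition quantum_matrices ::
    "nat \<Rightarrow> 'k::field \<Rightarrow> (nat \<Rightarrow> nat \<Rightarrow> 'k) \<Rightarrow> ('k, ('k, nat \<times> nat) free_poly set) module"
  where "quantum_matrices n lam p = presented_algebra ({1..n} \<times> {1..n})
    ({gen (l, m) * gen (i, j) - (const (p l i * p j m) * gen (i, j) * gen (l, m)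
        + const ((lam - 1) * p l i) * gen (i, m) * gen (l, j)) | l m i j.
        {l, m, i, j} \<subseteq> {1..n} \<and> l > i \<and> m > j} \<union>
     {gen (l, m) * gen (i, j) - const (lam * p l i * p j m) * gen (i, j) * gen (l, m) | l m i j.
        {l, m, i, j} \<subseteq> {1..n} \<and> l > i \<and> m \<le> j} \<union>
     {gen (l, m) * gen (i, j) - const (p j m) * gen (i, j) * gen (l, m) | l m i j.
        {l, m, i, j} \<subseteq> {1..n} \<and> l = i \<and> m > j})"

datatype K_gen = XG nat | YG nat

definition K_algebra ::
    "nat \<Rightarrow> (nat \<Rightarrow> 'k::field) \<Rightarrow> (nat \<Rightarrow> 'k) \<Rightarrow> (nat \<Rightarrow> nat \<Rightarrow> 'k) \<Rightarrow>
     ('k, ('k, K_gen) free_poly set) module"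
  where "K_algebra n P Q \<Gamma> = presented_algebra (XG ` {1..n} \<union> YG ` {1..n})
    ({gen (YG i) * gen (YG j) - const (\<Gamma> i j) * gen (YG j) * gen (YG i) | i j.
        {i, j} \<subseteq> {1..n}} \<union>
     {gen (XG i) * gen (XG j) - const (Q i * inverse (P j) * \<Gamma> i j) * gen (XG j) * gen (XG i) | i j.
        {i, j} \<subseteq> {1..n} \<and> i < j} \<union>
     {gen (XG i) * gen (YG j) - const (P j * \<Gamma> j i) * gen (YG j) * gen (XG i) | i j.
        {i, j} \<subseteq> {1..n} \<and> i < j} \<union>
     {gen (XG i) * gen (YG j) - const (Q j * \<Gamma> j i) * gen (YG j) * gen (XG i) | i j.
        {i, j} \<subseteq> {1..n} \<and> i > j} \<union>
     {gen (XG i) * gen (YG i) - (const (Q i) * gen (YG i) * gen (XG i)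
        + (\<Sum>l \<in> {1..<i}. const (Q l - P l) * gen (YG l) * gen (XG l))) | i.
        i \<in> {1..n}})"

end

theory Submission
  imports Defs
begin

text \<open>
  Let \<open>D\<close> be the division ring of fractions of \<open>A/I\<close>. It suffices to find finitely many elements of
  \<open>D\<close> which pairwise commute up to scalars and generate \<open>D\<close> as a division algebra: the subalgebra
  generated by them is a domain \<open>O\<^sub>\<lambda>(k\<^sup>N)/J\<close> and, by its polynomial growth, an Ore domain, so that its
  fractions fill \<open>D\<close>. Growth also shows that \<open>A/I\<close> itself is an Ore domain.

  For the quantum Euclidean spaces, the quantized Weyl algebras and the algebras \<open>K\<close> the elements
  \<open>\<Omega>\<^sub>i = \<kappa> w\<^sup>2 + \<Sum>\<^sub>l\<^sub>\<le>\<^sub>i c\<^sub>l y\<^sub>l x\<^sub>l\<close> commute up to scalars with each other and with \<open>w\<close> and all \<open>y\<^sub>j\<close>. If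
  \<open>y\<^sub>i \<noteq> 0\<close> in \<open>D\<close>, then \<open>x\<^sub>i = c\<^sub>i\<^sup>-\<^sup>1 y\<^sub>i\<^sup>-\<^sup>1 (\<Omega>\<^sub>i - \<Omega>\<^sub>i\<^sub>-\<^sub>1)\<close> is redundant; if \<open>y\<^sub>i = 0\<close>, then \<open>\<Omega>\<^sub>i = 0\<close> and \<open>x\<^sub>i\<close> itself
  commutes up to scalars with the other generators.

  For quantum matrices one runs through the positions \<open>(u, v)\<close> in decreasing lexicographic order and
  replaces \<open>x\<^sub>i\<^sub>j\<close> by \<open>x\<^sub>i\<^sub>j - x\<^sub>i\<^sub>v x\<^sub>u\<^sub>v\<^sup>-\<^sup>1 x\<^sub>u\<^sub>j\<close> for \<open>i < u\<close>, \<open>j < v\<close> whenever the pivot \<open>x\<^sub>u\<^sub>v\<close> is nonzero. The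
  relations of the new elements follow by comparing weights for conjugation with the pivot, which
  works for roots of unity as well.
\<close>

text \<open>Both Ore conditions are taken from growth because one argument then serves
  \<open>A/I\<close> and the unknown factor of the quantum affine space: if \<open>a v = b u\<close>
  forced \<open>v = 0\<close>, then \<open>aE + bE\<close> would have twice the dimension of each
  layer \<open>E\<close>, against a polynomial bound. The bound rests on spanning by sorted words,
  and spanning passes to every factor algebra. Relations are therefore kept as equations or as
  membership in a span and pushed along homomorphisms into \<open>A/I\<close> and \<open>D\<close>;
  in \<open>D\<close> it is decided which elements vanish.

  The \<open>c_i\<close> are forced by \<open>x_i y_i = a_i y_i x_i + \<Omega>_{i-1}\<close>: moving
  \<open>\<Omega>_{i-1}\<close> past \<open>y_i\<close> gives the factor \<open>a_i - c_i\<close>,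
  and the missing \<open>c_i y_i \<Omega>_{i-1}\<close> comes from \<open>c_i y_i x_i\<close>.
  Recovering \<open>x_i\<close> needs \<open>c_i \<noteq> 0\<close>.

  For matrices the new element and its correction term are eigenvectors of conjugation by the pivot,
  for eigenvalues differing by the factor \<open>lam\<close>. If \<open>lam \<noteq> 1\<close>, each
  old relation, after cancelling the same relation among the corrections, splits into
  eigencomponents; one of them is the new relation. If \<open>lam = 1\<close>, there is nothing to
  delete.\<close>

section \<open>Algebras over a field: scalar arithmetic and transport of structure\<close>

lemma ring_of_type_algebra_simps [simp]:
  "carrier ring_of_type_algebra = UNIV"
  "\<one>\<^bsub>ring_of_type_algebra\<^esub> = 1"
  "\<zero>\<^bsub>ring_of_type_algebra\<^esub> = 0"
  "x \<oplus>\<^bsub>ring_of_type_algebra\<^esub> y = x + y"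
  "x \<otimes>\<^bsub>ring_of_type_algebra\<^esub> y = x * y"
  by (simp_all add: ring_of_type_algebra_def)

lemma k_algebraI:
  fixes A :: "('k::field, 'a) module" (structure)
  assumes "ring A"
    and "\<And>c x. x \<in> carrier A \<Longrightarrow> c \<odot> x \<in> carrier A"
    and "\<And>a b x. x \<in> carrier A \<Longrightarrow> (a + b) \<odot> x = a \<odot> x \<oplus> b \<odot> x"
    and "\<And>a x y. x \<in> carrier A \<Longrightarrow> y \<in> carrier A \<Longrightarrow> a \<odot> (x \<oplus> y) = a \<odot> x \<oplus> a \<odot> y"
    and "\<And>a b x. x \<in> carrier A \<Longrightarrow> (a * b) \<odot> x = a \<odot> (b \<odot> x)"
    and "\<And>x. x \<in> carrier A \<Longrightarrow> 1 \<odot> x = x"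
    and "\<And>c x y. x \<in> carrier A \<Longrightarrow> y \<in> carrier A \<Longrightarrow> (c \<odot> x) \<otimes> y = c \<odot> (x \<otimes> y)"
    and "\<And>c x y. x \<in> carrier A \<Longrightarrow> y \<in> carrier A \<Longrightarrow> x \<otimes> (c \<odot> y) = c \<odot> (x \<otimes> y)"
  shows "k_algebra A"
proof -
  interpret ring A by fact
  have c: "cring (ring_of_type_algebra :: 'k ring)" by blast
  show ?thesis
    unfolding k_algebra_def k_algebra_axioms_def
    by (intro conjI moduleI c assms(1) is_abelian_group allI impI; (simp add: assms)?)
qed

context k_algebra
begin

lemma ring_A: "ring A" ..

lemma sm_closed [simp, intro]: "x \<in> carrier A \<Longrightarrow> c \<odot> x \<in> carrier A"
  by (rule smult_closed) auto

lemma sm_add_left: "x \<in> carrier A \<Longrightarrow> (a + b) \<odot> x = a \<odot> x \<oplus> b \<odot> x"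
  using smult_l_distr[of a b x] by simp

lemma sm_add_right: "x \<in> carrier A \<Longrightarrow> y \<in> carrier A \<Longrightarrow> a \<odot> (x \<oplus> y) = a \<odot> x \<oplus> a \<odot> y"
  using smult_r_distr[of a x y] by simp

lemma sm_sm [simp]: "x \<in> carrier A \<Longrightarrow> a \<odot> (b \<odot> x) = (a * b) \<odot> x"
  using smult_assoc1[of a b x] by simp

lemma sm_one [simp]: "x \<in> carrier A \<Longrightarrow> 1 \<odot> x = x"
  using smult_one[of x] by simp

lemma sm_0 [simp]: "x \<in> carrier A \<Longrightarrow> 0 \<odot> x = \<zero>"
  using smult_l_null[of x] by simp

lemma sm_zero [simp]: "c \<odot> \<zero> = \<zero>"
  using smult_r_null[of c] by simp

lemma sm_minus_left: "x \<in> carrier A \<Longrightarrow> (- c) \<odot> x = \<ominus> (c \<odot> x)"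
  by (rule minus_equality[symmetric]) (auto simp flip: sm_add_left)

lemma sm_minus_right: "x \<in> carrier A \<Longrightarrow> c \<odot> (\<ominus> x) = \<ominus> (c \<odot> x)"
  by (rule minus_equality[symmetric]) (auto simp flip: sm_add_right simp: l_neg)

lemma sm_diff_left: "x \<in> carrier A \<Longrightarrow> (a - b) \<odot> x = a \<odot> x \<ominus> b \<odot> x"
  using sm_add_left[of x a "- b"] by (simp add: sm_minus_left a_minus_def)

lemmas sm_mult = smult_mult_left smult_mult_right

lemma sm_cancel: "c \<noteq> 0 \<Longrightarrow> x \<in> carrier A \<Longrightarrow> y \<in> carrier A \<Longrightarrow> c \<odot> x = c \<odot> y \<Longrightarrow> x = y"
  by (metis left_inverse sm_one sm_sm)

lemma sm_eq_zero: "c \<noteq> 0 \<Longrightarrow> x \<in> carrier A \<Longrightarrow> c \<odot> x = \<zero> \<longleftrightarrow> x = \<zero>"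
  using sm_cancel[of c x \<zero>] by auto

lemma sm_finsum:
  "f \<in> S \<rightarrow> carrier A \<Longrightarrow> c \<odot> (\<Oplus>i\<in>S. f i) = (\<Oplus>i\<in>S. c \<odot> f i)"
proof (induction S rule: infinite_finite_induct)
  case (insert x F)
  then have "f x \<in> carrier A" "f \<in> F \<rightarrow> carrier A" "(\<lambda>i. c \<odot> f i) \<in> F \<rightarrow> carrier A" by auto
  with insert show ?case by (simp add: finsum_insert sm_add_right finsum_closed)
qed auto

end

text \<open>Every element of \<open>B\<close> is an image under \<open>f\<close>, so each axiom of
  \<open>B\<close> is the image of the same axiom of \<open>A\<close>. It serves for factor
  algebras, with \<open>f\<close> the coset map, and for moving a division algebra to another
  carrier type.\<close>

lemma k_algebra_image:
  fixes A :: "('k::field, 'a) module" and B :: "('k, 'b) module"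
  assumes A: "k_algebra A" and car: "carrier B = f ` carrier A"
    and add: "\<And>x y. x \<in> carrier A \<Longrightarrow> y \<in> carrier A \<Longrightarrow> f (x \<oplus>\<^bsub>A\<^esub> y) = f x \<oplus>\<^bsub>B\<^esub> f y"
    and mult: "\<And>x y. x \<in> carrier A \<Longrightarrow> y \<in> carrier A \<Longrightarrow> f (x \<otimes>\<^bsub>A\<^esub> y) = f x \<otimes>\<^bsub>B\<^esub> f y"
    and smult: "\<And>c x. x \<in> carrier A \<Longrightarrow> f (c \<odot>\<^bsub>A\<^esub> x) = c \<odot>\<^bsub>B\<^esub> f x"
    and one: "\<one>\<^bsub>B\<^esub> = f \<one>\<^bsub>A\<^esub>" and zero: "\<zero>\<^bsub>B\<^esub> = f \<zero>\<^bsub>A\<^esub>"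
  shows "k_algebra B" and "f \<in> alg_hom A B"
proof -
  interpret A: k_algebra A by fact
  note s = add[symmetric] mult[symmetric] smult[symmetric]
  have cl: "x \<in> carrier A \<Longrightarrow> f x \<in> carrier B" for x using car by auto
  have ex: "\<exists>y\<in>carrier A. f (x \<oplus>\<^bsub>A\<^esub> y) = f \<zero>\<^bsub>A\<^esub>" if "x \<in> carrier A" for x
    using that by (intro bexI[of _ "\<ominus>\<^bsub>A\<^esub> x"]) (auto simp: A.r_neg)
  show "k_algebra B"
  proof (rule k_algebraI)
    show "ring B"
      by (intro ringI abelian_groupI monoidI)
        (auto simp: car one zero s A.a_assoc A.a_comm A.m_assoc A.l_distr A.r_distr A.sm_mult A.a_lcomm
           ex)
  qed (auto simp: car one zero s A.sm_add_left A.sm_add_right A.sm_mult)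
  show "f \<in> alg_hom A B"
    unfolding alg_hom_def ring_hom_def by (auto simp: car one s)
qed

section \<open>Homomorphisms, generators and factor algebras\<close>

lemma alg_homI:
  assumes "\<And>x. x \<in> carrier A \<Longrightarrow> f x \<in> carrier B"
    and "\<And>x y. x \<in> carrier A \<Longrightarrow> y \<in> carrier A \<Longrightarrow> f (x \<otimes>\<^bsub>A\<^esub> y) = f x \<otimes>\<^bsub>B\<^esub> f y"
    and "\<And>x y. x \<in> carrier A \<Longrightarrow> y \<in> carrier A \<Longrightarrow> f (x \<oplus>\<^bsub>A\<^esub> y) = f x \<oplus>\<^bsub>B\<^esub> f y"
    and "f \<one>\<^bsub>A\<^esub> = \<one>\<^bsub>B\<^esub>"
    and "\<And>c x. x \<in> carrier A \<Longrightarrow> f (c \<odot>\<^bsub>A\<^esub> x) = c \<odot>\<^bsub>B\<^esub> f x"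
  shows "f \<in> alg_hom A B"
  using assms by (auto simp: alg_hom_def intro!: ring_hom_memI)

locale alg_hom_loc = A: k_algebra A + B: k_algebra B for A :: "('k::field, 'a) module" and
   B :: "('k, 'b) module" +
  fixes f assumes f: "f \<in> alg_hom A B"
begin

lemma closed [simp, intro]: "x \<in> carrier A \<Longrightarrow> f x \<in> carrier B"
  and mult: "x \<in> carrier A \<Longrightarrow> y \<in> carrier A \<Longrightarrow> f (x \<otimes>\<^bsub>A\<^esub> y) = f x \<otimes>\<^bsub>B\<^esub> f y"
  and add: "x \<in> carrier A \<Longrightarrow> y \<in> carrier A \<Longrightarrow> f (x \<oplus>\<^bsub>A\<^esub> y) = f x \<oplus>\<^bsub>B\<^esub> f y"
  and one: "f \<one>\<^bsub>A\<^esub> = \<one>\<^bsub>B\<^esub>"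
  and smult: "x \<in> carrier A \<Longrightarrow> f (c \<odot>\<^bsub>A\<^esub> x) = c \<odot>\<^bsub>B\<^esub> f x"
  using f by (auto simp: alg_hom_def ring_hom_def)

lemma zero: "f \<zero>\<^bsub>A\<^esub> = \<zero>\<^bsub>B\<^esub>"
  using smult[of "\<zero>\<^bsub>A\<^esub>" 0] by simp

lemma minus: "x \<in> carrier A \<Longrightarrow> f (\<ominus>\<^bsub>A\<^esub> x) = \<ominus>\<^bsub>B\<^esub> f x"
  using smult[of x "-1"] by (simp add: A.sm_minus_left B.sm_minus_left)

lemma diff: "x \<in> carrier A \<Longrightarrow> y \<in> carrier A \<Longrightarrow> f (x \<ominus>\<^bsub>A\<^esub> y) = f x \<ominus>\<^bsub>B\<^esub> f y"
  by (simp add: a_minus_def add minus)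

lemma hom_sum: "g \<in> S \<rightarrow> carrier A \<Longrightarrow> f (\<Oplus>\<^bsub>A\<^esub>i\<in>S. g i) = (\<Oplus>\<^bsub>B\<^esub>i\<in>S. f (g i))"
proof (induction S rule: infinite_finite_induct)
  case (insert x F)
  then have "g x \<in> carrier A" "g \<in> F \<rightarrow> carrier A" "(\<lambda>i. f (g i)) \<in> F \<rightarrow> carrier B" by auto
  with insert show ?case by (simp add: A.finsum_insert B.finsum_insert add A.finsum_closed)
qed (auto simp: zero)

lemmas simps = mult add one smult zero minus diff

end

lemma alg_hom_locI: "k_algebra A \<Longrightarrow> k_algebra B \<Longrightarrow> f \<in> alg_hom A B \<Longrightarrow> alg_hom_loc A B f"
  by (simp add: alg_hom_loc_def alg_hom_loc_axioms_def)

lemma alg_hom_comp: "f \<in> alg_hom A B \<Longrightarrow> g \<in> alg_hom B C \<Longrightarrow> g \<circ> f \<in> alg_hom A C"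
  unfolding alg_hom_def ring_hom_def by (simp add: Pi_iff)

lemma subalgI:
  assumes "k_algebra A" "S \<subseteq> carrier A" "\<one>\<^bsub>A\<^esub> \<in> S"
    and "\<And>x y. x \<in> S \<Longrightarrow> y \<in> S \<Longrightarrow> x \<oplus>\<^bsub>A\<^esub> y \<in> S"
    and "\<And>x y. x \<in> S \<Longrightarrow> y \<in> S \<Longrightarrow> x \<otimes>\<^bsub>A\<^esub> y \<in> S"
    and "\<And>c x. x \<in> S \<Longrightarrow> c \<odot>\<^bsub>A\<^esub> x \<in> S"
  shows "subalg S A"
proof -
  interpret k_algebra A by fact
  have "\<ominus>\<^bsub>A\<^esub> x \<in> S" if "x \<in> S" for x
    using that assms(2) assms(6)[of x "-1"] by (auto simp: sm_minus_left)
  then show ?thesis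
    unfolding subalg_def using assms(2-6) by (intro conjI subringI allI ballI) simp_all
qed

lemma subalgD:
  assumes "k_algebra A" "subalg S A"
  shows "x \<in> S \<Longrightarrow> x \<in> carrier A" "\<one>\<^bsub>A\<^esub> \<in> S" "\<zero>\<^bsub>A\<^esub> \<in> S"
    and "\<And>x y. x \<in> S \<Longrightarrow> y \<in> S \<Longrightarrow> x \<oplus>\<^bsub>A\<^esub> y \<in> S"
    and "\<And>x y. x \<in> S \<Longrightarrow> y \<in> S \<Longrightarrow> x \<ominus>\<^bsub>A\<^esub> y \<in> S"
    and "\<And>x y. x \<in> S \<Longrightarrow> y \<in> S \<Longrightarrow> x \<otimes>\<^bsub>A\<^esub> y \<in> S"
    and "\<And>c x. x \<in> S \<Longrightarrow> c \<odot>\<^bsub>A\<^esub> x \<in> S"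
    and "\<And>x. x \<in> S \<Longrightarrow> \<ominus>\<^bsub>A\<^esub> x \<in> S"
  using assms(2) by (auto simp: subalg_def a_minus_def dest: subringE)

definition generating :: "('k, 'a) module \<Rightarrow> 'a set \<Rightarrow> bool"
  where "generating A G \<longleftrightarrow> G \<subseteq> carrier A \<and> (\<forall>S \<in> {S. subalg S A \<and> G \<subseteq> S}. carrier A \<subseteq> S)"

lemma generating_image:
  assumes "k_algebra A" "k_algebra B" and f: "f \<in> alg_hom A B" and surj: "f ` carrier A = carrier B"
    and gen: "generating A G"
  shows "generating B (f ` G)"
  unfolding generating_def
proof (intro conjI ballI)
  interpret alg_hom_loc A B f by (rule alg_hom_locI) fact+
  have G: "G \<subseteq> carrier A" using gen by (simp add: generating_def)
  then show "f ` G \<subseteq> carrier B" by auto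
  fix S assume "S \<in> {S. subalg S B \<and> f ` G \<subseteq> S}"
  then have S: "subalg S B" "f ` G \<subseteq> S" by auto
  note D = subalgD[OF assms(2) S(1)]
  have "subalg {a \<in> carrier A. f a \<in> S} A"
  proof (rule subalgI[OF assms(1)])
    show "{a \<in> carrier A. f a \<in> S} \<subseteq> carrier A" by blast
    show "\<one>\<^bsub>A\<^esub> \<in> {a \<in> carrier A. f a \<in> S}" by (simp add: one D(2))
  qed (simp_all add: mult add smult D(4,6,7))
  moreover have "G \<subseteq> {a \<in> carrier A. f a \<in> S}" using S(2) G by auto
  ultimately have "carrier A \<subseteq> {a \<in> carrier A. f a \<in> S}"
    using gen by (simp add: generating_def)
  then show "carrier B \<subseteq> S" using surj by (metis (no_types, lifting) CollectD image_subsetI subsetD)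
qed

lemma generating_mono: "generating A G \<Longrightarrow> G \<subseteq> Y \<Longrightarrow> Y \<subseteq> carrier A \<Longrightarrow> generating A Y"
  unfolding generating_def by blast

lemma alg_quot_simps:
  "carrier (alg_quot A I) = a_rcosets\<^bsub>A\<^esub> I" "monoid.mult (alg_quot A I) = rcoset_mult A I"
  "one (alg_quot A I) = I +>\<^bsub>A\<^esub> \<one>\<^bsub>A\<^esub>" "zero (alg_quot A I) = I"
  "add (alg_quot A I) = set_add A"
  "module.smult (alg_quot A I) = (\<lambda>c B. \<Union>x\<in>B. I +>\<^bsub>A\<^esub> (c \<odot>\<^bsub>A\<^esub> x))"
  by (simp_all add: alg_quot_def FactRing_def)

lemma alg_quot:
  fixes A :: "('k::field, 'a) module" (structure)
  assumes "k_algebra A" "ideal I A"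
  shows "k_algebra (alg_quot A I)"
    and "(+>\<^bsub>A\<^esub>) I \<in> alg_hom A (alg_quot A I)"
    and "(+>\<^bsub>A\<^esub>) I ` carrier A = carrier (alg_quot A I)"
proof -
  interpret k_algebra A by fact
  interpret ideal I A by fact
  show car: "(+>) I ` carrier A = carrier (alg_quot A I)"
    by (auto simp: alg_quot_simps A_RCOSETS_def')
  \<comment> \<open>\<open>alg_quot\<close> defines a scalar multiple of a coset as the union of
    \<open>I + c y\<close> over all \<open>y\<close> in it. These cosets all coincide because the
    ideal is closed under scalars, by \<open>c i = (c 1) i\<close>.\<close>
  have sm: "I +> c \<odot> x = c \<odot>\<^bsub>alg_quot A I\<^esub> (I +> x)" if x: "x \<in> carrier A" for c x
  proof -
    have "I +> c \<odot> y = I +> c \<odot> x" if "y \<in> I +> x" for y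
    proof -
      obtain i where i: "i \<in> I" "y = i \<oplus> x"
        using \<open>y \<in> I +> x\<close> unfolding a_r_coset_def' by blast
      have iA: "i \<in> carrier A" using i a_Hcarr by blast
      have "c \<odot> i = (c \<odot> \<one>) \<otimes> i" using iA by (simp add: sm_mult)
      then have "c \<odot> i \<in> I" using i by (auto intro: I_l_closed)
      then have "c \<odot> i \<oplus> c \<odot> x \<in> I +> c \<odot> x"
        unfolding a_r_coset_def' by blast
      from a_repr_independence[OF this _ a_subgroup] show ?thesis
        using x iA by (simp add: i sm_add_right)
    qed
    moreover have "x \<in> I +> x" using a_rcos_self x by blast
    ultimately show ?thesis unfolding alg_quot_simps by blast
  qed
  note * = k_algebra_image[OF assms(1) car[symmetric], OF _ _ sm]
  have z: "I +> \<zero> = I" by (simp add: a_coset_add_zero a_subset)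
  show "k_algebra (alg_quot A I)"
    by (rule *(1); simp add: alg_quot_simps(1-5) rcoset_mult_add a_rcos_sum z)
  show "(+>) I \<in> alg_hom A (alg_quot A I)"
    by (rule *(2); simp add: alg_quot_simps(1-5) rcoset_mult_add a_rcos_sum z)
qed

lemma completely_primeD:
  assumes "k_algebra A" "completely_prime I A"
  shows "k_algebra (alg_quot A I)" "nc_domain (alg_quot A I)"
    "(+>\<^bsub>A\<^esub>) I \<in> alg_hom A (alg_quot A I)" "(+>\<^bsub>A\<^esub>) I ` carrier A = carrier (alg_quot A I)"
  using assms alg_quot[of A I] by (auto simp: completely_prime_def)

lemma nc_domainD:
  assumes "nc_domain R"
  shows "ring R" "\<one>\<^bsub>R\<^esub> \<noteq> \<zero>\<^bsub>R\<^esub>"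
    "a \<in> carrier R \<Longrightarrow> b \<in> carrier R \<Longrightarrow> a \<otimes>\<^bsub>R\<^esub> b = \<zero>\<^bsub>R\<^esub> \<Longrightarrow> a = \<zero>\<^bsub>R\<^esub> \<or> b = \<zero>\<^bsub>R\<^esub>"
  using assms by (auto simp: nc_domain_def)

section \<open>Ore localization\<close>

definition right_Ore :: "('a, 'm) ring_scheme \<Rightarrow> bool"
  where "right_Ore R \<longleftrightarrow> (\<forall>a\<in>carrier R. \<forall>b\<in>carrier R - {\<zero>\<^bsub>R\<^esub>}.
    \<exists>u\<in>carrier R. \<exists>v\<in>carrier R - {\<zero>\<^bsub>R\<^esub>}. a \<otimes>\<^bsub>R\<^esub> v = b \<otimes>\<^bsub>R\<^esub> u)"

text \<open>The fraction \<open>a b\<^sup>-\<^sup>1\<close> is encoded by its graph, the set of all pairs \<open>(c, d)\<close> such that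
  \<open>a b\<^sup>-\<^sup>1 d = c\<close>: a right submodule of \<open>R \<times> R\<close> which is the graph of a partial map, has a nonzero
  domain and is saturated. A product of fractions is then a composition of relations.\<close>

locale ore_domain = k_algebra R for R :: "('k::field, 'a) module" (structure) +
  assumes domain: "nc_domain R" and ore: "right_Ore R"
begin

lemma integral: "a \<in> carrier R \<Longrightarrow> b \<in> carrier R \<Longrightarrow> a \<otimes> b = \<zero> \<longleftrightarrow> a = \<zero> \<or> b = \<zero>"
  using nc_domainD(3)[OF domain] by auto

lemma one_neq_zero: "\<one> \<noteq> \<zero>"
  using nc_domainD(2)[OF domain] .

lemma common_multiple:
  assumes "a \<in> carrier R" "b \<in> carrier R" "b \<noteq> \<zero>"
  obtains u v where "u \<in> carrier R" "v \<in> carrier R" "v \<noteq> \<zero>" "a \<otimes> v = b \<otimes> u"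
proof -
  have "\<exists>u\<in>carrier R. \<exists>v\<in>carrier R - {\<zero>}. a \<otimes> v = b \<otimes> u"
    using assms by (intro bspec[OF bspec[OF ore[unfolded right_Ore_def]]]) auto
  then show ?thesis using that by blast
qed

lemma common_multiple2:
  assumes "a \<in> carrier R" "b \<in> carrier R" "a \<noteq> \<zero>" "b \<noteq> \<zero>"
  obtains u v where "u \<in> carrier R" "v \<in> carrier R" "u \<noteq> \<zero>" "v \<noteq> \<zero>" "a \<otimes> v = b \<otimes> u"
proof -
  obtain u v where *: "u \<in> carrier R" "v \<in> carrier R" "v \<noteq> \<zero>" "a \<otimes> v = b \<otimes> u"
    using common_multiple assms by metis
  moreover have "u \<noteq> \<zero>"
    using * assms integral[of a v] by auto
  ultimately show ?thesis using that by blast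
qed

definition graph :: "('a \<times> 'a) set \<Rightarrow> bool"
  where "graph G \<longleftrightarrow> G \<subseteq> carrier R \<times> carrier R \<and>
    (\<forall>a b a' b'. (a, b) \<in> G \<and> (a', b') \<in> G \<longrightarrow> (a \<oplus> a', b \<oplus> b') \<in> G) \<and>
    (\<forall>a b. \<forall>r\<in>carrier R. (a, b) \<in> G \<longrightarrow> (a \<otimes> r, b \<otimes> r) \<in> G) \<and>
    (\<forall>a. (a, \<zero>) \<in> G \<longrightarrow> a = \<zero>) \<and> (\<exists>a b. (a, b) \<in> G \<and> b \<noteq> \<zero>)"

text \<open>Saturation: a pair is added as soon as some multiple of it by a nonzero element is
  present. Graphs with different domains that describe the same fraction become equal in this
  way.\<close>

definition cl :: "('a \<times> 'a) set \<Rightarrow> ('a \<times> 'a) set"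
  where "cl G = {(a, b). a \<in> carrier R \<and> b \<in> carrier R \<and>
    (\<exists>v\<in>carrier R. v \<noteq> \<zero> \<and> (a \<otimes> v, b \<otimes> v) \<in> G)}"

lemma graphD:
  assumes "graph G"
  shows "(a, b) \<in> G \<Longrightarrow> a \<in> carrier R" "(a, b) \<in> G \<Longrightarrow> b \<in> carrier R"
    "(a, b) \<in> G \<Longrightarrow> (a', b') \<in> G \<Longrightarrow> (a \<oplus> a', b \<oplus> b') \<in> G"
    "(a, b) \<in> G \<Longrightarrow> r \<in> carrier R \<Longrightarrow> (a \<otimes> r, b \<otimes> r) \<in> G"
    "(a, \<zero>) \<in> G \<Longrightarrow> a = \<zero>"
    "\<exists>a b. (a, b) \<in> G \<and> b \<noteq> \<zero>"
  using assms unfolding graph_def by (blast | meson)+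

lemma graphI:
  assumes "\<And>a b. (a, b) \<in> G \<Longrightarrow> a \<in> carrier R \<and> b \<in> carrier R"
    "\<And>a b a' b'. (a, b) \<in> G \<Longrightarrow> (a', b') \<in> G \<Longrightarrow> (a \<oplus> a', b \<oplus> b') \<in> G"
    "\<And>a b r. (a, b) \<in> G \<Longrightarrow> r \<in> carrier R \<Longrightarrow> (a \<otimes> r, b \<otimes> r) \<in> G"
    "\<And>a. (a, \<zero>) \<in> G \<Longrightarrow> a = \<zero>"
    "\<exists>a b. (a, b) \<in> G \<and> b \<noteq> \<zero>"
  shows "graph G"
  using assms unfolding graph_def by auto

lemma graph_unique:
  assumes G: "graph G" and "(a, b) \<in> G" "(a', b) \<in> G"
  shows "a = a'"
proof -
  note c = graphD(1,2)[OF G assms(2)] graphD(1,2)[OF G assms(3)]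
  have "(a' \<otimes> (\<ominus> \<one>), b \<otimes> (\<ominus> \<one>)) \<in> G"
    using graphD(4)[OF G assms(3), of "\<ominus> \<one>"] by simp
  from graphD(3)[OF G assms(2) this] have "(a \<ominus> a', \<zero>) \<in> G"
    using c by (simp add: r_minus r_neg a_minus_def)
  then show ?thesis using graphD(5)[OF G] c by (metis r_right_minus_eq)
qed

lemma subset_cl: "graph G \<Longrightarrow> G \<subseteq> cl G"
proof (rule subrelI)
  fix a b assume "graph G" "(a, b) \<in> G"
  with graphD(1,2)[of G a b] one_neq_zero show "(a, b) \<in> cl G"
    by (auto simp: cl_def intro!: bexI[of _ \<one>])
qed

lemma graph_cl:
  assumes G: "graph G" shows "graph (cl G)"
proof (rule graphI)
  note D = graphD[OF G]
  fix a b a' b' assume "(a, b) \<in> cl G" "(a', b') \<in> cl G"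
  then obtain v v' where v: "v \<in> carrier R" "v \<noteq> \<zero>" "(a \<otimes> v, b \<otimes> v) \<in> G"
    and v': "v' \<in> carrier R" "v' \<noteq> \<zero>" "(a' \<otimes> v', b' \<otimes> v') \<in> G"
    and c [simp]: "a \<in> carrier R" "a' \<in> carrier R" "b \<in> carrier R" "b' \<in> carrier R"
    by (auto simp: cl_def)
  \<comment> \<open>The multipliers \<open>v\<close> and \<open>v'\<close> have a common right
    multiple, so a single multiplier works for both pairs.\<close>
  obtain s t where st [simp]: "s \<in> carrier R" "t \<in> carrier R" and n: "s \<noteq> \<zero>" "t \<noteq> \<zero>"
    and e: "v \<otimes> t = v' \<otimes> s"
    using common_multiple2[of v v'] v v' by metis
  have "(a \<otimes> v \<otimes> t \<oplus> a' \<otimes> v' \<otimes> s, b \<otimes> v \<otimes> t \<oplus> b' \<otimes> v' \<otimes> s) \<in> G"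
    using D(4)[OF v(3), of t] D(4)[OF v'(3), of s] by (intro D(3)) auto
  then have "((a \<oplus> a') \<otimes> (v \<otimes> t), (b \<oplus> b') \<otimes> (v \<otimes> t)) \<in> G"
    using v v' by (simp add: m_assoc e l_distr)
  moreover have "v \<otimes> t \<noteq> \<zero>" using v n integral by auto
  ultimately show "(a \<oplus> a', b \<oplus> b') \<in> cl G" using v by (auto simp: cl_def)
next
  note D = graphD[OF G]
  fix a b r assume "(a, b) \<in> cl G" and r [simp]: "r \<in> carrier R"
  then obtain v where v: "v \<in> carrier R" "v \<noteq> \<zero>" "(a \<otimes> v, b \<otimes> v) \<in> G"
    and c [simp]: "a \<in> carrier R" "b \<in> carrier R"
    by (auto simp: cl_def)
  \<comment> \<open>If \<open>v\<close> brings \<open>(a, b)\<close> into \<open>G\<close>, then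
    \<open>r t = v s\<close> makes \<open>t\<close> a multiplier for
    \<open>(a r, b r)\<close>.\<close>
  obtain s t where st [simp]: "s \<in> carrier R" "t \<in> carrier R" and n: "t \<noteq> \<zero>"
    and e: "r \<otimes> t = v \<otimes> s"
    using common_multiple[of r v] v r by metis
  have "(a \<otimes> v \<otimes> s, b \<otimes> v \<otimes> s) \<in> G"
    using D(4)[OF v(3) st(1)] .
  then have "(a \<otimes> r \<otimes> t, b \<otimes> r \<otimes> t) \<in> G"
    using v by (simp add: m_assoc e)
  then show "(a \<otimes> r, b \<otimes> r) \<in> cl G" using n by (auto simp: cl_def)
next
  note D = graphD[OF G]
  fix a assume "(a, \<zero>) \<in> cl G"
  then obtain v where v: "a \<in> carrier R" "v \<in> carrier R" "v \<noteq> \<zero>" "(a \<otimes> v, \<zero>) \<in> G"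
    by (auto simp: cl_def)
  with D(5)[OF v(4)] show "a = \<zero>" by (simp add: integral)
next
  note D = graphD[OF G]
  show "\<exists>a b. (a, b) \<in> cl G \<and> b \<noteq> \<zero>" using D(6) subset_cl[OF G] by blast
qed (auto simp: cl_def)

lemma cl_mono: "G \<subseteq> H \<Longrightarrow> cl G \<subseteq> cl H"
  unfolding cl_def by blast

lemma cl_cl:
  assumes G: "graph G" shows "cl (cl G) = cl G"
proof -
  have "(a, b) \<in> cl G" if ab: "(a, b) \<in> cl (cl G)" for a b
  proof -
    obtain v where v: "v \<in> carrier R" "v \<noteq> \<zero>" "(a \<otimes> v, b \<otimes> v) \<in> cl G"
      and c: "a \<in> carrier R" "b \<in> carrier R" using ab by (auto simp: cl_def)
    then obtain u where u: "u \<in> carrier R" "u \<noteq> \<zero>" "(a \<otimes> v \<otimes> u, b \<otimes> v \<otimes> u) \<in> G"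
      by (auto simp: cl_def)
    have "v \<otimes> u \<noteq> \<zero>" using u v by (simp add: integral)
    with u v c show ?thesis by (auto simp: cl_def m_assoc intro!: bexI[of _ "v \<otimes> u"])
  qed
  then show ?thesis using subset_cl[OF graph_cl[OF G]] by auto
qed

definition frac :: "('a \<times> 'a) set \<Rightarrow> bool"
  where "frac G \<longleftrightarrow> graph G \<and> cl G = G"

lemma frac_cl: "graph G \<Longrightarrow> frac (cl G)"
  by (simp add: frac_def graph_cl cl_cl)

text \<open>By the Ore condition each \<open>b\<close> has a right multiple \<open>b v\<close>, with
  \<open>v\<close> nonzero, in the domain of the smaller graph, and there the two partial maps
  agree. So a fraction is determined by any of its subgraphs.\<close>

lemma graph_subset_cl:
  assumes G: "graph G" and H: "graph H" and sub: "G \<subseteq> H"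
  shows "H \<subseteq> cl G"
proof
  fix p assume p: "p \<in> H"
  obtain a b where ab: "p = (a, b)" by force
  note c [simp] = graphD(1,2)[OF H p[unfolded ab]]
  obtain c d where cd: "(c, d) \<in> G" "d \<noteq> \<zero>" using graphD(6)[OF G] by blast
  note c' [simp] = graphD(1,2)[OF G cd(1)]
  obtain u v where uv [simp]: "u \<in> carrier R" "v \<in> carrier R" and v: "v \<noteq> \<zero>"
    and e: "b \<otimes> v = d \<otimes> u"
    using common_multiple[of b d] cd by auto
  have 1: "(c \<otimes> u, d \<otimes> u) \<in> G" using graphD(4)[OF G cd(1)] by simp
  have "(a \<otimes> v, b \<otimes> v) \<in> H" using graphD(4)[OF H, of a b v] p ab by simp
  moreover have "(c \<otimes> u, b \<otimes> v) \<in> H" using 1 sub e by auto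
  ultimately have "a \<otimes> v = c \<otimes> u" by (rule graph_unique[OF H])
  then show "p \<in> cl G" using v 1 e by (auto simp: ab cl_def intro!: bexI[of _ v])
qed

text \<open>The device behind the identities between fractions below: it is enough to exhibit one
  graph contained in both sides.\<close>

lemma cl_eqI:
  assumes "graph K" "graph G" "graph H" "K \<subseteq> G" "K \<subseteq> H"
  shows "cl G = cl H"
proof -
  have "cl G' = cl K" if "graph G'" "K \<subseteq> G'" for G'
    using graph_subset_cl[OF assms(1) that] cl_mono[of G' "cl K"] cl_mono[OF that(2)] cl_cl[OF assms(1)]
    by simp
  then show ?thesis using assms by metis
qed

definition psum :: "('a \<times> 'a) set \<Rightarrow> ('a \<times> 'a) set \<Rightarrow> ('a \<times> 'a) set"
  where "psum G H = {(a \<oplus> a', b) | a a' b. (a, b) \<in> G \<and> (a', b) \<in> H}"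

lemma psumI: "(a, b) \<in> G \<Longrightarrow> (a', b) \<in> H \<Longrightarrow> (a \<oplus> a', b) \<in> psum G H"
  unfolding psum_def by blast

lemma graph_psum:
  assumes G: "graph G" and H: "graph H" shows "graph (psum G H)"
proof (rule graphI)
  note D = graphD[OF G] and E = graphD[OF H]
  fix a b a' b' assume "(a, b) \<in> psum G H" "(a', b') \<in> psum G H"
  then obtain s t s' t' where *: "(s, b) \<in> G" "(t, b) \<in> H" "(s', b') \<in> G" "(t', b') \<in> H"
    "a = s \<oplus> t" "a' = s' \<oplus> t'" by (auto simp: psum_def)
  then have "a \<oplus> a' = (s \<oplus> s') \<oplus> (t \<oplus> t')" by (simp add: D(1) E(1) a_ac)
  with * D(3) E(3) show "(a \<oplus> a', b \<oplus> b') \<in> psum G H" unfolding psum_def by blast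
next
  note D = graphD[OF G] and E = graphD[OF H]
  fix a b r assume "(a, b) \<in> psum G H" and r: "r \<in> carrier R"
  then obtain s t where *: "(s, b) \<in> G" "(t, b) \<in> H" "a = s \<oplus> t" by (auto simp: psum_def)
  then have "a \<otimes> r = s \<otimes> r \<oplus> t \<otimes> r" using r by (simp add: D(1) E(1) l_distr)
  with * D(4) E(4) r show "(a \<otimes> r, b \<otimes> r) \<in> psum G H" unfolding psum_def by blast
next
  note D = graphD[OF G] and E = graphD[OF H]
  show "(a, b) \<in> psum G H \<Longrightarrow> a \<in> carrier R \<and> b \<in> carrier R" for a b
    using D(1,2) E(1) by (auto simp: psum_def)
  show "(a, \<zero>) \<in> psum G H \<Longrightarrow> a = \<zero>" for a
    using D(5) E(5) by (fastforce simp: psum_def)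
  obtain a b a' b' where ab: "(a, b) \<in> G" "b \<noteq> \<zero>" "(a', b') \<in> H" "b' \<noteq> \<zero>"
    using D(6) E(6) by blast
  then obtain u v where uv: "u \<in> carrier R" "v \<in> carrier R" "v \<noteq> \<zero>" "b \<otimes> v = b' \<otimes> u"
    using common_multiple2[of b b'] D(2) E(2) by metis
  then have "(a \<otimes> v \<oplus> a' \<otimes> u, b \<otimes> v) \<in> psum G H"
    using ab D(4)[of a b v] E(4)[of a' b' u] unfolding psum_def by auto
  moreover have "b \<otimes> v \<noteq> \<zero>" using ab uv D(2) integral by auto
  ultimately show "\<exists>a b. (a, b) \<in> psum G H \<and> b \<noteq> \<zero>" by blast
qed

lemma graph_comp:
  assumes G: "graph G" and H: "graph H" shows "graph (G O H)"
proof (rule graphI)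
  note D = graphD[OF G] and E = graphD[OF H]
  fix a b a' b' assume "(a, b) \<in> G O H" "(a', b') \<in> G O H"
  with D(3) E(3) show "(a \<oplus> a', b \<oplus> b') \<in> G O H" by blast
next
  note D = graphD[OF G] and E = graphD[OF H]
  fix a b r assume "(a, b) \<in> G O H" and r: "r \<in> carrier R"
  with D(4) E(4) r show "(a \<otimes> r, b \<otimes> r) \<in> G O H" by blast
next
  note D = graphD[OF G] and E = graphD[OF H]
  show "(a, b) \<in> G O H \<Longrightarrow> a \<in> carrier R \<and> b \<in> carrier R" for a b
    using D(1) E(2) by blast
  show "(a, \<zero>) \<in> G O H \<Longrightarrow> a = \<zero>" for a using D(5) E(5) by blast
  obtain a b' b c where ab: "(a, b') \<in> G" "b' \<noteq> \<zero>" "(b, c) \<in> H" "c \<noteq> \<zero>"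
    using D(6) E(6) by blast
  \<comment> \<open>Read as partial maps, \<open>H\<close> sends \<open>c\<close> to
    \<open>b\<close>, and \<open>G\<close> is defined at \<open>b'\<close>; the Ore condition moves
    \<open>b\<close> into the domain of \<open>G\<close>. As \<open>b\<close> may be zero, so may
    \<open>u\<close>, but \<open>c v\<close> is a nonzero element of the domain.\<close>
  then obtain u v where uv: "u \<in> carrier R" "v \<in> carrier R" "v \<noteq> \<zero>" "b \<otimes> v = b' \<otimes> u"
    using common_multiple[of b b'] D(2) E(1) by metis
  then have "(a \<otimes> u, c \<otimes> v) \<in> G O H"
    using ab D(4)[of a b' u] E(4)[of b c v] by (metis relcomp.relcompI)
  moreover have "c \<otimes> v \<noteq> \<zero>" using ab uv E(2) integral by auto
  ultimately show "\<exists>a b. (a, b) \<in> G O H \<and> b \<noteq> \<zero>" by blast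
qed

definition emb :: "'a \<Rightarrow> ('a \<times> 'a) set"
  where "emb r = {(r \<otimes> b, b) | b. b \<in> carrier R}"

lemma emb_mem: "r \<in> carrier R \<Longrightarrow> b \<in> carrier R \<Longrightarrow> a = r \<otimes> b \<Longrightarrow> (a, b) \<in> emb r"
  by (auto simp: emb_def)

lemma graph_emb: "r \<in> carrier R \<Longrightarrow> graph (emb r)"
  using one_neq_zero by (intro graphI) (auto simp: emb_def r_distr m_assoc)

lemma frac_emb: 
  assumes r: "r \<in> carrier R" shows "frac (emb r)"
proof -
  have "(a, b) \<in> emb r" if ab: "(a, b) \<in> cl (emb r)" for a b
  proof -
    obtain v where v: "a \<in> carrier R" "b \<in> carrier R" "v \<in> carrier R" "v \<noteq> \<zero>" "a \<otimes> v = r \<otimes> (b \<otimes> v)"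
      using ab by (auto simp: cl_def emb_def)
    then have "(a \<ominus> r \<otimes> b) \<otimes> v = \<zero>" using r by (simp add: m_assoc a_minus_def l_distr l_minus r_neg)
    then have "a = r \<otimes> b" using v r integral by auto
    then show ?thesis using v by (auto simp: emb_def)
  qed
  then show ?thesis using subset_cl graph_emb[OF r] by (auto simp: frac_def)
qed

section \<open>The division algebra of fractions\<close>

definition fadd where "fadd G H = cl (psum G H)"
definition fmult where "fmult G H = cl (G O H)"

definition Frac :: "('k, ('a \<times> 'a) set) module"
  where "Frac = \<lparr>carrier = {G. frac G}, monoid.mult = fmult, one = emb \<one>, zero = emb \<zero>,
     add = fadd, module.smult = (\<lambda>c G. fmult (emb (c \<odot> \<one>)) G)\<rparr>"

lemma frac_ops: "frac G \<Longrightarrow> frac H \<Longrightarrow> frac (fadd G H)" "frac G \<Longrightarrow> frac H \<Longrightarrow> frac (fmult G H)"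
  unfolding fadd_def fmult_def
  by (intro frac_cl graph_psum graph_comp; simp add: frac_def)+

lemma cl_eqI':
  assumes "graph K" "graph G" "frac H" "K \<subseteq> G" "K \<subseteq> H"
  shows "cl G = H"
  using cl_eqI[OF assms(1,2) _ assms(4,5)] assms(3) by (auto simp: frac_def)

lemma psum_mono: "G \<subseteq> G' \<Longrightarrow> H \<subseteq> H' \<Longrightarrow> psum G H \<subseteq> psum G' H'"
  unfolding psum_def by blast

context
  fixes G H L assumes G: "frac G" and H: "frac H" and L: "frac L"
begin

lemma graphs: "graph G" "graph H" "graph L"
  using G H L by (auto simp: frac_def)

lemmas gr = graphs graph_psum graph_comp graph_cl

text \<open>Composition of relations is associative before saturation, so \<open>G O H O L\<close>
  lies in both sides.\<close>

lemma fmult_assoc: "fmult (fmult G H) L = fmult G (fmult H L)"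
  unfolding fmult_def
  by (rule cl_eqI[of "G O H O L"]; (intro gr)?)
    (use subset_cl[of "G O H"] subset_cl[of "H O L"] gr in blast)+

lemma fadd_assoc: "fadd (fadd G H) L = fadd G (fadd H L)"
proof -
  have "psum (psum G H) L = psum G (psum H L)" (is "?l = ?r")
  proof (intro equalityI subrelI)
    fix a b assume "(a, b) \<in> ?l"
    then obtain s t u where "(s, b) \<in> G" "(t, b) \<in> H" "(u, b) \<in> L" "a = s \<oplus> t \<oplus> u" by (auto simp: psum_def)
    moreover from this have "a = s \<oplus> (t \<oplus> u)" using graphD(1) gr(1-3) by (metis a_assoc)
    ultimately show "(a, b) \<in> ?r" by (metis psumI)
  next
    fix a b assume "(a, b) \<in> ?r"
    then obtain s t u where "(s, b) \<in> G" "(t, b) \<in> H" "(u, b) \<in> L" "a = s \<oplus> (t \<oplus> u)" by (auto simp: psum_def)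
    moreover from this have "a = s \<oplus> t \<oplus> u" using graphD(1) gr(1-3) by (metis a_assoc)
    ultimately show "(a, b) \<in> ?l" by (metis psumI)
  qed
  then show ?thesis
    unfolding fadd_def
    by (intro cl_eqI[of "psum G (psum H L)"] gr) (metis psum_mono subset_cl gr order_refl)+
qed

lemma fadd_comm: "fadd G H = fadd H G"
proof -
  have "psum G H = psum H G"
    unfolding psum_def using graphD(1) graphs by (auto; metis a_comm)
  then show ?thesis by (simp add: fadd_def)
qed

lemma fmult_distr_right: "fmult (fadd G H) L = fadd (fmult G L) (fmult H L)"
  unfolding fmult_def fadd_def
proof (rule cl_eqI[of "psum G H O L"]; (intro gr)?)
  show "psum G H O L \<subseteq> cl (psum G H) O L" using subset_cl[of "psum G H"] gr by blast
  have "psum G H O L \<subseteq> psum (G O L) (H O L)" by (auto simp: psum_def)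
  also have "\<dots> \<subseteq> psum (cl (G O L)) (cl (H O L))" by (intro psum_mono subset_cl gr)
  finally show "psum G H O L \<subseteq> psum (cl (G O L)) (cl (H O L))" .
qed

text \<open>\<open>L O psum G H\<close> can have a larger domain than the sum of the two products,
  for \<open>L\<close> may be defined at a sum without being defined at the summands. The common
  subgraph is therefore the sum of the products, which additivity of \<open>L\<close> places inside
  the other side.\<close>

lemma fmult_distr_left: "fmult L (fadd G H) = fadd (fmult L G) (fmult L H)"
  unfolding fmult_def fadd_def
proof (rule cl_eqI[of "psum (L O G) (L O H)"]; (intro gr)?)
  have "psum (L O G) (L O H) \<subseteq> L O psum G H"
    using graphD(3)[OF graphs(3)] by (fastforce simp: psum_def)
  also have "\<dots> \<subseteq> L O cl (psum G H)" using subset_cl[of "psum G H"] gr by blast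
  finally show "psum (L O G) (L O H) \<subseteq> L O cl (psum G H)" .
  show "psum (L O G) (L O H) \<subseteq> psum (cl (L O G)) (cl (L O H))" by (intro psum_mono subset_cl gr)
qed

lemma fmult_one: "fmult (emb \<one>) G = G" "fmult G (emb \<one>) = G"
proof -
  note D = graphD[OF graphs(1)]
  have "(a, a) \<in> emb \<one>" if "a \<in> carrier R" for a using that by (intro emb_mem) auto
  then have "G \<subseteq> emb \<one> O G" "G \<subseteq> G O emb \<one>"
    by (meson D(1,2) relcompI subrelI)+
  moreover have "graph (emb \<one> O G)" "graph (G O emb \<one>)" by (intro gr graph_emb one_closed)+
  ultimately show "fmult (emb \<one>) G = G" "fmult G (emb \<one>) = G"
    unfolding fmult_def by (metis cl_eqI' G graphs(1) order_refl)+
qed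

lemma fadd_zero: "fadd (emb \<zero>) G = G"
proof -
  have "G \<subseteq> psum (emb \<zero>) G"
  proof (rule subrelI)
    fix a b assume *: "(a, b) \<in> G"
    note c = graphD(1,2)[OF graphs(1) *]
    have "(\<zero>, b) \<in> emb \<zero>" using c by (intro emb_mem) auto
    from psumI[OF this *] show "(a, b) \<in> psum (emb \<zero>) G" using c by simp
  qed
  moreover have "graph (psum (emb \<zero>) G)" by (intro gr graph_emb zero_closed)
  ultimately show ?thesis
    unfolding fadd_def by (metis cl_eqI' G graphs(1) order_refl)
qed

lemma fadd_neg: "fadd (fmult (emb (\<ominus> \<one>)) G) G = emb \<zero>"
  unfolding fadd_def
proof (rule cl_eqI'[of "psum (emb (\<ominus> \<one>) O G) G"]; (intro gr graph_emb frac_emb)?)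
  show "psum (emb (\<ominus> \<one>) O G) G \<subseteq> psum (fmult (emb (\<ominus> \<one>)) G) G"
    unfolding fmult_def by (intro psum_mono subset_cl gr graph_emb) auto
  show "psum (emb (\<ominus> \<one>) O G) G \<subseteq> emb \<zero>"
  proof
    fix p assume "p \<in> psum (emb (\<ominus> \<one>) O G) G"
    then obtain a a' b where p: "p = (\<ominus> \<one> \<otimes> a \<oplus> a', b)" "(a, b) \<in> G" "(a', b) \<in> G"
      by (auto simp: psum_def emb_def)
    then have "a = a'" using graph_unique graphs(1) by blast
    with p show "p \<in> emb \<zero>" using graphD(1,2)[OF graphs(1) p(2)]
      by (auto simp: emb_def l_minus l_neg)
  qed
  show "graph (fmult (emb (\<ominus> \<one>)) G)"
    unfolding fmult_def by (intro gr graph_emb) simp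
qed simp_all

end

lemma frac_graph: "frac G \<Longrightarrow> graph G" by (simp add: frac_def)

lemma fmult_eqI:
  assumes "frac G" "frac H" "frac L" "graph K" "K \<subseteq> G O H" "K \<subseteq> L"
  shows "fmult G H = L"
  unfolding fmult_def using assms by (intro cl_eqI'[of K] graph_comp) (auto simp: frac_def)

lemma emb_add:
  assumes "a \<in> carrier R" "b \<in> carrier R" shows "emb (a \<oplus> b) = fadd (emb a) (emb b)"
  unfolding fadd_def
proof (rule cl_eqI'[symmetric, of "emb (a \<oplus> b)"])
  show "emb (a \<oplus> b) \<subseteq> psum (emb a) (emb b)"
    using assms by (auto simp: psum_def emb_def l_distr)
qed (use assms in \<open>auto intro: graph_psum graph_emb frac_emb\<close>)

lemma emb_mult:
  assumes "a \<in> carrier R" "b \<in> carrier R" shows "emb (a \<otimes> b) = fmult (emb a) (emb b)"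
proof (rule fmult_eqI[symmetric, of _ _ _ "emb (a \<otimes> b)"])
  show "emb (a \<otimes> b) \<subseteq> emb a O emb b"
  proof (rule subrelI)
    fix s t assume "(s, t) \<in> emb (a \<otimes> b)"
    then have "t \<in> carrier R" "s = a \<otimes> (b \<otimes> t)" using assms by (auto simp: emb_def m_assoc)
    with assms show "(s, t) \<in> emb a O emb b" by (auto simp: emb_def)
  qed
qed (use assms in \<open>auto intro: graph_emb frac_emb\<close>)

text \<open>Scalars are central among the fractions: a graph is closed under right multiplication by
  \<open>c 1\<close>, and on elements of \<open>R\<close> this agrees with left
  multiplication.\<close>

lemma emb_scalar_comm:
  assumes G: "frac G" shows "fmult (emb (c \<odot> \<one>)) G = fmult G (emb (c \<odot> \<one>))"
proof -
  note D = graphD[OF frac_graph[OF G]]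
  let ?e = "emb (c \<odot> \<one>)"
  have g: "graph (?e O G)" "graph (G O ?e)" using G by (auto intro: graph_comp graph_emb frac_graph)
  have "?e O G \<subseteq> G O ?e"
  proof (rule subrelI)
    fix a b assume "(a, b) \<in> ?e O G"
    then obtain d where d: "(d, b) \<in> G" "a = (c \<odot> \<one>) \<otimes> d" by (auto simp: emb_def)
    note cc = D(1,2)[OF d(1)]
    have "(a, (c \<odot> \<one>) \<otimes> b) \<in> G"
      using D(4)[OF d(1), of "c \<odot> \<one>"] cc d(2) by (simp add: sm_mult)
    moreover have "((c \<odot> \<one>) \<otimes> b, b) \<in> ?e" using cc by (intro emb_mem) auto
    ultimately show "(a, b) \<in> G O ?e" by blast
  qed
  then show ?thesis unfolding fmult_def using cl_eqI[OF g(1) g] by blast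
qed

lemma Frac_simps:
  "carrier Frac = {G. frac G}" "monoid.mult Frac = fmult" "one Frac = emb \<one>" "zero Frac = emb \<zero>"
  "add Frac = fadd" "module.smult Frac c G = fmult (emb (c \<odot> \<one>)) G"
  by (simp_all add: Frac_def)

lemma k_algebra_Frac: "k_algebra Frac"
proof (rule k_algebraI)
  have neg: "\<exists>H. frac H \<and> fadd H G = emb \<zero>" if "frac G" for G
    using fadd_neg[OF that that that] frac_ops(2)[OF frac_emb[of "\<ominus> \<one>"] that] by auto
  have comm: "fadd G H = fadd H G" if "frac G" "frac H" for G H
    using fadd_comm[of G H G] that by simp
  have "\<exists>y. frac y \<and> fadd y x = emb \<zero>" if "frac x" for x using neg that .
  then show "ring Frac"
    by (intro ringI abelian_groupI monoidI;
        simp add: Frac_simps frac_emb frac_ops fadd_assoc fmult_assoc fmult_one fadd_zero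
          fmult_distr_right fmult_distr_left; use comm in blast)
next
  fix a b :: 'k and G assume G: "G \<in> carrier Frac"
  then show "(a + b) \<odot>\<^bsub>Frac\<^esub> G = a \<odot>\<^bsub>Frac\<^esub> G \<oplus>\<^bsub>Frac\<^esub> b \<odot>\<^bsub>Frac\<^esub> G"
    by (simp add: Frac_simps sm_add_left emb_add fmult_distr_right frac_emb)
  have "(a * b) \<odot> \<one> = (a \<odot> \<one>) \<otimes> (b \<odot> \<one>)" by (simp add: sm_mult mult.commute)
  with G show "(a * b) \<odot>\<^bsub>Frac\<^esub> G = a \<odot>\<^bsub>Frac\<^esub> (b \<odot>\<^bsub>Frac\<^esub> G)"
    by (simp only: Frac_simps) (simp add: emb_mult fmult_assoc frac_emb)
next
  fix c :: 'k and G H assume "G \<in> carrier Frac" "H \<in> carrier Frac"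
  then have GH: "frac G" "frac H" by (auto simp: Frac_simps)
  then show "c \<odot>\<^bsub>Frac\<^esub> G \<otimes>\<^bsub>Frac\<^esub> H = c \<odot>\<^bsub>Frac\<^esub> (G \<otimes>\<^bsub>Frac\<^esub> H)"
    by (simp add: Frac_simps fmult_assoc frac_emb)
  have "frac (emb (c \<odot> \<one>))" by (simp add: frac_emb)
  then show "G \<otimes>\<^bsub>Frac\<^esub> (c \<odot>\<^bsub>Frac\<^esub> H) = c \<odot>\<^bsub>Frac\<^esub> (G \<otimes>\<^bsub>Frac\<^esub> H)"
    using GH by (simp add: Frac_simps flip: fmult_assoc emb_scalar_comm)
qed (auto simp: Frac_simps frac_ops frac_emb fmult_distr_left fmult_one)

text \<open>The inverse of \<open>a b^-1\<close> is \<open>b a^-1\<close>, encoded by the converse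
  relation. The converse is again the graph of a partial map because a nonzero fraction annihilates
  no nonzero element, \<open>R\<close> being a domain.\<close>

lemma fmult_converse:
  assumes G: "frac G" "G \<noteq> emb \<zero>"
  shows "frac (converse G)" "fmult G (converse G) = emb \<one>" "fmult (converse G) G = emb \<one>"
proof -
  note g = frac_graph[OF G(1)]
  note D = graphD[OF g]
  have "\<exists>a b. (a, b) \<in> G \<and> a \<noteq> \<zero>"
  proof (rule ccontr)
    assume "\<not> ?thesis"
    then have "G \<subseteq> emb \<zero>" using D(1,2) by (fastforce simp: emb_def)
    then have "cl G = emb \<zero>" using cl_eqI'[OF g g frac_emb[OF zero_closed]] by blast
    with G show False by (simp add: frac_def)
  qed
  then obtain a0 b0 where ab0: "(a0, b0) \<in> G" "a0 \<noteq> \<zero>" by blast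
  have g': "graph (converse G)"
  proof (rule graphI)
    fix b assume "(b, \<zero>) \<in> converse G"
    then have b: "(\<zero>, b) \<in> G" by simp
    show "b = \<zero>"
    proof (rule ccontr)
      assume "b \<noteq> \<zero>"
      \<comment> \<open>At a common multiple of \<open>b\<close> and \<open>b0\<close> the graph
        would have both values \<open>0\<close> and \<open>a0 u\<close>, although \<open>a0\<close>
        and \<open>u\<close> are nonzero.\<close>
      with common_multiple2[of b b0] D(2)[OF b] D(2)[OF ab0(1)] D(5) ab0
      obtain u v where uv: "u \<in> carrier R" "v \<in> carrier R" "u \<noteq> \<zero>" "b \<otimes> v = b0 \<otimes> u" by metis
      have "(\<zero> \<otimes> v, b \<otimes> v) \<in> G" "(a0 \<otimes> u, b \<otimes> v) \<in> G"
        using D(4)[OF b uv(2)] D(4)[OF ab0(1) uv(1)] by (simp_all add: uv)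
      then have "\<zero> \<otimes> v = a0 \<otimes> u" by (rule graph_unique[OF g])
      with uv ab0 integral D(1)[OF ab0(1)] show False by auto
    qed
  qed (use D ab0 in auto)
  have "(a, b) \<in> G" if "(b, a) \<in> cl (converse G)" for a b
  proof -
    have "(a, b) \<in> cl G" using that by (auto simp: cl_def)
    then show ?thesis using G by (simp add: frac_def)
  qed
  then show fc: "frac (converse G)" using subset_cl[OF g'] g' by (auto simp: frac_def)
  have e: "(a, a) \<in> emb \<one>" if "a \<in> carrier R" for a using that by (intro emb_mem) auto
  have "G O converse G \<subseteq> emb \<one>"
  proof (rule subrelI)
    fix a c assume "(a, c) \<in> G O converse G"
    then obtain b where ab: "(a, b) \<in> G" "(c, b) \<in> G" by blast
    from graph_unique[OF g ab] e[OF D(1)[OF ab(1)]] show "(a, c) \<in> emb \<one>" by simp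
  qed
  moreover have "converse G O G \<subseteq> emb \<one>"
  proof (rule subrelI)
    fix b c assume "(b, c) \<in> converse G O G"
    then obtain a where ab: "(a, b) \<in> G" "(a, c) \<in> G" by blast
    from graph_unique[OF g', of b a c] ab e[OF D(2)[OF ab(1)]] show "(b, c) \<in> emb \<one>" by simp
  qed
  ultimately show "fmult G (converse G) = emb \<one>" "fmult (converse G) G = emb \<one>"
    by (intro fmult_eqI[OF G(1) fc frac_emb graph_comp[OF g g'] order_refl]
        fmult_eqI[OF fc G(1) frac_emb graph_comp[OF g' g] order_refl] one_closed; simp)+
qed

lemma emb_eq_zero: "a \<in> carrier R \<Longrightarrow> emb a = emb \<zero> \<longleftrightarrow> a = \<zero>"
  using emb_mem[of a \<one> a] emb_def[of \<zero>] by auto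

lemma division_algebra_Frac: "division_algebra Frac"
proof -
  interpret F: k_algebra Frac by (rule k_algebra_Frac)
  have ne: "\<one>\<^bsub>Frac\<^esub> \<noteq> \<zero>\<^bsub>Frac\<^esub>"
    using emb_eq_zero[of \<one>] one_neq_zero by (simp add: Frac_simps)
  have "G \<in> Units Frac" if "G \<in> carrier Frac" "G \<noteq> \<zero>\<^bsub>Frac\<^esub>" for G
    using fmult_converse[of G] that unfolding Units_def by (auto simp: Frac_simps)
  moreover have "\<zero>\<^bsub>Frac\<^esub> \<notin> Units Frac"
    using ne F.Units_l_inv[of "\<zero>\<^bsub>Frac\<^esub>"] F.r_null[OF F.Units_inv_closed] by metis
  moreover have "Units Frac \<subseteq> carrier Frac" by (auto simp: Units_def)
  ultimately show ?thesis
    unfolding division_algebra_def using k_algebra_Frac ne by blast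
qed

lemma is_Fract_Frac: "is_Fract Frac emb R"
  unfolding is_Fract_def
proof (intro conjI ballI)
  interpret F: k_algebra Frac by (rule k_algebra_Frac)
  show "division_algebra Frac" by (rule division_algebra_Frac)
  show hom: "emb \<in> alg_hom R Frac"
  proof (rule alg_homI)
    fix c x assume x: "x \<in> carrier R"
    have "c \<odot> x = (c \<odot> \<one>) \<otimes> x" using x by (simp add: sm_mult)
    then show "emb (c \<odot> x) = c \<odot>\<^bsub>Frac\<^esub> emb x"
      using x by (simp only: Frac_simps) (simp add: emb_mult)
  qed (simp_all add: Frac_simps emb_add emb_mult frac_emb)
  show "inj_on emb (carrier R)"
  proof (rule inj_onI)
    fix a b assume "a \<in> carrier R" "b \<in> carrier R" "emb a = emb b"
    moreover have "(a, \<one>) \<in> emb a" using \<open>a \<in> carrier R\<close> by (intro emb_mem) auto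
    ultimately show "a = b" by (auto simp: emb_def)
  qed
  fix d assume "d \<in> carrier Frac"
  then have d: "frac d" by (simp add: Frac_simps)
  note D = graphD[OF frac_graph[OF d]]
  obtain a b where ab: "(a, b) \<in> d" "b \<noteq> \<zero>" using D(6) by blast
  note c = D(1,2)[OF ab(1)]
  \<comment> \<open>A pair \<open>(a, b)\<close> of \<open>d\<close> with nonzero \<open>b\<close>
    exhibits \<open>d\<close> as \<open>a b^-1\<close>: multiplying by \<open>b\<close> on the right
    gives a relation that contains the graph of \<open>a\<close>.\<close>
  have "emb a \<subseteq> d O emb b"
  proof (rule subrelI)
    fix s t assume "(s, t) \<in> emb a"
    then have "s = a \<otimes> t" "t \<in> carrier R" by (auto simp: emb_def)
    with D(4)[OF ab(1)] emb_mem[OF c(2)] show "(s, t) \<in> d O emb b" by blast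
  qed
  then have *: "d \<otimes>\<^bsub>Frac\<^esub> emb b = emb a"
    unfolding Frac_simps using c d by (intro fmult_eqI[of _ _ _ "emb a"] frac_emb graph_emb) auto
  have u: "emb b \<in> Units Frac"
    using division_algebra_Frac c ab emb_eq_zero[of b]
    by (auto simp: division_algebra_def Frac_simps frac_emb)
  have "emb a \<otimes>\<^bsub>Frac\<^esub> inv\<^bsub>Frac\<^esub> emb b = d"
    using \<open>d \<in> carrier Frac\<close> u by (simp add: *[symmetric] F.m_assoc F.Units_closed)
  then show "\<exists>a\<in>carrier R. \<exists>b\<in>carrier R - {\<zero>}. d = emb a \<otimes>\<^bsub>Frac\<^esub> inv\<^bsub>Frac\<^esub> emb b"
    using c ab by auto
qed

end

section \<open>Polynomial growth implies the Ore condition\<close>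

text \<open>Spans are introduced inductively so that closure under products and homomorphic images
  follows by rule induction; they are identified with \<open>Span\<close> when dimensions are
  counted.\<close>

inductive_set lspan :: "('k, 'a) module \<Rightarrow> 'a set \<Rightarrow> 'a set"
  for A :: "('k, 'a) module" and S :: "'a set" where
  zero: "\<zero>\<^bsub>A\<^esub> \<in> lspan A S"
| base: "x \<in> S \<Longrightarrow> x \<in> lspan A S"
| add: "x \<in> lspan A S \<Longrightarrow> y \<in> lspan A S \<Longrightarrow> x \<oplus>\<^bsub>A\<^esub> y \<in> lspan A S"
| smult: "x \<in> lspan A S \<Longrightarrow> c \<odot>\<^bsub>A\<^esub> x \<in> lspan A S"

lemma lspan_subset: "S \<subseteq> lspan A T \<Longrightarrow> x \<in> lspan A S \<Longrightarrow> x \<in> lspan A T"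
  by (erule lspan.induct) (auto intro: lspan.intros)

lemma lspan_mono: "S \<subseteq> T \<Longrightarrow> x \<in> lspan A S \<Longrightarrow> x \<in> lspan A T"
  by (rule lspan_subset) (auto intro: lspan.base)

lemma (in k_algebra) lspan_closed: "S \<subseteq> carrier A \<Longrightarrow> x \<in> lspan A S \<Longrightarrow> x \<in> carrier A"
  by (erule lspan.induct) auto

lemma (in k_algebra) lspan_mult:
  assumes S: "S \<subseteq> carrier A" and T: "T \<subseteq> carrier A"
    and ST: "\<And>s t. s \<in> S \<Longrightarrow> t \<in> T \<Longrightarrow> s \<otimes> t \<in> lspan A U"
    and x: "x \<in> lspan A S" and y: "y \<in> lspan A T"
  shows "x \<otimes> y \<in> lspan A U"
proof -
  have 1: "s \<otimes> y \<in> lspan A U" if s: "s \<in> S" for s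
    using y
  proof induction
    case zero
    have "s \<in> carrier A" using s S by auto
    then show ?case by (simp add: lspan.zero)
  next
    case (add u v)
    then have "s \<otimes> (u \<oplus> v) = s \<otimes> u \<oplus> s \<otimes> v"
      using s S lspan_closed[OF T] by (intro r_distr) auto
    then show ?case using add by (auto intro: lspan.add)
  next
    case (smult u c)
    then have "s \<otimes> (c \<odot> u) = c \<odot> (s \<otimes> u)" using s S lspan_closed[OF T] by (auto simp: sm_mult)
    then show ?case using smult by (auto intro: lspan.smult)
  qed (use s S ST in \<open>auto intro: lspan.intros\<close>)
  have yc: "y \<in> carrier A" using lspan_closed[OF T y] .
  show ?thesis
    using x
  proof induction
    case (add u v)
    then have "(u \<oplus> v) \<otimes> y = u \<otimes> y \<oplus> v \<otimes> y"
      using yc lspan_closed[OF S] by (intro l_distr) auto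
    then show ?case using add by (auto intro: lspan.add)
  next
    case (smult u c)
    then have "(c \<odot> u) \<otimes> y = c \<odot> (u \<otimes> y)" using yc lspan_closed[OF S] by (auto simp: sm_mult)
    then show ?case using smult by (auto intro: lspan.smult)
  qed (use yc 1 in \<open>auto intro: lspan.intros\<close>)
qed

lemma (in k_algebra) lspan_finsum:
  assumes "\<And>i. i \<in> I \<Longrightarrow> f i \<in> lspan A S" "S \<subseteq> carrier A"
  shows "(\<Oplus>i\<in>I. f i) \<in> lspan A S"
  using assms(1)
proof (induction I rule: infinite_finite_induct)
  case (insert i I)
  then have "f i \<in> carrier A" "f \<in> I \<rightarrow> carrier A" using lspan_closed[OF assms(2)] by auto
  with insert show ?case by (simp add: finsum_insert lspan.add)
qed (auto intro: lspan.zero)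

lemma (in alg_hom_loc) lspan_image:
  assumes "S \<subseteq> carrier A" "x \<in> lspan A S" shows "f x \<in> lspan B (f ` S)"
  using assms(2)
proof induction
  case (add x y)
  then show ?case using A.lspan_closed[OF assms(1)] by (auto simp: simps intro: lspan.add)
next
  case (smult x c)
  then show ?case using A.lspan_closed[OF assms(1)] by (auto simp: simps intro: lspan.smult)
qed (auto simp: zero intro: lspan.intros)

section \<open>Dimensions of spans and the growth argument\<close>

lemma scalarsI: "c \<odot>\<^bsub>A\<^esub> \<one>\<^bsub>A\<^esub> \<in> scalars A"
  by (auto simp: scalars_def)

text \<open>\<open>Span\<close> and \<open>dimension\<close> refer to a subfield of the ring itself;
  the copy \<open>k 1\<close> of the ground field takes that place.\<close>

lemma (in k_algebra) subfield_scalars: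
  assumes "\<one> \<noteq> \<zero>" shows "subfield (scalars A) A"
proof (rule ring.subfield_iff(1)[OF ring_A])
  show sub: "scalars A \<subseteq> carrier A" by (auto simp: scalars_def)
  have inj: "c \<odot> \<one> = \<zero> \<longleftrightarrow> c = 0" for c
    using assms sm_eq_zero[of c \<one>] by auto
  have add: "a \<odot> \<one> \<oplus> b \<odot> \<one> = (a + b) \<odot> \<one>" for a b by (simp add: sm_add_left)
  have mult: "(a \<odot> \<one>) \<otimes> (b \<odot> \<one>) = (a * b) \<odot> \<one>" for a b by (simp add: sm_mult mult.commute)
  have minus: "\<ominus> (a \<odot> \<one>) = (- a) \<odot> \<one>" for a by (simp add: sm_minus_left)
  have "subring (scalars A) A"
  proof (rule subringI[OF sub])
    show "\<one> \<in> scalars A" using scalarsI[of A 1] by simp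
  qed (auto simp: scalars_def add mult minus)
  then have r: "ring (A\<lparr>carrier := scalars A\<rparr>)" by (rule subring_is_ring)
  have c: "cring (A\<lparr>carrier := scalars A\<rparr>)"
  proof (intro cring.intro r comm_monoid.intro comm_monoid_axioms.intro)
    show "monoid (A\<lparr>carrier := scalars A\<rparr>)" using r by (simp add: ring_def)
  qed (auto simp: scalars_def mult mult.commute)
  show "field (A\<lparr>carrier := scalars A\<rparr>)"
  proof (rule cring.cring_fieldI2[OF c])
    show "\<zero>\<^bsub>A\<lparr>carrier := scalars A\<rparr>\<^esub> \<noteq> \<one>\<^bsub>A\<lparr>carrier := scalars A\<rparr>\<^esub>" using assms by simp
    fix a assume a: "a \<in> carrier (A\<lparr>carrier := scalars A\<rparr>)" "a \<noteq> \<zero>\<^bsub>A\<lparr>carrier := scalars A\<rparr>\<^esub>"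
    then obtain c where c: "a = c \<odot> \<one>" "c \<noteq> 0" by (auto simp: scalars_def inj)
    then have "a \<otimes> (inverse c \<odot> \<one>) = \<one>" by (simp add: mult)
    then show "\<exists>b\<in>carrier (A\<lparr>carrier := scalars A\<rparr>).
        a \<otimes>\<^bsub>A\<lparr>carrier := scalars A\<rparr>\<^esub> b = \<one>\<^bsub>A\<lparr>carrier := scalars A\<rparr>\<^esub>"
      using scalarsI[of A "inverse c"] by auto
  qed
qed

lemma (in k_algebra) lspan_eq_Span:
  assumes "\<one> \<noteq> \<zero>" and xs: "set xs \<subseteq> carrier A"
  shows "lspan A (set xs) = Span (scalars A) xs"
proof
  note K = subfield_scalars[OF assms(1)]
  note P = Span_subgroup_props[OF K xs] Span_smult_closed[OF K xs]
  show "lspan A (set xs) \<subseteq> Span (scalars A) xs"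
  proof
    fix x assume "x \<in> lspan A (set xs)"
    then show "x \<in> Span (scalars A) xs"
    proof induction
      case (base x)
      then show ?case using Span_base_incl[OF K xs] by auto
    next
      case (smult x c)
      then have "x \<in> carrier A" using P(1) by auto
      then have "c \<odot> x = (c \<odot> \<one>) \<otimes> x" by (simp add: sm_mult)
      then show ?case using P(5)[OF scalarsI[of A c]] smult by simp
    qed (use P in auto)
  qed
  have "combine Ks ys \<in> lspan A (set xs)" if "set Ks \<subseteq> scalars A" "set ys \<subseteq> set xs" for Ks ys
    using that
  proof (induction Ks ys rule: combine.induct)
    case (1 k Ks u Us)
    then obtain c where c: "k = c \<odot> \<one>" by (auto simp: scalars_def)
    have "k \<otimes> u = c \<odot> u" using 1 xs by (auto simp: c sm_mult)
    then show ?case using 1 by (auto intro: lspan.add lspan.smult lspan.base)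
  qed (auto intro: lspan.zero)
  then show "Span (scalars A) xs \<subseteq> lspan A (set xs)"
    using Span_mem_iff_length_version[OF K xs] by (metis order_refl subsetI)
qed

lemma (in k_algebra) dimension_lspan:
  assumes "\<one> \<noteq> \<zero>" "finite S" "S \<subseteq> carrier A"
  shows "\<exists>m \<le> card S. dimension m (scalars A) (lspan A S)"
proof -
  note K = subfield_scalars[OF assms(1)]
  obtain xs where xs: "set xs = S" "distinct xs" using finite_distinct_list[OF assms(2)] by blast
  then have c: "set xs \<subseteq> carrier A" using assms(3) by simp
  \<comment> \<open>The vectors of a spanning list are added one at a time: one that already lies in
    the span leaves the dimension unchanged, any other raises it by one.\<close>
  have "\<exists>m \<le> length ys. dimension m (scalars A) (Span (scalars A) ys)" if "set ys \<subseteq> carrier A" for ys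
    using that
  proof (induction ys)
    case (Cons y ys)
    then have ys: "set ys \<subseteq> carrier A" "y \<in> carrier A" by auto
    obtain m where m: "m \<le> length ys" "dimension m (scalars A) (Span (scalars A) ys)"
      using Cons.IH[OF ys(1)] by blast
    show ?case
    proof (cases "y \<in> Span (scalars A) ys")
      case True
      then have "set (y # ys) \<subseteq> Span (scalars A) ys" using Span_base_incl[OF K ys(1)] by auto
      from mono_Span_subset[OF K this ys(1)] mono_Span[OF K ys]
      have "Span (scalars A) (y # ys) = Span (scalars A) ys" by blast
      then show ?thesis using m by (intro exI[of _ m]) (simp del: Span.simps)
    next
      case False
      from Suc_dim[OF ys(2) this m(2)] m(1) show ?thesis by (intro exI[of _ "Suc m"]) simp
    qed
  qed auto
  then show ?thesis using lspan_eq_Span[OF assms(1) c] xs c distinct_card by metis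
qed

text \<open>In a domain left multiplication by a nonzero \<open>a\<close> is injective, and it is
  linear because scalars are central. So it carries the chain of line extensions that builds
  \<open>E\<close> to another such chain.\<close>

lemma (in k_algebra) dimension_mult_left:
  assumes dom: "nc_domain A" and a: "a \<in> carrier A" "a \<noteq> \<zero>"
    and dim: "dimension n (scalars A) E"
  shows "dimension n (scalars A) ((\<otimes>) a ` E)"
  using dim
proof (induction n "scalars A" E rule: dimension.induct)
  case zero_dim
  then show ?case using a by simp
next
  case (Suc_dim v E n)
  note E = space_subgroup_props(1)[OF subfield_scalars[OF nc_domainD(2)[OF dom]] Suc_dim(3)]
  have inj: "x = y" if "x \<in> carrier A" "y \<in> carrier A" "a \<otimes> x = a \<otimes> y" for x y
  proof -
    have "a \<otimes> (x \<ominus> y) = \<zero>"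
      using that a by (simp add: a_minus_def r_distr r_minus r_neg)
    then have "x \<ominus> y = \<zero>" using nc_domainD(3)[OF dom a(1), of "x \<ominus> y"] that a by auto
    then show ?thesis using that by simp
  qed
  have "a \<otimes> v \<notin> (\<otimes>) a ` E"
    using Suc_dim(1,2) E inj[of v] by auto
  moreover have "(\<otimes>) a ` line_extension (scalars A) v E = line_extension (scalars A) (a \<otimes> v) ((\<otimes>) a ` E)"
  proof -
    have *: "a \<otimes> ((c \<odot> \<one>) \<otimes> v \<oplus> e) = (c \<odot> \<one>) \<otimes> (a \<otimes> v) \<oplus> a \<otimes> e" if "e \<in> E" for c e
      using that E Suc_dim(1) a by (auto simp: r_distr sm_mult)
    show ?thesis
      by (auto simp: image_iff line_extension_mem_iff scalars_def Bex_def *) (metis *)+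
  qed
  ultimately show ?case using Suc_dim a by (auto intro!: dimension.Suc_dim)
qed

lemma exponential_beats_polynomial: "\<exists>j::nat. (j * e + 1) ^ M < 2 ^ j"
proof (cases "M = 0")
  case True
  then show ?thesis by (intro exI[of _ 1]) simp
next
  case False
  \<comment> \<open>With \<open>s - 1 = 2 M e\<close> one has
    \<open>2 s M e + 1 = s (s - 1) + 1 \<le> s^2 < 4^s\<close>; the \<open>M\<close>-th power of
    this inequality is the claim for \<open>j = 2 s M\<close>.\<close>
  define s where "s = 2 * (M * e) + 1"
  have "s * s < 2 ^ s * 2 ^ s" by (intro mult_strict_mono) auto
  moreover have "2 * s * M * e + 1 \<le> s * s" by (simp add: s_def algebra_simps)
  ultimately have "2 * s * M * e + 1 < 2 ^ (2 * s)" by (simp add: mult_2 power_add)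
  then have "(2 * s * M * e + 1) ^ M < (2 ^ (2 * s)) ^ M" using False by (intro power_strict_mono) auto
  then show ?thesis by (intro exI[of _ "2 * s * M"]) (simp add: power_mult)
qed

text \<open>The sets \<open>lspan A (S d)\<close> form a filtration of polynomial growth. If the Ore
  condition fails for \<open>a\<close> and \<open>b\<close>, both in layer \<open>e\<close>, then
  \<open>aE\<close> and \<open>bE\<close> meet in zero for every layer \<open>E\<close>; so the
  dimension at least doubles each time the degree grows by \<open>e\<close>.\<close>

lemma (in k_algebra) right_Ore_of_growth:
  assumes dom: "nc_domain A"
    and V: "\<And>d. finite (S d)" "\<And>d. S d \<subseteq> carrier A" "\<And>d. card (S d) \<le> (d + 1) ^ M"
    and one: "\<And>d. \<one> \<in> lspan A (S d)"
    and mult: "\<And>d e x y. x \<in> lspan A (S d) \<Longrightarrow> y \<in> lspan A (S e) \<Longrightarrow> x \<otimes> y \<in> lspan A (S (d + e))"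
    and all: "carrier A \<subseteq> (\<Union>d. lspan A (S d))"
  shows "right_Ore A"
  unfolding right_Ore_def
proof (intro ballI, rule ccontr)
  fix a b assume a: "a \<in> carrier A" and b: "b \<in> carrier A - {\<zero>}"
    and neg: "\<not> (\<exists>u\<in>carrier A. \<exists>v\<in>carrier A - {\<zero>}. a \<otimes> v = b \<otimes> u)"
  note ne = nc_domainD(2)[OF dom]
  note K = subfield_scalars[OF ne]
  have a0: "a \<noteq> \<zero>"
  proof
    assume "a = \<zero>"
    then have "a \<otimes> \<one> = b \<otimes> \<zero>" using b by simp
    moreover have "\<one> \<in> carrier A - {\<zero>}" using ne by simp
    ultimately show False using neg zero_closed by blast
  qed
  obtain d1 d2 where "a \<in> lspan A (S d1)" "b \<in> lspan A (S d2)" using a b all by blast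
  \<comment> \<open>Both elements are put into one layer; the filtration increases because every
    layer contains \<open>1\<close>.\<close>
  then have ab: "a \<in> lspan A (S (d1 + d2))" "b \<in> lspan A (S (d1 + d2))"
    using mult[OF _ one, of a d1 d2] mult[OF one, of b d2 d1] a b by auto
  define e where "e = d1 + d2"
  have "\<exists>m. 2 ^ j \<le> m \<and> dimension m (scalars A) (lspan A (S (j * e)))" for j
  proof (induction j)
    case 0
    obtain m where m: "dimension m (scalars A) (lspan A (S 0))"
      using dimension_lspan[OF ne V(1,2)] by blast
    moreover have "m \<noteq> 0" using dimension_zero[OF K] m one[of 0] ne by (metis singletonD)
    ultimately show ?case by (intro exI[of _ m]) simp
  next
    case (Suc j)
    then obtain m where m: "2 ^ j \<le> m" "dimension m (scalars A) (lspan A (S (j * e)))" by blast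
    let ?E = "lspan A (S (j * e))" and ?F = "lspan A (S (Suc j * e))"
    have Ec: "x \<in> carrier A" if "x \<in> ?E" for x using lspan_closed[OF V(2) that] .
    have "x = \<zero>" if x: "x \<in> (\<otimes>) a ` ?E" "x \<in> (\<otimes>) b ` ?E" for x
    proof -
      obtain v u where *: "v \<in> ?E" "x = a \<otimes> v" "u \<in> ?E" "x = b \<otimes> u" using x by blast
      then have "v = \<zero>" using neg Ec[of v] Ec[of u] by blast
      then show ?thesis using * a by simp
    qed
    moreover have "\<zero> \<in> (\<otimes>) a ` ?E" "\<zero> \<in> (\<otimes>) b ` ?E"
      using lspan.zero[of A] a b by (force intro!: image_eqI[of _ _ "\<zero>"])+
    ultimately have int: "(\<otimes>) a ` ?E \<inter> (\<otimes>) b ` ?E = {\<zero>}" by blast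
    have "dimension (m + m) (scalars A) ((\<otimes>) a ` ?E <+>\<^bsub>A\<^esub> (\<otimes>) b ` ?E)"
      using b a0 by (intro dimension_direct_sum_space[OF K _ _ int] dimension_mult_left[OF dom] a m) auto
    from exists_base[OF K this] obtain Us where Us: "independent (scalars A) Us" "length Us = m + m"
        "Span (scalars A) Us = (\<otimes>) a ` ?E <+>\<^bsub>A\<^esub> (\<otimes>) b ` ?E" "set Us \<subseteq> carrier A" by blast
    have "(\<otimes>) a ` ?E <+>\<^bsub>A\<^esub> (\<otimes>) b ` ?E \<subseteq> ?F"
      using mult[OF ab(1)] mult[OF ab(2)] unfolding e_def
      by (auto simp: set_add_def' intro!: lspan.add)
    then have "set Us \<subseteq> ?F" using Span_base_incl[OF K Us(4)] Us(3) by auto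
    moreover obtain m' where m': "dimension m' (scalars A) ?F"
      using dimension_lspan[OF ne V(1,2)] by blast
    ultimately have "m + m \<le> m'" using independent_length_le_dimension[OF K m' Us(1)] Us(2) by simp
    with m' m(1) show ?case by (intro exI[of _ m']) simp
  qed
  moreover obtain j where j: "(j * e + 1) ^ M < 2 ^ j"
    using exponential_beats_polynomial by blast
  ultimately obtain m where m: "2 ^ j \<le> m" "dimension m (scalars A) (lspan A (S (j * e)))" by blast
  obtain m' where "m' \<le> card (S (j * e))" "dimension m' (scalars A) (lspan A (S (j * e)))"
    using dimension_lspan[OF ne V(1,2)] by blast
  then have "m \<le> (j * e + 1) ^ M" using dimension_is_inj[OF K m(2)] V(3)[of "j * e"] by fastforce
  with m j show False by simp
qed

text \<open>The products with \<open>a < j\<close> are lexicographically smaller than \<open>g j \<otimes> g i\<close>, so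
  that rewriting with these relations ends in nondecreasing words.\<close>

definition straightening :: "('k, 'a) module \<Rightarrow> (nat \<Rightarrow> 'a) \<Rightarrow> nat \<Rightarrow> bool"
  where "straightening A g M \<longleftrightarrow> g ` {..<M} \<subseteq> carrier A \<and>
    (\<forall>j<M. \<forall>i<j. g j \<otimes>\<^bsub>A\<^esub> g i \<in> lspan A {g a \<otimes>\<^bsub>A\<^esub> g b | a b. a < j \<and> b < M})"

lemma straightening_image:
  assumes "k_algebra A" "k_algebra B" "f \<in> alg_hom A B" "straightening A g M"
  shows "straightening B (f \<circ> g) M"
  unfolding straightening_def
proof (intro conjI allI impI)
  interpret alg_hom_loc A B f by (rule alg_hom_locI) fact+
  have g: "g ` {..<M} \<subseteq> carrier A" using assms(4) by (simp add: straightening_def)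
  then show "(f \<circ> g) ` {..<M} \<subseteq> carrier B" by auto
  fix i j assume ij: "j < M" "i < j"
  let ?S = "{g a \<otimes>\<^bsub>A\<^esub> g b | a b. a < j \<and> b < M}"
  have S: "?S \<subseteq> carrier A" using g ij by (force intro!: A.m_closed)
  have c: "g i \<in> carrier A" "g j \<in> carrier A" using g ij by auto
  have "f (g j \<otimes>\<^bsub>A\<^esub> g i) \<in> lspan B (f ` ?S)"
    using assms(4) ij by (intro lspan_image[OF S]) (auto simp: straightening_def)
  moreover have "f ` ?S \<subseteq> {(f \<circ> g) a \<otimes>\<^bsub>B\<^esub> (f \<circ> g) b | a b. a < j \<and> b < M}"
  proof
    fix t assume "t \<in> f ` ?S"
    then obtain a b where ab: "t = f (g a \<otimes>\<^bsub>A\<^esub> g b)" "a < j" "b < M" by blast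
    then have "g a \<in> carrier A" "g b \<in> carrier A" using g ij by auto
    then have "t = (f \<circ> g) a \<otimes>\<^bsub>B\<^esub> (f \<circ> g) b" by (simp add: ab mult)
    then show "t \<in> {(f \<circ> g) a \<otimes>\<^bsub>B\<^esub> (f \<circ> g) b | a b. a < j \<and> b < M}" using ab by blast
  qed
  ultimately show "(f \<circ> g) j \<otimes>\<^bsub>B\<^esub> (f \<circ> g) i \<in> lspan B {(f \<circ> g) a \<otimes>\<^bsub>B\<^esub> (f \<circ> g) b | a b. a < j \<and> b < M}"
    using lspan_mono c by (auto simp: mult)
qed

section \<open>Words in the generators and their straightening\<close>

definition wprod :: "('k, 'a) module \<Rightarrow> ('x \<Rightarrow> 'a) \<Rightarrow> 'x list \<Rightarrow> 'a"
  where "wprod A g u = foldr (\<lambda>i t. g i \<otimes>\<^bsub>A\<^esub> t) u \<one>\<^bsub>A\<^esub>"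

lemma wprod_simps [simp]:
  "wprod A g [] = \<one>\<^bsub>A\<^esub>" "wprod A g (i # u) = g i \<otimes>\<^bsub>A\<^esub> wprod A g u"
  by (simp_all add: wprod_def)

lemma (in k_algebra) wprod_closed [simp, intro]: "g ` set u \<subseteq> carrier A \<Longrightarrow> wprod A g u \<in> carrier A"
  by (induction u) auto

lemma (in k_algebra) wprod_append:
  "g ` set u \<subseteq> carrier A \<Longrightarrow> g ` set v \<subseteq> carrier A \<Longrightarrow> wprod A g (u @ v) = wprod A g u \<otimes> wprod A g v"
  by (induction u) (auto simp: m_assoc)

lemma not_sorted_descent:
  "\<not> sorted (u :: nat list) \<Longrightarrow> \<exists>p j i s. u = p @ j # i # s \<and> i < j"
proof (induction u)
  case (Cons x u)
  show ?case
  proof (cases "sorted u")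
    case True
    then obtain y v where "u = y # v" "y < x" using Cons.prems by (cases u) force+
    then show ?thesis by (intro exI[of _ "[]"]) auto
  next
    case False
    then obtain p j i s where "u = p @ j # i # s" "i < j" using Cons.IH by blast
    then show ?thesis by (intro exI[of _ "x # p"]) auto
  qed
qed simp

definition sorted_words :: "nat \<Rightarrow> nat \<Rightarrow> nat list set"
  where "sorted_words M d = {u. sorted u \<and> set u \<subseteq> {..<M} \<and> length u \<le> d}"

text \<open>A sorted word is determined by the multiplicities of its letters, that is by a map from
  \<open>{..<M}\<close> to \<open>{..d}\<close>.\<close>

lemma sorted_words_card: "finite (sorted_words M d)" "card (sorted_words M d) \<le> (d + 1) ^ M"
proof -
  let ?f = "\<lambda>u. restrict (count (mset u)) {..<M}"
  let ?F = "{..<M} \<rightarrow>\<^sub>E {..d}"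
  have inj: "inj_on ?f (sorted_words M d)"
  proof (rule inj_onI)
    fix u v assume u: "u \<in> sorted_words M d" and v: "v \<in> sorted_words M d" and e: "?f u = ?f v"
    have "count (mset u) i = count (mset v) i" for i
    proof (cases "i < M")
      case True
      then show ?thesis using fun_cong[OF e, of i] by simp
    next
      case False
      then have "i \<notin> set u" "i \<notin> set v" using u v by (auto simp: sorted_words_def)
      then show ?thesis by (metis count_eq_zero_iff set_mset_mset)
    qed
    then have "mset u = mset v" by (rule multiset_eqI)
    then show "u = v" using u v by (metis (mono_tags, lifting) mem_Collect_eq properties_for_sort sorted_words_def)
  qed
  have sub: "?f ` sorted_words M d \<subseteq> ?F"
  proof
    fix t assume "t \<in> ?f ` sorted_words M d"
    then obtain u where u: "u \<in> sorted_words M d" "t = ?f u" by blast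
    have "count (mset u) i \<le> d" for i
      using count_le_size[of "mset u" i] u(1) by (auto simp: sorted_words_def)
    then show "t \<in> ?F" by (auto simp: u(2))
  qed
  have fin: "finite ?F" by (intro finite_PiE) auto
  show "finite (sorted_words M d)" using inj sub fin by (metis finite_imageD finite_subset)
  have "card (sorted_words M d) = card (?f ` sorted_words M d)" by (simp add: card_image[OF inj])
  also have "\<dots> \<le> card ?F" by (rule card_mono[OF fin sub])
  also have "\<dots> = (d + 1) ^ M" by (simp add: card_PiE)
  finally show "card (sorted_words M d) \<le> (d + 1) ^ M" .
qed

text \<open>Induction along \<open>lex less_than\<close>, which compares words of equal length. A
  descent \<open>j i\<close> is replaced by products \<open>a b\<close> with \<open>a < j\<close>:
  the length is kept and the word becomes lexicographically smaller, however large \<open>b\<close>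
  may be.\<close>

lemma (in k_algebra) wprod_in_sorted:
  assumes str: "straightening A g M"
  shows "set u \<subseteq> {..<M} \<Longrightarrow> wprod A g u \<in> lspan A (wprod A g ` sorted_words M (length u))"
proof (induction u rule: wf_induct_rule[OF wf_lex[OF wf_less_than]])
  case (1 u)
  have g: "\<And>i. i < M \<Longrightarrow> g i \<in> carrier A" using str by (auto simp: straightening_def)
  show ?case
  proof (cases "sorted u")
    case True
    then show ?thesis using 1(2) by (auto simp: sorted_words_def intro!: lspan.base)
  next
    case False
    then obtain p j i s where u: "u = p @ j # i # s" "i < j" using not_sorted_descent by blast
    have M: "set p \<subseteq> {..<M}" "set s \<subseteq> {..<M}" "i < M" "j < M" using 1(2) u by auto
    have c: "g ` set p \<subseteq> carrier A" "g ` set s \<subseteq> carrier A" using M g by auto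
    note c' = wprod_closed[OF c(1)] wprod_closed[OF c(2)]
    let ?T = "lspan A (wprod A g ` sorted_words M (length u))"
    let ?S = "{g a \<otimes> g b | a b. a < j \<and> b < M}"
    have split: "wprod A g (p @ a # b # s) = wprod A g p \<otimes> (g a \<otimes> g b) \<otimes> wprod A g s" if "a < M" "b < M" for a b
      using that g c c' by (subst wprod_append) (auto simp: m_assoc)
    \<comment> \<open>The relation is multiplied by the prefix and then by the suffix; the fixed
      factor is viewed as an element of the span of a singleton, so that \<open>lspan_mult\<close>
      applies.\<close>
    have "wprod A g p \<otimes> t \<in> lspan A ((\<lambda>t. wprod A g p \<otimes> t) ` ?S)" if t: "t \<in> lspan A ?S" for t
      by (rule lspan_mult[OF _ _ _ lspan.base[of "wprod A g p" "{wprod A g p}"] t])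
        (use c' g M in \<open>auto intro!: lspan.base m_closed image_eqI\<close>)
    moreover have "t \<otimes> wprod A g s \<in> ?T" if t: "t \<in> lspan A ((\<lambda>t. wprod A g p \<otimes> t) ` ?S)" for t
    proof (rule lspan_mult[OF _ _ _ t lspan.base[of "wprod A g s" "{wprod A g s}"]])
      fix x y assume "x \<in> (\<lambda>t. wprod A g p \<otimes> t) ` ?S" "y \<in> {wprod A g s}"
      then obtain a b where ab: "a < j" "b < M" "x = wprod A g p \<otimes> (g a \<otimes> g b)" "y = wprod A g s" by blast
      then have "x \<otimes> y = wprod A g (p @ a # b # s)" using M by (simp add: split)
      moreover have "(p @ a # b # s, u) \<in> lex less_than"
        unfolding u using ab by (intro lex_append_leftI) auto
      moreover have "set (p @ a # b # s) \<subseteq> {..<M}" using M ab by auto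
      ultimately show "x \<otimes> y \<in> ?T" using 1(1)[of "p @ a # b # s"] by (simp add: u)
    qed (use c' g M in \<open>auto intro!: m_closed\<close>)
    ultimately have "wprod A g p \<otimes> (g j \<otimes> g i) \<otimes> wprod A g s \<in> ?T"
      using str M u by (simp add: straightening_def)
    then show ?thesis using split[OF M(4,3)] u by simp
  qed
qed

text \<open>Layer \<open>d\<close> is spanned by the sorted words of length at most
  \<open>d\<close>. Straightening preserves the length, so concatenation of words sends layers
  \<open>d\<close> and \<open>e\<close> into layer \<open>d + e\<close>. The union of the layers is
  a subalgebra that contains the generators, hence everything.\<close>

theorem (in k_algebra) right_Ore_of_straightening:
  assumes dom: "nc_domain A" and gen: "generating A (g ` {..<M})" and str: "straightening A g M"
  shows "right_Ore A"
proof (rule right_Ore_of_growth[OF dom])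
  let ?S = "\<lambda>d. wprod A g ` sorted_words M d"
  have g: "\<And>i. i < M \<Longrightarrow> g i \<in> carrier A" using str by (auto simp: straightening_def)
  have in_S: "wprod A g u \<in> lspan A (?S d)" if "set u \<subseteq> {..<M}" "length u \<le> d" for u d
  proof (rule lspan_mono[OF _ wprod_in_sorted[OF str that(1)]])
    show "?S (length u) \<subseteq> ?S d" using that(2) by (intro image_mono) (auto simp: sorted_words_def)
  qed
  show "finite (?S d)" for d using sorted_words_card by blast
  show sc: "?S d \<subseteq> carrier A" for d using g by (auto simp: sorted_words_def intro!: wprod_closed)
  show "card (?S d) \<le> (d + 1) ^ M" for d
    using card_image_le[OF sorted_words_card(1)[of M d], of "wprod A g"] sorted_words_card(2)[of M d]
    by linarith
  show one: "\<one> \<in> lspan A (?S d)" for d using in_S[of "[]" d] by simp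
  show mult: "x \<otimes> y \<in> lspan A (?S (d + e))" if "x \<in> lspan A (?S d)" "y \<in> lspan A (?S e)" for d e x y
  proof (rule lspan_mult[OF sc sc _ that])
    fix s t assume "s \<in> ?S d" "t \<in> ?S e"
    then obtain u v where uv: "s = wprod A g u" "t = wprod A g v" "set u \<subseteq> {..<M}" "set v \<subseteq> {..<M}"
      "length u \<le> d" "length v \<le> e" by (auto simp: sorted_words_def)
    have "s \<otimes> t = wprod A g (u @ v)" using uv g by (subst wprod_append) auto
    then show "s \<otimes> t \<in> lspan A (?S (d + e))" using in_S[of "u @ v" "d + e"] uv by auto
  qed
  show "carrier A \<subseteq> (\<Union>d. lspan A (?S d))"
  proof -
    have lc: "x \<in> carrier A" if "x \<in> lspan A (?S d)" for x d using lspan_closed[OF sc that] .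
    have mono: "x \<in> lspan A (?S (d + e))" "x \<in> lspan A (?S (e + d))" if "x \<in> lspan A (?S d)" for x d e
      using mult[OF that one[of e]] mult[OF one[of e] that] lc[OF that] by auto
    have "subalg (\<Union>d. lspan A (?S d)) A"
    proof (rule subalgI[OF k_algebra_axioms])
      show "(\<Union>d. lspan A (?S d)) \<subseteq> carrier A" using lc by blast
      show "\<one> \<in> (\<Union>d. lspan A (?S d))" using one by blast
      fix x y assume "x \<in> (\<Union>d. lspan A (?S d))" "y \<in> (\<Union>d. lspan A (?S d))"
      then obtain d e where de: "x \<in> lspan A (?S d)" "y \<in> lspan A (?S e)" by blast
      show "x \<otimes> y \<in> (\<Union>d. lspan A (?S d))" using mult[OF de] by blast
      show "x \<oplus> y \<in> (\<Union>d. lspan A (?S d))"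
        using lspan.add[OF mono(1)[OF de(1), of e] mono(2)[OF de(2), of d]] by blast
    next
      fix c x assume "x \<in> (\<Union>d. lspan A (?S d))"
      then obtain d where "x \<in> lspan A (?S d)" by blast
      from lspan.smult[OF this] show "c \<odot> x \<in> (\<Union>d. lspan A (?S d))" by blast
    qed
    moreover have "g i \<in> (\<Union>d. lspan A (?S d))" if "i < M" for i
      using in_S[of "[i]" 1] g that by auto
    ultimately show ?thesis using gen by (auto simp: generating_def)
  qed
qed

section \<open>Factor algebras and presentations\<close>

lemma quot_elem:
  assumes "k_algebra A" "ideal I A" "C \<in> carrier (alg_quot A I)"
  obtains x where "x \<in> carrier A" "C = I +>\<^bsub>A\<^esub> x"
  using assms(3) unfolding alg_quot(3)[OF assms(1,2), symmetric] by (rule imageE)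

text \<open>The induced map picks a representative by choice; its value is independent of the choice
  since \<open>f\<close> vanishes on \<open>I\<close>.\<close>

lemma quot_lift:
  fixes A :: "('k::field, 'a) module" and B :: "('k, 'b) module"
  assumes A: "k_algebra A" and B: "k_algebra B" and f: "f \<in> alg_hom A B"
    and I: "ideal I A" and ker: "\<And>x. x \<in> I \<Longrightarrow> f x = \<zero>\<^bsub>B\<^esub>"
  shows "\<exists>h. h \<in> alg_hom (alg_quot A I) B \<and> (\<forall>x\<in>carrier A. h (I +>\<^bsub>A\<^esub> x) = f x)"
proof -
  interpret alg_hom_loc A B f by (rule alg_hom_locI) fact+
  interpret I: ideal I A by fact
  interpret p: alg_hom_loc A "alg_quot A I" "(+>\<^bsub>A\<^esub>) I"
    by (intro alg_hom_locI A alg_quot I)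
  define h where "h C = f (SOME x. x \<in> C)" for C
  have h: "h (I +>\<^bsub>A\<^esub> x) = f x" if x: "x \<in> carrier A" for x
  proof -
    have "x \<in> I +>\<^bsub>A\<^esub> x" using I.a_rcos_self x by blast
    then have "(SOME y. y \<in> I +>\<^bsub>A\<^esub> x) \<in> I +>\<^bsub>A\<^esub> x" by (rule someI)
    then obtain i where i: "i \<in> I" "(SOME y. y \<in> I +>\<^bsub>A\<^esub> x) = i \<oplus>\<^bsub>A\<^esub> x"
      unfolding a_r_coset_def' by blast
    have "i \<in> carrier A" using i I.a_Hcarr by blast
    then show ?thesis using x by (simp add: h_def i add ker)
  qed
  have "h \<in> alg_hom (alg_quot A I) B"
  proof (rule alg_homI, goal_cases)
    case (1 x)
    then obtain u where "x = I +>\<^bsub>A\<^esub> u" "u \<in> carrier A" using quot_elem[OF A I] by metis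
    then show ?case by (simp add: h)
  next
    case (2 x y)
    then obtain u v where "x = I +>\<^bsub>A\<^esub> u" "y = I +>\<^bsub>A\<^esub> v" "u \<in> carrier A" "v \<in> carrier A"
      using quot_elem[OF A I] by metis
    then show ?case by (simp add: h mult p.mult[symmetric])
  next
    case (3 x y)
    then obtain u v where "x = I +>\<^bsub>A\<^esub> u" "y = I +>\<^bsub>A\<^esub> v" "u \<in> carrier A" "v \<in> carrier A"
      using quot_elem[OF A I] by metis
    then show ?case by (simp add: h add p.add[symmetric])
  next
    case 4
    show ?case by (simp add: h one p.one[symmetric])
  next
    case (5 c x)
    then obtain u where "x = I +>\<^bsub>A\<^esub> u" "u \<in> carrier A" using quot_elem[OF A I] by metis
    then show ?case by (simp add: h smult p.smult[symmetric])
  qed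
  then show ?thesis using h by blast
qed

lemma (in alg_hom_loc) kernel_ideal: "ideal {x \<in> carrier A. f x = \<zero>\<^bsub>B\<^esub>} A"
proof (rule idealI)
  show "ring A" by (rule A.ring_A)
  show "subgroup {x \<in> carrier A. f x = \<zero>\<^bsub>B\<^esub>} (add_monoid A)"
    by (rule A.add.subgroupI) (auto simp: simps a_inv_def[symmetric] intro: exI[of _ "\<zero>\<^bsub>A\<^esub>"])
qed (auto simp: simps)

lemma (in alg_hom_loc) inj_iff: "inj_on f (carrier A) \<longleftrightarrow> (\<forall>x\<in>carrier A. f x = \<zero>\<^bsub>B\<^esub> \<longrightarrow> x = \<zero>\<^bsub>A\<^esub>)"
proof
  assume "inj_on f (carrier A)"
  then show "\<forall>x\<in>carrier A. f x = \<zero>\<^bsub>B\<^esub> \<longrightarrow> x = \<zero>\<^bsub>A\<^esub>"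
    using zero by (metis A.zero_closed inj_onD)
next
  assume *: "\<forall>x\<in>carrier A. f x = \<zero>\<^bsub>B\<^esub> \<longrightarrow> x = \<zero>\<^bsub>A\<^esub>"
  show "inj_on f (carrier A)"
  proof (rule inj_onI)
    fix x y assume xy: "x \<in> carrier A" "y \<in> carrier A" "f x = f y"
    then have "f (x \<ominus>\<^bsub>A\<^esub> y) = \<zero>\<^bsub>B\<^esub>" by (simp add: diff)
    then have "x \<ominus>\<^bsub>A\<^esub> y = \<zero>\<^bsub>A\<^esub>" using * xy by simp
    then show "x = y" using xy by simp
  qed
qed

lemma (in alg_hom_loc) nc_domain_inj:
  assumes inj: "inj_on f (carrier A)" and dom: "nc_domain B"
  shows "nc_domain A"
  unfolding nc_domain_def
proof (intro conjI ballI impI)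
  note i = inj[unfolded inj_iff, rule_format]
  show "ring A" by (rule A.ring_A)
  show "\<one>\<^bsub>A\<^esub> \<noteq> \<zero>\<^bsub>A\<^esub>" using nc_domainD(2)[OF dom] one zero by metis
  fix a b assume ab: "a \<in> carrier A" "b \<in> carrier A" "a \<otimes>\<^bsub>A\<^esub> b = \<zero>\<^bsub>A\<^esub>"
  then have "f a \<otimes>\<^bsub>B\<^esub> f b = \<zero>\<^bsub>B\<^esub>" using zero by (simp add: mult[symmetric])
  then show "a = \<zero>\<^bsub>A\<^esub> \<or> b = \<zero>\<^bsub>A\<^esub>" using nc_domainD(3)[OF dom, of "f a" "f b"] i ab by auto
qed

text \<open>Source of the ideal \<open>J\<close> of the theorem: the kernel of a homomorphism to a
  domain is completely prime because the factor algebra embeds into that domain.\<close>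

lemma quot_kernel:
  fixes A :: "('k::field, 'a) module" and B :: "('k, 'b) module"
  assumes A: "k_algebra A" and B: "k_algebra B" and f: "f \<in> alg_hom A B" and dom: "nc_domain B"
  obtains J h where "completely_prime J A" "h \<in> alg_hom (alg_quot A J) B"
    "inj_on h (carrier (alg_quot A J))" "\<And>x. x \<in> carrier A \<Longrightarrow> h (J +>\<^bsub>A\<^esub> x) = f x"
proof -
  interpret alg_hom_loc A B f by (rule alg_hom_locI) fact+
  define J where "J = {x \<in> carrier A. f x = \<zero>\<^bsub>B\<^esub>}"
  have J: "ideal J A" unfolding J_def by (rule kernel_ideal)
  interpret J: ideal J A by fact
  have ker: "f x = \<zero>\<^bsub>B\<^esub>" if "x \<in> J" for x using that unfolding J_def by blast
  have "\<exists>h. h \<in> alg_hom (alg_quot A J) B \<and> (\<forall>x\<in>carrier A. h (J +>\<^bsub>A\<^esub> x) = f x)"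
    by (rule quot_lift[OF A B f J ker])
  then obtain h where h: "h \<in> alg_hom (alg_quot A J) B" "\<And>x. x \<in> carrier A \<Longrightarrow> h (J +>\<^bsub>A\<^esub> x) = f x"
    by auto
  interpret h: alg_hom_loc "alg_quot A J" B h by (intro alg_hom_locI alg_quot A B h J)
  have inj: "inj_on h (carrier (alg_quot A J))"
    unfolding h.inj_iff
  proof (intro ballI impI)
    fix C assume C: "C \<in> carrier (alg_quot A J)" "h C = \<zero>\<^bsub>B\<^esub>"
    from quot_elem[OF A J C(1)] obtain x where x: "x \<in> carrier A" "C = J +>\<^bsub>A\<^esub> x" .
    then have "f x = \<zero>\<^bsub>B\<^esub>" using h(2)[OF x(1)] C(2) by simp
    then have "x \<in> J" using x(1) unfolding J_def by blast
    then show "C = \<zero>\<^bsub>alg_quot A J\<^esub>" using x J.a_rcos_const by (simp add: alg_quot_simps)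
  qed
  have "completely_prime J A"
    unfolding completely_prime_def using J h.nc_domain_inj[OF inj dom] by simp
  then show ?thesis using h(1) inj h(2) by (rule that)
qed

section \<open>Free algebras, evaluation and presented algebras\<close>

lemma free_algebra_simps:
  "carrier (free_algebra G) = {f. \<forall>u \<in> Poly_Mapping.keys f. set (letters u) \<subseteq> G}"
  "f \<otimes>\<^bsub>free_algebra G\<^esub> g = f * g" "\<one>\<^bsub>free_algebra G\<^esub> = 1" "\<zero>\<^bsub>free_algebra G\<^esub> = 0"
  "f \<oplus>\<^bsub>free_algebra G\<^esub> g = f + g" "c \<odot>\<^bsub>free_algebra G\<^esub> f = const c * f"
  by (simp_all add: free_algebra_def)

lemma letters_simps [simp]: "letters 0 = []" "letters (u + v) = letters u @ letters v"
  by (simp_all add: zero_free_word_def plus_free_word_def)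

lemma const_simps: "const (a + b) = const a + const b" "const (a * b) = const a * const b" "const 1 = 1"
  by (simp_all add: const_def single_add mult_single)

lemma single_decomp: "(f :: 'a \<Rightarrow>\<^sub>0 'b::comm_monoid_add) = (\<Sum>u\<in>Poly_Mapping.keys f. Poly_Mapping.single u (Poly_Mapping.lookup f u))"
proof (rule poly_mapping_eqI)
  fix v
  show "Poly_Mapping.lookup f v = Poly_Mapping.lookup (\<Sum>u\<in>Poly_Mapping.keys f. Poly_Mapping.single u (Poly_Mapping.lookup f u)) v"
    by (simp add: lookup_sum lookup_single when_def in_keys_iff)
qed

text \<open>Terms of the fixed element \<open>f\<close> are added one by one. The step remembers
  that \<open>u\<close> is in the support of \<open>f\<close>, and this is how the letters of
  \<open>u\<close> are known to belong to the generating set.\<close>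

lemma single_induct [case_names zero add]:
  fixes f :: "'a \<Rightarrow>\<^sub>0 'b::comm_monoid_add"
  assumes "P 0" "\<And>g u. u \<in> Poly_Mapping.keys f \<Longrightarrow> P g \<Longrightarrow> P (Poly_Mapping.single u (Poly_Mapping.lookup f u) + g)"
  shows "P f"
proof -
  have "P (\<Sum>u\<in>S. Poly_Mapping.single u (Poly_Mapping.lookup f u))" if "finite S" "S \<subseteq> Poly_Mapping.keys f" for S
    using that by (induction S rule: finite_induct) (use assms in auto)
  from this[OF finite_keys order_refl] show ?thesis using single_decomp[of f] by simp
qed

lemma const_comm: "const c * f = f * const (c :: 'k::field)"
proof (induction f rule: single_induct)
  case (add g u)
  then show ?case by (simp add: distrib_left distrib_right const_def mult_single mult.commute)
qed simp

lemma const_in_free: "const c \<in> carrier (free_algebra G)"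
  by (auto simp: free_algebra_simps const_def)

lemma gen_in_free: "x \<in> G \<Longrightarrow> gen x \<in> carrier (free_algebra G)"
  by (auto simp: free_algebra_simps gen_def)

lemma free_mult_closed:
  "f \<in> carrier (free_algebra G) \<Longrightarrow> g \<in> carrier (free_algebra G) \<Longrightarrow> f * g \<in> carrier (free_algebra G)"
  using keys_mult[of f g] by (force simp: free_algebra_simps)

lemma free_add_closed:
  "f \<in> carrier (free_algebra G) \<Longrightarrow> g \<in> carrier (free_algebra G) \<Longrightarrow> f + g \<in> carrier (free_algebra G)"
  using keys_add[of f g] by (force simp: free_algebra_simps)

lemma k_algebra_free: "k_algebra (free_algebra G :: ('k::field, ('k, 'x) free_poly) module)"
proof (rule k_algebraI)
  let ?F = "free_algebra G :: ('k, ('k, 'x) free_poly) module"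
  have um: "- f \<in> carrier ?F" if "f \<in> carrier ?F" for f
    using that by (auto simp: free_algebra_simps in_keys_iff)
  have neg: "\<exists>g\<in>carrier ?F. f + g = 0" if "f \<in> carrier ?F" for f
    using um[OF that] by (intro bexI[of _ "- f"]) auto
  have neg': "\<exists>g\<in>carrier ?F. g + f = 0" if "f \<in> carrier ?F" for f
    using um[OF that] by (intro bexI[of _ "- f"]) auto
  have 01: "0 \<in> carrier ?F" "1 \<in> carrier ?F" by (auto simp: free_algebra_simps)
  note [simp] = free_algebra_simps(2-6)
  show "ring ?F"
    by (intro ringI abelian_groupI monoidI)
      (auto simp: free_add_closed free_mult_closed algebra_simps 01 neg neg')
  fix c a b :: 'k and x y assume xy: "x \<in> carrier ?F" "y \<in> carrier ?F"
  show "x \<otimes>\<^bsub>?F\<^esub> (c \<odot>\<^bsub>?F\<^esub> y) = c \<odot>\<^bsub>?F\<^esub> (x \<otimes>\<^bsub>?F\<^esub> y)"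
    by (simp add: const_comm mult.assoc)
qed (auto simp: free_algebra_simps(2-6) const_simps algebra_simps intro: const_in_free free_mult_closed)

lemma free_minus_closed:
  "f \<in> carrier (free_algebra G) \<Longrightarrow> g \<in> carrier (free_algebra G) \<Longrightarrow>
    f - g \<in> carrier (free_algebra G :: ('k::field, ('k, 'x) free_poly) module)"
proof -
  assume f: "f \<in> carrier (free_algebra G)" and g: "g \<in> carrier (free_algebra G)"
  interpret F: k_algebra "free_algebra G :: ('k, ('k, 'x) free_poly) module" by (rule k_algebra_free)
  have "const (- 1) * g = - g" by (simp add: const_def single_uminus)
  then show ?thesis using free_add_closed[OF f F.sm_closed[OF g, of "- 1"]] by (simp add: free_algebra_simps(6))
qed

lemma generating_free: "generating (free_algebra G :: ('k::field, ('k, 'x) free_poly) module) (gen ` G)"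
  unfolding generating_def
proof (intro conjI ballI subsetI)
  let ?F = "free_algebra G :: ('k, ('k, 'x) free_poly) module"
  show "f \<in> carrier ?F" if "f \<in> gen ` G" for f using that by (auto intro: gen_in_free)
  fix S f assume "S \<in> {S. subalg S ?F \<and> gen ` G \<subseteq> S}" and f: "f \<in> carrier ?F"
  then have S: "subalg S ?F" "gen ` G \<subseteq> S" by auto
  note D = subalgD[OF k_algebra_free S(1), unfolded free_algebra_simps]
  have w: "Poly_Mapping.single (Word xs) 1 \<in> S" if "set xs \<subseteq> G" for xs
    using that
  proof (induction xs)
    case Nil
    then show ?case using D(2) by (simp flip: zero_free_word_def)
  next
    case (Cons x xs)
    then have "gen x \<in> S" "Poly_Mapping.single (Word xs) 1 \<in> S" using S by auto
    from D(6)[OF this] show ?case by (simp add: gen_def mult_single plus_free_word_def)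
  qed
  show "f \<in> S"
  proof (induction f rule: single_induct)
    case zero
    then show ?case using D(3) by simp
  next
    case (add g u)
    then have "set (letters u) \<subseteq> G" using f by (auto simp: free_algebra_simps)
    from D(7)[OF w[OF this], of "Poly_Mapping.lookup f u"] have "Poly_Mapping.single u (Poly_Mapping.lookup f u) \<in> S"
      by (simp add: const_def mult_single)
    from D(4)[OF this add(2)] show ?case by simp
  qed
qed

text \<open>The universal property of the free algebra. The family \<open>z\<close> is total on the
  letter type, so that \<open>ev\<close> is multiplicative on all polynomials whatever letters occur
  in them.\<close>

locale evaluation = k_algebra D for D :: "('k::field, 'd) module" (structure) +
  fixes z :: "'x \<Rightarrow> 'd"
  assumes z: "\<And>x. z x \<in> carrier D"
begin

definition ev :: "('k, 'x) free_poly \<Rightarrow> 'd"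
  where "ev f = (\<Oplus>u\<in>Poly_Mapping.keys f. Poly_Mapping.lookup f u \<odot> wprod D z (letters u))"

lemma w_closed [simp]: "wprod D z xs \<in> carrier D"
  using z by (intro wprod_closed) auto

lemma ev_closed [simp]: "ev f \<in> carrier D"
  unfolding ev_def by (intro finsum_closed) auto

lemma ev_superset:
  assumes "finite S" "Poly_Mapping.keys f \<subseteq> S"
  shows "ev f = (\<Oplus>u\<in>S. Poly_Mapping.lookup f u \<odot> wprod D z (letters u))"
  unfolding ev_def using assms
  by (intro add.finprod_mono_neutral_cong_left) (auto simp: in_keys_iff)

lemma ev_add: "ev (f + g) = ev f \<oplus> ev g"
proof -
  let ?S = "Poly_Mapping.keys f \<union> Poly_Mapping.keys g"
  have "ev (f + g) = (\<Oplus>u\<in>?S. Poly_Mapping.lookup (f + g) u \<odot> wprod D z (letters u))"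
    using keys_add[of f g] by (intro ev_superset) auto
  also have "\<dots> = (\<Oplus>u\<in>?S. Poly_Mapping.lookup f u \<odot> wprod D z (letters u) \<oplus> Poly_Mapping.lookup g u \<odot> wprod D z (letters u))"
    by (simp add: lookup_add sm_add_left)
  also have "\<dots> = (\<Oplus>u\<in>?S. Poly_Mapping.lookup f u \<odot> wprod D z (letters u)) \<oplus> (\<Oplus>u\<in>?S. Poly_Mapping.lookup g u \<odot> wprod D z (letters u))"
    by (intro finsum_addf) auto
  also have "\<dots> = ev f \<oplus> ev g" by (subst (1 2) ev_superset[of ?S]) auto
  finally show ?thesis .
qed

lemma ev_single: "ev (Poly_Mapping.single u c) = c \<odot> wprod D z (letters u)"
  by (subst ev_superset[of "{u}"]) auto

lemma ev_zero: "ev 0 = \<zero>"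
  by (simp add: ev_def)

lemma ev_mult: "ev (f * g) = ev f \<otimes> ev g"
proof (induction f rule: single_induct)
  case (add f' u)
  have "ev (Poly_Mapping.single u c * g) = ev (Poly_Mapping.single u c) \<otimes> ev g" for c
  proof (induction g rule: single_induct)
    case (add g' v)
    have "ev (Poly_Mapping.single u c * Poly_Mapping.single v d) = ev (Poly_Mapping.single u c) \<otimes> ev (Poly_Mapping.single v d)" for d
      using z by (simp add: mult_single ev_single wprod_append image_subset_iff sm_mult mult.commute)
    with add show ?case by (simp add: distrib_left ev_add r_distr)
  qed (simp add: ev_zero)
  with add show ?case by (simp add: distrib_right ev_add l_distr)
qed (simp add: ev_zero)

lemma ev_const: "ev (const c) = c \<odot> \<one>"
  by (simp add: const_def ev_single)

lemma ev_gen: "ev (gen x) = z x"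
  using z by (simp add: gen_def ev_single)

lemma ev_hom: "ev \<in> alg_hom (free_algebra G) D"
  by (rule alg_homI)
    (use ev_const[of 1] in \<open>simp_all add: free_algebra_simps ev_add ev_mult ev_const const_simps sm_mult\<close>)

end

lemma presented_algebra:
  fixes G :: "'x set" and Rel :: "('k::field, 'x) free_poly set"
  assumes R: "Rel \<subseteq> carrier (free_algebra G)"
  defines "I \<equiv> Idl\<^bsub>free_algebra G\<^esub> Rel"
  defines "p \<equiv> (+>\<^bsub>free_algebra G\<^esub>) I"
  shows "k_algebra (presented_algebra G Rel)"
    and "p \<in> alg_hom (free_algebra G) (presented_algebra G Rel)"
    and "p ` carrier (free_algebra G) = carrier (presented_algebra G Rel)"
    and "ideal I (free_algebra G)"
    and "\<And>f g. f - g \<in> Rel \<Longrightarrow> f \<in> carrier (free_algebra G) \<Longrightarrow>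
      g \<in> carrier (free_algebra G) \<Longrightarrow> p f = p g"
    and "generating (presented_algebra G Rel) ((p \<circ> gen) ` G)"
proof -
  interpret F: k_algebra "free_algebra G :: ('k, ('k, 'x) free_poly) module" by (rule k_algebra_free)
  show I: "ideal I (free_algebra G)" unfolding I_def by (rule F.genideal_ideal[OF R])
  interpret I: ideal I "free_algebra G" by (rule I)
  have P: "presented_algebra G Rel = alg_quot (free_algebra G) I"
    by (simp add: presented_algebra_def I_def)
  note q = alg_quot[OF k_algebra_free I, folded P p_def]
  show "k_algebra (presented_algebra G Rel)" "p \<in> alg_hom (free_algebra G) (presented_algebra G Rel)"
    "p ` carrier (free_algebra G) = carrier (presented_algebra G Rel)" by (rule q)+
  interpret p: alg_hom_loc "free_algebra G" "presented_algebra G Rel" p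
    by (intro alg_hom_locI k_algebra_free q)
  fix f g assume fg: "f - g \<in> Rel" "f \<in> carrier (free_algebra G)" "g \<in> carrier (free_algebra G)"
  have RI: "r \<in> I" if "r \<in> Rel" for r using F.genideal_self[OF R] that by (auto simp: I_def)
  have "p (f - g) = \<zero>\<^bsub>presented_algebra G Rel\<^esub>"
    using I.a_rcos_const[OF RI[OF fg(1)]] by (simp add: p_def P alg_quot_simps)
  moreover have "p ((f - g) + g) = p (f - g) \<oplus>\<^bsub>presented_algebra G Rel\<^esub> p g"
    using p.add[of "f - g" g] R fg by (auto simp: free_algebra_simps(5))
  ultimately show "p f = p g" using fg by simp
next
  interpret F: k_algebra "free_algebra G :: ('k, ('k, 'x) free_poly) module" by (rule k_algebra_free)
  have I: "ideal I (free_algebra G)" unfolding I_def by (rule F.genideal_ideal[OF R])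
  note q = alg_quot[OF k_algebra_free I, folded p_def, unfolded I_def, folded presented_algebra_def]
  show "generating (presented_algebra G Rel) ((p \<circ> gen) ` G)"
    using generating_image[OF k_algebra_free q generating_free] by (simp add: image_comp)
qed

section \<open>Reduction to q-commuting elements of a division algebra\<close>

locale div_alg = k_algebra D for D :: "('k::field, 'd) module" (structure) +
  assumes div: "division_algebra D"
begin

lemma one_neq_zero [simp]: "\<one> \<noteq> \<zero>" "\<zero> \<noteq> \<one>"
  using div unfolding division_algebra_def by metis+

lemma unit: "x \<in> carrier D \<Longrightarrow> x \<noteq> \<zero> \<Longrightarrow> x \<in> Units D"
  using div unfolding division_algebra_def by blast

lemma inv_closed [simp]: "x \<in> carrier D \<Longrightarrow> x \<noteq> \<zero> \<Longrightarrow> inv x \<in> carrier D"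
  using unit by simp

lemma inv_l [simp]: "x \<in> carrier D \<Longrightarrow> x \<noteq> \<zero> \<Longrightarrow> inv x \<otimes> x = \<one>"
  and inv_r [simp]: "x \<in> carrier D \<Longrightarrow> x \<noteq> \<zero> \<Longrightarrow> x \<otimes> inv x = \<one>"
  using unit by simp_all

lemma inv_l' [simp]: "x \<in> carrier D \<Longrightarrow> x \<noteq> \<zero> \<Longrightarrow> y \<in> carrier D \<Longrightarrow> inv x \<otimes> (x \<otimes> y) = y"
  and inv_r' [simp]: "x \<in> carrier D \<Longrightarrow> x \<noteq> \<zero> \<Longrightarrow> y \<in> carrier D \<Longrightarrow> x \<otimes> (inv x \<otimes> y) = y"
  by (simp_all flip: m_assoc)

lemma mult_zero_iff [simp]:
  assumes "x \<in> carrier D" "y \<in> carrier D" shows "x \<otimes> y = \<zero> \<longleftrightarrow> x = \<zero> \<or> y = \<zero>"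
proof
  assume "x \<otimes> y = \<zero>"
  then have "y = \<zero>" if "x \<noteq> \<zero>" using inv_l'[of x y] that assms by simp
  then show "x = \<zero> \<or> y = \<zero>" by blast
qed (use assms in auto)

lemma inv_nonzero [simp]: "x \<in> carrier D \<Longrightarrow> x \<noteq> \<zero> \<Longrightarrow> inv x \<noteq> \<zero>"
  using inv_l[of x] by (metis l_null one_neq_zero(1))

lemma inv_char':
  assumes "x \<in> carrier D" "y \<in> carrier D" "x \<otimes> y = \<one>" shows "inv x = y"
proof -
  have "x \<noteq> \<zero>" using assms by auto
  then show ?thesis using inv_l'[of x y] assms by simp
qed

lemma inv_mult:
  assumes "x \<in> carrier D" "x \<noteq> \<zero>" "y \<in> carrier D" "y \<noteq> \<zero>"
  shows "inv (x \<otimes> y) = inv y \<otimes> inv x"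
  using assms by (intro inv_char') (simp_all add: m_assoc)

lemma nc_domain_D: "nc_domain D"
  unfolding nc_domain_def using ring_A by auto

end

lemma div_algI: "division_algebra D \<Longrightarrow> div_alg D"
  unfolding div_alg_def div_alg_axioms_def by (auto simp: division_algebra_def)

definition div_subalg :: "'d set \<Rightarrow> ('k, 'd) module \<Rightarrow> bool"
  where "div_subalg H D \<longleftrightarrow> subalg H D \<and> (\<forall>x\<in>H - {\<zero>\<^bsub>D\<^esub>}. inv\<^bsub>D\<^esub> x \<in> H)"

definition qcommute :: "('k::field, 'd) module \<Rightarrow> 'd \<Rightarrow> 'd \<Rightarrow> bool"
  where "qcommute D x y \<longleftrightarrow> (\<exists>c. c \<noteq> 0 \<and> x \<otimes>\<^bsub>D\<^esub> y = c \<odot>\<^bsub>D\<^esub> (y \<otimes>\<^bsub>D\<^esub> x))"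

text \<open>Right fractions of a right Ore subalgebra are closed under all operations: sums by a
  common denominator, products by moving a denominator to the right, inverses by exchanging
  numerator and denominator.\<close>

lemma (in div_alg) div_subalg_fractions:
  assumes B: "subalg B D"
    and ore: "\<And>a b. a \<in> B \<Longrightarrow> b \<in> B \<Longrightarrow> b \<noteq> \<zero> \<Longrightarrow> \<exists>u\<in>B. \<exists>v\<in>B. v \<noteq> \<zero> \<and> a \<otimes> v = b \<otimes> u"
  shows "div_subalg {a \<otimes> inv b | a b. a \<in> B \<and> b \<in> B \<and> b \<noteq> \<zero>} D" (is "div_subalg ?L D")
    and "B \<subseteq> {a \<otimes> inv b | a b. a \<in> B \<and> b \<in> B \<and> b \<noteq> \<zero>}"
proof -
  note S = subalgD[OF k_algebra_axioms B]
  note c [simp] = S(1)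
  have LI: "a \<otimes> inv b \<in> ?L" if "a \<in> B" "b \<in> B" "b \<noteq> \<zero>" for a b using that by blast
  show BL: "B \<subseteq> ?L"
  proof
    fix b assume "b \<in> B"
    then show "b \<in> ?L" using LI[of b \<one>] S(2) by simp
  qed
  have "subalg ?L D"
  proof (rule subalgI[OF k_algebra_axioms])
    show "?L \<subseteq> carrier D" by auto
    show "\<one> \<in> ?L" using BL S(2) by blast
    fix x y assume "x \<in> ?L" "y \<in> ?L"
    then obtain a b p d where x: "x = a \<otimes> inv b" "a \<in> B" "b \<in> B" "b \<noteq> \<zero>"
      and y: "y = p \<otimes> inv d" "p \<in> B" "d \<in> B" "d \<noteq> \<zero>" by blast
    \<comment> \<open>From \<open>d v = b u\<close> both fractions get the denominator
      \<open>d v\<close>.\<close>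
    obtain u v where uv: "u \<in> B" "v \<in> B" "v \<noteq> \<zero>" "d \<otimes> v = b \<otimes> u" using ore[of d b] x y by blast
    have u: "u \<noteq> \<zero>" using uv y x mult_zero_iff[of d v] by auto
    have "x = a \<otimes> u \<otimes> inv (b \<otimes> u)" using x uv u by (simp add: inv_mult m_assoc)
    moreover have "y = p \<otimes> v \<otimes> inv (d \<otimes> v)" using y uv(1-3) by (simp add: inv_mult m_assoc)
    ultimately have "x \<oplus> y = (a \<otimes> u \<oplus> p \<otimes> v) \<otimes> inv (d \<otimes> v)"
      using uv x y u by (simp add: l_distr)
    then show "x \<oplus> y \<in> ?L" using LI[of "a \<otimes> u \<oplus> p \<otimes> v" "d \<otimes> v"] uv x y u by (simp add: S(4,6))
    \<comment> \<open>The Ore condition rewrites the left fraction \<open>b^-1 p\<close> as the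
      right fraction \<open>s t^-1\<close>.\<close>
    obtain s t where st: "s \<in> B" "t \<in> B" "t \<noteq> \<zero>" "p \<otimes> t = b \<otimes> s" using ore[of p b] x y by blast
    have "inv b \<otimes> p = inv b \<otimes> (p \<otimes> t) \<otimes> inv t" using st(1-3) x y by (simp add: m_assoc)
    also have "\<dots> = s \<otimes> inv t" using st x y by simp
    finally have e: "inv b \<otimes> p = s \<otimes> inv t" .
    have "x \<otimes> y = a \<otimes> (inv b \<otimes> p) \<otimes> inv d" using x y by (simp add: m_assoc)
    also have "\<dots> = (a \<otimes> s) \<otimes> inv (d \<otimes> t)" using x y st by (simp add: e inv_mult m_assoc)
    finally show "x \<otimes> y \<in> ?L" using LI[of "a \<otimes> s" "d \<otimes> t"] x y st by (simp add: S(6))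
  next
    fix c x assume "x \<in> ?L"
    then obtain a b where x: "x = a \<otimes> inv b" "a \<in> B" "b \<in> B" "b \<noteq> \<zero>" by blast
    then have "c \<odot> x = (c \<odot> a) \<otimes> inv b" by (simp add: sm_mult)
    then show "c \<odot> x \<in> ?L" using LI[of "c \<odot> a" b] x by (simp add: S(7))
  qed
  moreover have "inv x \<in> ?L" if "x \<in> ?L" "x \<noteq> \<zero>" for x
  proof -
    obtain a b where x: "x = a \<otimes> inv b" "a \<in> B" "b \<in> B" "b \<noteq> \<zero>" using \<open>x \<in> ?L\<close> by blast
    then have a: "a \<noteq> \<zero>" using that by auto
    then have "inv x = b \<otimes> inv a" using x by (intro inv_char') (simp_all add: m_assoc)
    then show ?thesis using LI[of b a] x a by simp
  qed
  ultimately show "div_subalg ?L D" by (simp add: div_subalg_def)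
qed

text \<open>\<open>isomorphic_Fract\<close> asks for fractions of \<open>T\<close> whose elements
  are sets of pairs over \<open>T\<close>, whereas \<open>D\<close> may have any carrier type. An
  element \<open>d\<close> is encoded by its graph, the set of all \<open>(a, b)\<close> with
  \<open>\<phi> a = d \<phi> b\<close>, and the operations are transported along this
  injection.\<close>

lemma is_Fract_transport:
  fixes D :: "('k::field, 'd) module" and T :: "('k, 'b) module"
  assumes T: "k_algebra T" and fr: "is_Fract D \<phi> T"
  shows "\<exists>(E :: ('k, ('b \<times> 'b) set) module) \<psi>. is_Fract E \<psi> T \<and> alg_isomorphic D E"
proof -
  interpret D: div_alg D using fr by (intro div_algI) (simp add: is_Fract_def)
  interpret T: k_algebra T by fact
  have hom: "\<phi> \<in> alg_hom T D" and inj: "inj_on \<phi> (carrier T)" using fr by (simp_all add: is_Fract_def)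
  interpret \<phi>: alg_hom_loc T D \<phi> by (intro alg_hom_locI T D.k_algebra_axioms hom)
  define f where "f d = {(a, b). a \<in> carrier T \<and> b \<in> carrier T \<and> \<phi> a = d \<otimes>\<^bsub>D\<^esub> \<phi> b}" for d
  have inj_f: "inj_on f (carrier D)"
  proof (rule inj_onI)
    fix d d' assume d: "d \<in> carrier D" "d' \<in> carrier D" "f d = f d'"
    obtain a b where ab: "a \<in> carrier T" "b \<in> carrier T" "b \<noteq> \<zero>\<^bsub>T\<^esub>" "d = \<phi> a \<otimes>\<^bsub>D\<^esub> inv\<^bsub>D\<^esub> (\<phi> b)"
      using fr d(1) unfolding is_Fract_def by blast
    have b: "\<phi> b \<noteq> \<zero>\<^bsub>D\<^esub>" using inj ab unfolding \<phi>.inj_iff by blast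
    have "(a, b) \<in> f d" using ab b by (simp add: f_def D.m_assoc)
    then have "(a, b) \<in> f d'" using d by simp
    then have e: "\<phi> a = d' \<otimes>\<^bsub>D\<^esub> \<phi> b" by (simp add: f_def)
    then show "d = d'" using ab b d by (simp add: D.m_assoc)
  qed
  define g where "g = inv_into (carrier D) f"
  have gf: "g (f d) = d" if "d \<in> carrier D" for d using that inj_f by (simp add: g_def)
  define E :: "('k, ('b \<times> 'b) set) module" where
    "E = \<lparr>carrier = f ` carrier D, monoid.mult = (\<lambda>x y. f (g x \<otimes>\<^bsub>D\<^esub> g y)), one = f \<one>\<^bsub>D\<^esub>, zero = f \<zero>\<^bsub>D\<^esub>,
       add = (\<lambda>x y. f (g x \<oplus>\<^bsub>D\<^esub> g y)), module.smult = (\<lambda>c x. f (c \<odot>\<^bsub>D\<^esub> g x))\<rparr>"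
  have E: "k_algebra E" "f \<in> alg_hom D E"
    by (rule k_algebra_image[OF D.k_algebra_axioms, of E f]; simp add: E_def gf)+
  interpret E: k_algebra E by (rule E)
  interpret f: alg_hom_loc D E f by (intro alg_hom_locI D.k_algebra_axioms E)
  have car: "carrier E = f ` carrier D" by (simp add: E_def)
  have fz: "f d = \<zero>\<^bsub>E\<^esub> \<longleftrightarrow> d = \<zero>\<^bsub>D\<^esub>" if "d \<in> carrier D" for d
    using inj_f that unfolding f.inj_iff by (auto simp: f.zero)
  have ne: "\<one>\<^bsub>E\<^esub> \<noteq> \<zero>\<^bsub>E\<^esub>" using fz[of "\<one>\<^bsub>D\<^esub>"] by (simp add: f.one)
  have inv: "f d \<in> Units E" "inv\<^bsub>E\<^esub> (f d) = f (inv\<^bsub>D\<^esub> d)" if "d \<in> carrier D" "d \<noteq> \<zero>\<^bsub>D\<^esub>" for d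
  proof -
    have 1: "f d \<otimes>\<^bsub>E\<^esub> f (inv\<^bsub>D\<^esub> d) = \<one>\<^bsub>E\<^esub>" "f (inv\<^bsub>D\<^esub> d) \<otimes>\<^bsub>E\<^esub> f d = \<one>\<^bsub>E\<^esub>"
      using that by (simp_all add: f.mult[symmetric] f.one)
    moreover have "f d \<in> carrier E" "f (inv\<^bsub>D\<^esub> d) \<in> carrier E" using that by auto
    ultimately show u: "f d \<in> Units E" unfolding Units_def by blast
    show "inv\<^bsub>E\<^esub> (f d) = f (inv\<^bsub>D\<^esub> d)"
      using 1 that by (intro E.inv_char) auto
  qed
  have "Units E = carrier E - {\<zero>\<^bsub>E\<^esub>}"
  proof (intro equalityI subsetI)
    fix x assume x: "x \<in> Units E"
    then have "x \<noteq> \<zero>\<^bsub>E\<^esub>" using E.Units_l_inv[OF x] ne E.r_null[of "inv\<^bsub>E\<^esub> x"] E.Units_inv_closed[OF x] by metis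
    with x show "x \<in> carrier E - {\<zero>\<^bsub>E\<^esub>}" by auto
  next
    fix x assume "x \<in> carrier E - {\<zero>\<^bsub>E\<^esub>}"
    then obtain d where "x = f d" "d \<in> carrier D" "d \<noteq> \<zero>\<^bsub>D\<^esub>" by (auto simp: car f.zero[symmetric])
    then show "x \<in> Units E" using inv by simp
  qed
  then have div: "division_algebra E" using E ne by (simp add: division_algebra_def)
  have "is_Fract E (f \<circ> \<phi>) T"
    unfolding is_Fract_def
  proof (intro conjI ballI div alg_hom_comp[OF hom E(2)])
    show "inj_on (f \<circ> \<phi>) (carrier T)"
      by (rule comp_inj_on[OF inj inj_on_subset[OF inj_f]]) auto
    fix e assume "e \<in> carrier E"
    then obtain d where d: "e = f d" "d \<in> carrier D" by (auto simp: car)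
    obtain a b where ab: "a \<in> carrier T" "b \<in> carrier T - {\<zero>\<^bsub>T\<^esub>}" "d = \<phi> a \<otimes>\<^bsub>D\<^esub> inv\<^bsub>D\<^esub> (\<phi> b)"
      using fr d(2) unfolding is_Fract_def by blast
    have b: "\<phi> b \<noteq> \<zero>\<^bsub>D\<^esub>" "\<phi> b \<in> carrier D" using inj ab unfolding \<phi>.inj_iff by blast+
    have "e = (f \<circ> \<phi>) a \<otimes>\<^bsub>E\<^esub> inv\<^bsub>E\<^esub> ((f \<circ> \<phi>) b)"
      using ab b by (simp add: d f.mult inv)
    with ab show "\<exists>a\<in>carrier T. \<exists>b\<in>carrier T - {\<zero>\<^bsub>T\<^esub>}. e = (f \<circ> \<phi>) a \<otimes>\<^bsub>E\<^esub> inv\<^bsub>E\<^esub> ((f \<circ> \<phi>) b)" by blast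
  qed
  moreover have "f \<in> alg_iso D E"
    using E inj_f by (simp add: alg_iso_def bij_betw_def car)
  ultimately show ?thesis unfolding alg_isomorphic_def by blast
qed

lemma quantum_affine_space:
  fixes lam :: "nat \<Rightarrow> nat \<Rightarrow> 'k::field" and N :: nat
  defines "Rel \<equiv> {gen i * gen j - const (lam i j) * gen j * gen i | i j. i \<in> {1..N} \<and> j \<in> {1..N}}"
  defines "p \<equiv> (+>\<^bsub>free_algebra {1..N}\<^esub>) (Idl\<^bsub>free_algebra {1..N}\<^esub> Rel)"
  shows "k_algebra (quantum_affine_space N lam)"
    and "straightening (quantum_affine_space N lam) (\<lambda>i. p (gen (Suc i))) N"
    and "generating (quantum_affine_space N lam) ((\<lambda>i. p (gen (Suc i))) ` {..<N})"
    and "\<And>D z. k_algebra D \<Longrightarrow> (\<And>i. i \<in> {1..N} \<Longrightarrow> z i \<in> carrier D) \<Longrightarrow>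
      (\<And>i j. i \<in> {1..N} \<Longrightarrow> j \<in> {1..N} \<Longrightarrow> z i \<otimes>\<^bsub>D\<^esub> z j = lam i j \<odot>\<^bsub>D\<^esub> (z j \<otimes>\<^bsub>D\<^esub> z i)) \<Longrightarrow>
      \<exists>h\<in>alg_hom (quantum_affine_space N lam) D. \<forall>i\<in>{1..N}. h (p (gen i)) = z i"
proof -
  let ?F = "free_algebra {1..N} :: ('k, ('k, nat) free_poly) module"
  interpret F: k_algebra ?F by (rule k_algebra_free)
  have car: "gen i * gen j \<in> carrier ?F" "const c * gen j * gen i \<in> carrier ?F" if "i \<in> {1..N}" "j \<in> {1..N}" for i j c
    using that by (intro free_mult_closed gen_in_free const_in_free; simp)+
  have sub: "Rel \<subseteq> carrier ?F"
    unfolding Rel_def using car by (auto intro!: free_minus_closed simp del: One_nat_def atLeastAtMost_iff)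
  have Q: "quantum_affine_space N lam = presented_algebra {1..N} Rel"
    by (simp add: quantum_affine_space_def Rel_def)
  note P = presented_algebra[OF sub, folded p_def Q]
  show A: "k_algebra (quantum_affine_space N lam)" by (rule P)
  interpret A: k_algebra "quantum_affine_space N lam" by (rule A)
  interpret p: alg_hom_loc ?F "quantum_affine_space N lam" p by (intro alg_hom_locI k_algebra_free P)
  \<comment> \<open>The presentation numbers the generators from 1 and \<open>straightening\<close>
    from 0; hence the shift by \<open>Suc\<close>.\<close>
  let ?g = "\<lambda>i. p (gen (Suc i))"
  have g: "?g i \<in> carrier (quantum_affine_space N lam)" if "i < N" for i
    using that by (intro p.closed gen_in_free) auto
  have "(p \<circ> gen) ` {1..N} = ?g ` {..<N}"
    unfolding image_comp[symmetric] lessThan_atLeast0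
    by (simp add: image_image image_Suc_atLeastLessThan[symmetric] atLeastLessThanSuc_atLeastAtMost[symmetric] del: image_Suc_atLeastLessThan)
  then show "generating (quantum_affine_space N lam) (?g ` {..<N})" using P(6) by simp
  have rel: "p (gen i) \<otimes>\<^bsub>quantum_affine_space N lam\<^esub> p (gen j) =
      lam i j \<odot>\<^bsub>quantum_affine_space N lam\<^esub> (p (gen j) \<otimes>\<^bsub>quantum_affine_space N lam\<^esub> p (gen i))"
    if "i \<in> {1..N}" "j \<in> {1..N}" for i j
  proof -
    have gi: "gen i \<in> carrier ?F" "gen j \<in> carrier ?F" using that by (simp_all add: gen_in_free)
    have "p (gen i * gen j) = p (const (lam i j) * gen j * gen i)"
      using that car by (intro P(5)) (auto simp: Rel_def)
    also have "const (lam i j) * gen j * gen i = lam i j \<odot>\<^bsub>?F\<^esub> (gen j \<otimes>\<^bsub>?F\<^esub> gen i)"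
      by (simp add: free_algebra_simps(2-6) mult.assoc)
    also have "gen i * gen j = gen i \<otimes>\<^bsub>?F\<^esub> gen j" by (simp add: free_algebra_simps(2-6))
    finally show ?thesis using gi by (simp add: p.mult p.smult del: One_nat_def)
  qed
  show "straightening (quantum_affine_space N lam) ?g N"
    unfolding straightening_def
  proof (intro conjI allI impI)
    fix i j assume ij: "j < N" "i < j"
    let ?S = "{?g a \<otimes>\<^bsub>quantum_affine_space N lam\<^esub> ?g b |a b. a < j \<and> b < N}"
    \<comment> \<open>For \<open>i < j\<close> the product \<open>g j g i\<close> is a multiple of
      \<open>g i g j\<close>, whose first index is smaller than \<open>j\<close>.\<close>
    have "?g i \<otimes>\<^bsub>quantum_affine_space N lam\<^esub> ?g j \<in> ?S" using ij less_trans[OF ij(2,1)] by blast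
    from lspan.smult[OF lspan.base[OF this]] show "?g j \<otimes>\<^bsub>quantum_affine_space N lam\<^esub> ?g i \<in> lspan (quantum_affine_space N lam) ?S"
      using rel[of "Suc j" "Suc i"] ij by simp
  qed (use g in auto)
  fix D :: "('k, 'e) module" and z
  assume D: "k_algebra D" and z: "\<And>i. i \<in> {1..N} \<Longrightarrow> z i \<in> carrier D"
    and zz: "\<And>i j. i \<in> {1..N} \<Longrightarrow> j \<in> {1..N} \<Longrightarrow> z i \<otimes>\<^bsub>D\<^esub> z j = lam i j \<odot>\<^bsub>D\<^esub> (z j \<otimes>\<^bsub>D\<^esub> z i)"
  interpret D: k_algebra D by fact
  \<comment> \<open>\<open>evaluation\<close> expects a value for each letter; letters outside
    \<open>{1..N}\<close> do not occur in this free algebra and are sent to zero.\<close>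
  define z' where "z' i = (if i \<in> {1..N} then z i else \<zero>\<^bsub>D\<^esub>)" for i
  have z': "z' i = z i" if "i \<in> {1..N}" for i using that by (simp add: z'_def)
  interpret ev: evaluation D z'
    by (unfold_locales) (use z in \<open>auto simp: z'_def\<close>)
  interpret e: alg_hom_loc ?F D ev.ev by (intro alg_hom_locI k_algebra_free D ev.ev_hom)
  have "ev.ev r = \<zero>\<^bsub>D\<^esub>" if rR: "r \<in> Rel" for r
  proof -
    obtain i j where r: "r = gen i * gen j - const (lam i j) * gen j * gen i" "i \<in> {1..N}" "j \<in> {1..N}"
      using rR unfolding Rel_def by blast
    have "ev.ev r \<oplus>\<^bsub>D\<^esub> ev.ev (const (lam i j) * gen j * gen i) = ev.ev (gen i * gen j)"
      unfolding r(1) ev.ev_add[symmetric] by simp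
    also have "ev.ev (gen i * gen j) = ev.ev (const (lam i j) * gen j * gen i)"
      using zz[OF r(2,3)] z[OF r(2)] z[OF r(3)] r(2,3)
      by (simp add: ev.ev_mult ev.ev_gen ev.ev_const D.sm_mult z' del: One_nat_def)
    finally show ?thesis by simp
  qed
  then have "Rel \<subseteq> {x \<in> carrier ?F. ev.ev x = \<zero>\<^bsub>D\<^esub>}" using sub by auto
  then have "Idl\<^bsub>?F\<^esub> Rel \<subseteq> {x \<in> carrier ?F. ev.ev x = \<zero>\<^bsub>D\<^esub>}"
    by (rule F.genideal_minimal[OF e.kernel_ideal])
  then have "\<exists>h. h \<in> alg_hom (quantum_affine_space N lam) D \<and> (\<forall>x\<in>carrier ?F. h (p x) = ev.ev x)"
    unfolding Q presented_algebra_def p_def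
    by (intro quot_lift k_algebra_free D ev.ev_hom F.genideal_ideal sub) auto
  then obtain h where h: "h \<in> alg_hom (quantum_affine_space N lam) D" "\<forall>x\<in>carrier ?F. h (p x) = ev.ev x" by blast
  have "h (p (gen i)) = z i" if "i \<in> {1..N}" for i
    using bspec[OF h(2) gen_in_free[OF that]] z'[OF that] by (simp add: ev.ev_gen)
  with h(1) show "\<exists>h\<in>alg_hom (quantum_affine_space N lam) D. \<forall>i\<in>{1..N}. h (p (gen i)) = z i" by blast
qed

lemma qcommute_matrix:
  assumes D: "k_algebra D" and zs: "set zs \<subseteq> carrier D"
    and q: "\<And>x y. x \<in> set zs \<Longrightarrow> y \<in> set zs \<Longrightarrow> qcommute D x y"
  shows "\<exists>lam. mult_antisym (length zs) lam \<and> (\<forall>i\<in>{1..length zs}. \<forall>j\<in>{1..length zs}.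
    zs ! (i - 1) \<otimes>\<^bsub>D\<^esub> zs ! (j - 1) = lam i j \<odot>\<^bsub>D\<^esub> (zs ! (j - 1) \<otimes>\<^bsub>D\<^esub> zs ! (i - 1)))"
proof -
  interpret k_algebra D by fact
  define c where "c i j = (SOME c. c \<noteq> 0 \<and>
    zs ! (i - 1) \<otimes>\<^bsub>D\<^esub> zs ! (j - 1) = c \<odot>\<^bsub>D\<^esub> (zs ! (j - 1) \<otimes>\<^bsub>D\<^esub> zs ! (i - 1)))" for i j :: nat
  have c: "c i j \<noteq> 0 \<and> zs ! (i - 1) \<otimes>\<^bsub>D\<^esub> zs ! (j - 1) = c i j \<odot>\<^bsub>D\<^esub> (zs ! (j - 1) \<otimes>\<^bsub>D\<^esub> zs ! (i - 1))"
    if "i \<in> {1..length zs}" "j \<in> {1..length zs}" for i j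
  proof -
    have "zs ! (i - 1) \<in> set zs" "zs ! (j - 1) \<in> set zs" using that by (auto intro!: nth_mem)
    from q[OF this] show ?thesis unfolding c_def qcommute_def by (rule someI_ex)
  qed
  have zc: "zs ! (i - 1) \<in> carrier D" if "i \<in> {1..length zs}" for i
  proof -
    have "i - 1 < length zs" using that by auto
    then show ?thesis using zs nth_mem by blast
  qed
  \<comment> \<open>The chosen scalars may fail to be antisymmetric, as any nonzero scalar fits a
    pair with zero product. So the entries above the diagonal are kept and the others are derived
    from them.\<close>
  define lam where "lam i j = (if i = j then 1 else if i < j then c i j else inverse (c j i))" for i j
  show ?thesis
  proof (intro exI[of _ lam] conjI ballI)
    show "mult_antisym (length zs) lam"
      unfolding mult_antisym_def using c by (auto simp: lam_def)
    fix i j assume ij: "i \<in> {1..length zs}" "j \<in> {1..length zs}"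
    have "zs ! (j - 1) \<otimes>\<^bsub>D\<^esub> zs ! (i - 1) = inverse (c i j) \<odot>\<^bsub>D\<^esub> (zs ! (i - 1) \<otimes>\<^bsub>D\<^esub> zs ! (j - 1))"
      if "i \<in> {1..length zs}" "j \<in> {1..length zs}" for i j
      using c[OF that] zc[OF that(1)] zc[OF that(2)] by simp
    from this[OF ij(2,1)] show "zs ! (i - 1) \<otimes>\<^bsub>D\<^esub> zs ! (j - 1) = lam i j \<odot>\<^bsub>D\<^esub> (zs ! (j - 1) \<otimes>\<^bsub>D\<^esub> zs ! (i - 1))"
      using c[OF ij] zc[OF ij(1)] by (auto simp: lam_def)
  qed
qed

definition Fract_of_quantum_affine_factor :: "('k::field, 'a) module \<Rightarrow> bool"
  where "Fract_of_quantum_affine_factor R \<longleftrightarrow>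
    (\<exists>N lam J. N \<ge> 1 \<and> mult_antisym N (lam :: nat \<Rightarrow> nat \<Rightarrow> 'k) \<and>
      completely_prime J (quantum_affine_space N lam) \<and>
      isomorphic_Fract R (alg_quot (quantum_affine_space N lam) J))"

text \<open>The common reduction of all families to the elements \<open>zs\<close> in
  \<open>key\<close>. The division algebra is universally quantified there because the ring of
  fractions is built inside the proof, from the Ore condition that straightening yields.\<close>

theorem quantum_Gelfand_Kirillov:
  fixes R :: "('k::field, 'a) module"
  assumes R: "k_algebra R" and dom: "nc_domain R"
    and gen: "generating R (g ` {..<M})" and str: "straightening R g M"
    and key: "\<And>(D :: ('k, ('a \<times> 'a) set) module) \<phi>. div_alg D \<Longrightarrow> \<phi> \<in> alg_hom R D \<Longrightarrow>
      \<exists>zs. set zs \<subseteq> carrier D \<and> (\<forall>x\<in>set zs. \<forall>y\<in>set zs. qcommute D x y) \<and>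
        (\<forall>H\<in>{H. div_subalg H D \<and> set zs \<subseteq> H}. (\<phi> \<circ> g) ` {..<M} \<subseteq> H)"
  shows "Fract_of_quantum_affine_factor R"
proof -
  interpret R: k_algebra R by fact
  interpret R: ore_domain R
    by unfold_locales (use dom R.right_Ore_of_straightening[OF dom gen str] in auto)
  define D where "D = R.Frac"
  have fr: "is_Fract D R.emb R" unfolding D_def by (rule R.is_Fract_Frac)
  interpret D: div_alg D using fr by (intro div_algI) (simp add: is_Fract_def)
  have emb: "R.emb \<in> alg_hom R D" using fr by (simp add: is_Fract_def)
  interpret emb: alg_hom_loc R D R.emb by (intro alg_hom_locI R D.k_algebra_axioms emb)
  obtain zs where zs: "set zs \<subseteq> carrier D"
    and Z: "\<forall>x\<in>set zs. \<forall>y\<in>set zs. qcommute D x y"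
      "\<forall>H\<in>{H. div_subalg H D \<and> set zs \<subseteq> H}. (R.emb \<circ> g) ` {..<M} \<subseteq> H"
    using key[OF D.div_alg_axioms emb] by (elim exE conjE)
  have q: "qcommute D x y" if "x \<in> set zs" "y \<in> set zs" for x y
    using that Z(1) by simp
  have zgen: "(R.emb \<circ> g) ` {..<M} \<subseteq> H" if "div_subalg H D" "set zs \<subseteq> H" for H
    by (rule bspec[OF Z(2)]) (use that in simp)
  \<comment> \<open>Adjoining \<open>1\<close> keeps the family q-commuting and ensures
    \<open>N \<ge> 1\<close>, also for empty \<open>zs\<close>.\<close>
  define ws where "ws = \<one>\<^bsub>D\<^esub> # zs"
  have ws: "set ws \<subseteq> carrier D" using zs by (simp add: ws_def)
  have "qcommute D x \<one>\<^bsub>D\<^esub>" "qcommute D \<one>\<^bsub>D\<^esub> x" if "x \<in> carrier D" for x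
    using that unfolding qcommute_def by (auto intro!: exI[of _ 1])
  then have qw: "qcommute D x y" if "x \<in> set ws" "y \<in> set ws" for x y
    using that q zs D.one_closed by (auto simp: ws_def)
  define N where "N = length ws"
  obtain lam where lam: "mult_antisym N lam"
    "\<And>i j. i \<in> {1..N} \<Longrightarrow> j \<in> {1..N} \<Longrightarrow>
      ws ! (i - 1) \<otimes>\<^bsub>D\<^esub> ws ! (j - 1) = lam i j \<odot>\<^bsub>D\<^esub> (ws ! (j - 1) \<otimes>\<^bsub>D\<^esub> ws ! (i - 1))"
    using qcommute_matrix[OF D.k_algebra_axioms ws qw] unfolding N_def by blast
  define A where "A = quantum_affine_space N lam"
  define p where "p = (+>\<^bsub>free_algebra {1..N}\<^esub>) (Idl\<^bsub>free_algebra {1..N}\<^esub>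
    {gen i * gen j - const (lam i j) * gen j * gen i | i j. i \<in> {1..N} \<and> j \<in> {1..N}})"
  note A = quantum_affine_space[where N = N and lam = lam, folded p_def A_def]
  have wc: "ws ! (i - 1) \<in> carrier D" if "i \<in> {1..N}" for i
  proof -
    have "i - 1 < length ws" using that by (auto simp: N_def)
    then show ?thesis using ws nth_mem by blast
  qed
  obtain h0 where h0: "h0 \<in> alg_hom A D" "\<forall>i\<in>{1..N}. h0 (p (gen i)) = ws ! (i - 1)"
    using A(4)[OF D.k_algebra_axioms wc lam(2)] by blast
  \<comment> \<open>\<open>J\<close> is the kernel of the evaluation at \<open>ws\<close>, so that
    the factor algebra embeds into \<open>D\<close> as the subalgebra generated by
    \<open>ws\<close>.\<close>
  obtain J h where J: "completely_prime J A" and h: "h \<in> alg_hom (alg_quot A J) D"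
    "inj_on h (carrier (alg_quot A J))" "\<And>x. x \<in> carrier A \<Longrightarrow> h (J +>\<^bsub>A\<^esub> x) = h0 x"
    using quot_kernel[OF A(1) D.k_algebra_axioms h0(1) D.nc_domain_D] by metis
  define T where "T = alg_quot A J"
  note T = completely_primeD[OF A(1) J, folded T_def]
  interpret A: k_algebra A by (rule A)
  interpret T: k_algebra T by (rule T)
  interpret h: alg_hom_loc T D h by (intro alg_hom_locI T D.k_algebra_axioms h[folded T_def])
  let ?g = "\<lambda>i. p (gen (Suc i))"
  have gT: "generating T (((+>\<^bsub>A\<^esub>) J \<circ> ?g) ` {..<N})"
    using generating_image[OF A(1) T(1,3,4) A(3)] by (simp add: image_comp)
  have "right_Ore T"
    by (rule T.right_Ore_of_straightening[OF T(2) gT straightening_image[OF A(1) T(1,3) A(2)]])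
  then have ore: "\<exists>u\<in>carrier T. \<exists>v\<in>carrier T - {\<zero>\<^bsub>T\<^esub>}. a \<otimes>\<^bsub>T\<^esub> v = b \<otimes>\<^bsub>T\<^esub> u"
    if "a \<in> carrier T" "b \<in> carrier T" "b \<noteq> \<zero>\<^bsub>T\<^esub>" for a b
    using that unfolding right_Ore_def by simp
  define B where "B = h ` carrier T"
  have hz: "h x = \<zero>\<^bsub>D\<^esub> \<longleftrightarrow> x = \<zero>\<^bsub>T\<^esub>" if "x \<in> carrier T" for x
    using h(2)[folded T_def] that unfolding h.inj_iff by (auto simp: h.zero)
  have B: "subalg B D"
  proof (rule subalgI[OF D.k_algebra_axioms])
    show "\<one>\<^bsub>D\<^esub> \<in> B" unfolding B_def using h.one by (metis T.one_closed imageI)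
    show "x \<oplus>\<^bsub>D\<^esub> y \<in> B" "x \<otimes>\<^bsub>D\<^esub> y \<in> B" if "x \<in> B" "y \<in> B" for x y
      using that unfolding B_def by (auto simp flip: h.add h.mult)
  qed (auto simp: B_def simp flip: h.smult)
  have oreB: "\<exists>u\<in>B. \<exists>v\<in>B. v \<noteq> \<zero>\<^bsub>D\<^esub> \<and> a \<otimes>\<^bsub>D\<^esub> v = b \<otimes>\<^bsub>D\<^esub> u" if ab: "a \<in> B" "b \<in> B" "b \<noteq> \<zero>\<^bsub>D\<^esub>" for a b
  proof -
    obtain s t where st: "a = h s" "b = h t" "s \<in> carrier T" "t \<in> carrier T"
      using ab(1,2) unfolding B_def by blast
    then have "t \<noteq> \<zero>\<^bsub>T\<^esub>" using ab hz by auto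
    then obtain u v where uv: "u \<in> carrier T" "v \<in> carrier T" "v \<noteq> \<zero>\<^bsub>T\<^esub>" "s \<otimes>\<^bsub>T\<^esub> v = t \<otimes>\<^bsub>T\<^esub> u"
      using ore[OF st(3,4)] by blast
    have "a \<otimes>\<^bsub>D\<^esub> h v = b \<otimes>\<^bsub>D\<^esub> h u" using st uv by (simp flip: h.mult)
    moreover have "h u \<in> B" "h v \<in> B" using uv by (simp_all add: B_def)
    moreover have "h v \<noteq> \<zero>\<^bsub>D\<^esub>" using uv hz by simp
    ultimately show ?thesis by blast
  qed
  \<comment> \<open>\<open>L\<close> consists of the right fractions of \<open>B\<close> and is a
    division subalgebra of \<open>D\<close>. It contains \<open>zs\<close>, hence the generators of
    \<open>R\<close>, hence \<open>R\<close> and all its fractions; so \<open>L\<close> is all of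
    \<open>D\<close>.\<close>
  define L where "L = {a \<otimes>\<^bsub>D\<^esub> inv\<^bsub>D\<^esub> b | a b. a \<in> B \<and> b \<in> B \<and> b \<noteq> \<zero>\<^bsub>D\<^esub>}"
  note L = D.div_subalg_fractions[OF B oreB, folded L_def]
  have zL: "set zs \<subseteq> L"
  proof
    fix x assume "x \<in> set zs"
    then have "x \<in> set ws" by (simp add: ws_def)
    then obtain i where i: "i < length ws" "x = ws ! i" by (metis in_set_conv_nth)
    then have iN: "Suc i \<in> {1..N}" by (auto simp: N_def)
    have c: "p (gen (Suc i)) \<in> carrier A" using A(2) iN by (auto simp: straightening_def)
    have "h (J +>\<^bsub>A\<^esub> p (gen (Suc i))) = x" using h0(2)[rule_format, OF iN] h(3)[OF c] i by simp
    moreover have "J +>\<^bsub>A\<^esub> p (gen (Suc i)) \<in> carrier T" using T(4) c by blast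
    ultimately have "x \<in> B" unfolding B_def by blast
    then show "x \<in> L" using L(2) by blast
  qed
  note gL = zgen[OF L(1) zL]
  have L': "subalg L D" using L(1) by (simp add: div_subalg_def)
  note LD = subalgD[OF D.k_algebra_axioms L']
  have "subalg {x \<in> carrier R. R.emb x \<in> L} R"
  proof (rule subalgI[OF R])
    show "{x \<in> carrier R. R.emb x \<in> L} \<subseteq> carrier R" by blast
    show "\<one>\<^bsub>R\<^esub> \<in> {x \<in> carrier R. R.emb x \<in> L}" using LD(2) by (simp add: emb.one)
  qed (simp_all add: emb.mult emb.add emb.smult LD(4,6,7))
  moreover have "g ` {..<M} \<subseteq> {x \<in> carrier R. R.emb x \<in> L}"
    using gL gen by (auto simp: generating_def)
  ultimately have RL: "R.emb x \<in> L" if "x \<in> carrier R" for x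
    using gen that unfolding generating_def by (metis (no_types, lifting) CollectD CollectI subsetD)
  have DL: "d \<in> L" if dD: "d \<in> carrier D" for d
  proof -
    obtain a b where ab: "a \<in> carrier R" "b \<in> carrier R" "b \<noteq> \<zero>\<^bsub>R\<^esub>" "d = R.emb a \<otimes>\<^bsub>D\<^esub> inv\<^bsub>D\<^esub> (R.emb b)"
      using fr dD unfolding is_Fract_def by blast
    have "inj_on R.emb (carrier R)" using fr by (simp add: is_Fract_def)
    then have "R.emb b \<noteq> \<zero>\<^bsub>D\<^esub>" using ab(2,3) unfolding emb.inj_iff by blast
    then have "inv\<^bsub>D\<^esub> (R.emb b) \<in> L" using L(1) RL[OF ab(2)] by (simp add: div_subalg_def)
    then show ?thesis using LD(6) RL[OF ab(1)] ab(4) by simp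
  qed
  have "is_Fract D h T"
    unfolding is_Fract_def
  proof (intro conjI ballI)
    show "division_algebra D" by (rule D.div)
    show "h \<in> alg_hom T D" "inj_on h (carrier T)" using h by (simp_all add: T_def)
    fix d assume "d \<in> carrier D"
    then obtain x y where "d = x \<otimes>\<^bsub>D\<^esub> inv\<^bsub>D\<^esub> y" "x \<in> B" "y \<in> B" "y \<noteq> \<zero>\<^bsub>D\<^esub>" using DL unfolding L_def by blast
    moreover from this obtain a b where "x = h a" "y = h b" "a \<in> carrier T" "b \<in> carrier T" by (auto simp: B_def)
    ultimately show "\<exists>a\<in>carrier T. \<exists>b\<in>carrier T - {\<zero>\<^bsub>T\<^esub>}. d = h a \<otimes>\<^bsub>D\<^esub> inv\<^bsub>D\<^esub> h b" using hz by auto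
  qed
  then obtain E :: "('k, (('k, nat) free_poly set set \<times> ('k, nat) free_poly set set) set) module" and \<psi>
    where "is_Fract E \<psi> T" "alg_isomorphic D E"
    using is_Fract_transport[OF T(1)] by blast
  then have "isomorphic_Fract R T" unfolding isomorphic_Fract_def using fr by blast
  moreover have "N \<ge> 1" by (simp add: N_def ws_def)
  ultimately show ?thesis
    using lam(1) J unfolding Fract_of_quantum_affine_factor_def T_def A_def by blast
qed

section \<open>Algebras with a tower of normal elements\<close>

text \<open>Common form of three families: quantum Euclidean space with its own \<open>w\<close> and
  \<open>\<kappa> = s - s^3\<close>, the quantized Weyl algebra with \<open>w = 1\<close> and
  \<open>\<kappa> = 1\<close>, the algebra \<open>K\<close> with \<open>w = 1\<close> and
  \<open>\<kappa> = 0\<close>.\<close>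

definition tower_relations where
  "tower_relations A n w y x yy xx xy wy wx a c \<kappa> \<longleftrightarrow>
    w \<in> carrier A \<and> (\<forall>i\<in>{1..n::nat}. y i \<in> carrier A \<and> x i \<in> carrier A) \<and>
    (\<forall>i\<in>{1..n}. y i \<otimes>\<^bsub>A\<^esub> w = wy i \<odot>\<^bsub>A\<^esub> (w \<otimes>\<^bsub>A\<^esub> y i) \<and> x i \<otimes>\<^bsub>A\<^esub> w = wx i \<odot>\<^bsub>A\<^esub> (w \<otimes>\<^bsub>A\<^esub> x i) \<and>
      x i \<otimes>\<^bsub>A\<^esub> y i = a i \<odot>\<^bsub>A\<^esub> (y i \<otimes>\<^bsub>A\<^esub> x i) \<oplus>\<^bsub>A\<^esub>
        (\<kappa> \<odot>\<^bsub>A\<^esub> (w \<otimes>\<^bsub>A\<^esub> w) \<oplus>\<^bsub>A\<^esub> (\<Oplus>\<^bsub>A\<^esub>l\<in>{1..<i}. c l \<odot>\<^bsub>A\<^esub> (y l \<otimes>\<^bsub>A\<^esub> x l)))) \<and>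
    (\<forall>i\<in>{1..n}. \<forall>j\<in>{1..<i}. y i \<otimes>\<^bsub>A\<^esub> y j = yy i j \<odot>\<^bsub>A\<^esub> (y j \<otimes>\<^bsub>A\<^esub> y i) \<and>
      x i \<otimes>\<^bsub>A\<^esub> x j = xx i j \<odot>\<^bsub>A\<^esub> (x j \<otimes>\<^bsub>A\<^esub> x i)) \<and>
    (\<forall>i\<in>{1..n}. \<forall>j\<in>{1..n} - {i}. x i \<otimes>\<^bsub>A\<^esub> y j = xy i j \<odot>\<^bsub>A\<^esub> (y j \<otimes>\<^bsub>A\<^esub> x i))"

text \<open>The conditions on the scalars express that \<open>y\<^sub>l x\<^sub>l\<close> and \<open>w\<^sup>2\<close> q-commute with \<open>y\<^sub>i\<close> by a factor
  depending on \<open>l\<close> only through the order of \<open>l\<close> and \<open>i\<close>: \<open>a\<^sub>i - c\<^sub>i\<close> for \<open>l < i\<close> and \<open>w\<^sup>2\<close>, and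
  \<open>a\<^sub>i\<close> for \<open>i < l\<close>; with \<open>x\<^sub>i\<close> they q-commute by the inverse factor.\<close>

definition tower_scalars ::
  "nat \<Rightarrow> (nat \<Rightarrow> nat \<Rightarrow> 'k::field) \<Rightarrow> (nat \<Rightarrow> nat \<Rightarrow> 'k) \<Rightarrow> (nat \<Rightarrow> nat \<Rightarrow> 'k) \<Rightarrow> (nat \<Rightarrow> 'k) \<Rightarrow> (nat \<Rightarrow> 'k) \<Rightarrow>
    (nat \<Rightarrow> 'k) \<Rightarrow> (nat \<Rightarrow> 'k) \<Rightarrow> 'k \<Rightarrow> bool" where
  "tower_scalars n yy xx xy wy wx a c \<kappa> \<longleftrightarrow>
    (\<forall>i\<in>{1..n}. a i \<noteq> 0 \<and> c i \<noteq> 0 \<and> a i \<noteq> c i \<and> wx i * wy i = 1 \<and> (\<kappa> = 0 \<or> wy i * wy i * (a i - c i) = 1)) \<and>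
    (\<forall>i\<in>{1..n}. \<forall>l\<in>{1..<i}. yy i l \<noteq> 0 \<and> xx i l \<noteq> 0 \<and> xy l i \<noteq> 0 \<and> xy i l \<noteq> 0 \<and>
      xy l i = (a i - c i) * yy i l \<and> xy i l * yy i l = a l \<and>
      xy i l * xx i l = a i - c i \<and> a l * xx i l = xy l i)"

lemma tower_relations_image:
  assumes "k_algebra A" "k_algebra B" "f \<in> alg_hom A B"
    and t: "tower_relations A n w y x yy xx xy wy wx a c \<kappa>"
  shows "tower_relations B n (f w) (f \<circ> y) (f \<circ> x) yy xx xy wy wx a c \<kappa>"
proof -
  interpret alg_hom_loc A B f by (rule alg_hom_locI) fact+
  have car: "w \<in> carrier A" "\<And>i. i \<in> {1..n} \<Longrightarrow> y i \<in> carrier A" "\<And>i. i \<in> {1..n} \<Longrightarrow> x i \<in> carrier A"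
    using t by (auto simp: tower_relations_def)
  have sum: "f (\<Oplus>\<^bsub>A\<^esub>l\<in>{1..<i}. c l \<odot>\<^bsub>A\<^esub> (y l \<otimes>\<^bsub>A\<^esub> x l)) = (\<Oplus>\<^bsub>B\<^esub>l\<in>{1..<i}. c l \<odot>\<^bsub>B\<^esub> (f (y l) \<otimes>\<^bsub>B\<^esub> f (x l)))"
    and sumc: "(\<Oplus>\<^bsub>A\<^esub>l\<in>{1..<i}. c l \<odot>\<^bsub>A\<^esub> (y l \<otimes>\<^bsub>A\<^esub> x l)) \<in> carrier A"
    if "i \<in> {1..n}" for i
  proof -
    have cl: "y l \<in> carrier A" "x l \<in> carrier A" if "l \<in> {1..<i}" for l
    proof -
      have "l \<in> {1..n}" using that \<open>i \<in> {1..n}\<close> by auto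
      then show "y l \<in> carrier A" "x l \<in> carrier A" by (rule car)+
    qed
    then have *: "(\<lambda>l. c l \<odot>\<^bsub>A\<^esub> (y l \<otimes>\<^bsub>A\<^esub> x l)) \<in> {1..<i} \<rightarrow> carrier A" by simp
    then show "(\<Oplus>\<^bsub>A\<^esub>l\<in>{1..<i}. c l \<odot>\<^bsub>A\<^esub> (y l \<otimes>\<^bsub>A\<^esub> x l)) \<in> carrier A" by (rule A.finsum_closed)
    show "f (\<Oplus>\<^bsub>A\<^esub>l\<in>{1..<i}. c l \<odot>\<^bsub>A\<^esub> (y l \<otimes>\<^bsub>A\<^esub> x l)) = (\<Oplus>\<^bsub>B\<^esub>l\<in>{1..<i}. c l \<odot>\<^bsub>B\<^esub> (f (y l) \<otimes>\<^bsub>B\<^esub> f (x l)))"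
      unfolding hom_sum[OF *] using cl by (intro B.finsum_cong') (simp_all add: simps)
  qed
  have tr: "f u \<otimes>\<^bsub>B\<^esub> f v = d \<odot>\<^bsub>B\<^esub> (f v \<otimes>\<^bsub>B\<^esub> f u)"
    if "u \<otimes>\<^bsub>A\<^esub> v = d \<odot>\<^bsub>A\<^esub> (v \<otimes>\<^bsub>A\<^esub> u)" "u \<in> carrier A" "v \<in> carrier A" for u v d
    using that by (metis mult smult A.m_closed)
  have sp: "f (x i) \<otimes>\<^bsub>B\<^esub> f (y i) = a i \<odot>\<^bsub>B\<^esub> (f (y i) \<otimes>\<^bsub>B\<^esub> f (x i)) \<oplus>\<^bsub>B\<^esub>
        (\<kappa> \<odot>\<^bsub>B\<^esub> (f w \<otimes>\<^bsub>B\<^esub> f w) \<oplus>\<^bsub>B\<^esub> (\<Oplus>\<^bsub>B\<^esub>l\<in>{1..<i}. c l \<odot>\<^bsub>B\<^esub> (f (y l) \<otimes>\<^bsub>B\<^esub> f (x l))))"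
    if i: "i \<in> {1..n}" for i
  proof -
    have "f (x i \<otimes>\<^bsub>A\<^esub> y i) = f (a i \<odot>\<^bsub>A\<^esub> (y i \<otimes>\<^bsub>A\<^esub> x i) \<oplus>\<^bsub>A\<^esub>
        (\<kappa> \<odot>\<^bsub>A\<^esub> (w \<otimes>\<^bsub>A\<^esub> w) \<oplus>\<^bsub>A\<^esub> (\<Oplus>\<^bsub>A\<^esub>l\<in>{1..<i}. c l \<odot>\<^bsub>A\<^esub> (y l \<otimes>\<^bsub>A\<^esub> x l))))"
      using t i by (simp add: tower_relations_def)
    then show ?thesis using car(1) car(2)[OF i] car(3)[OF i] sumc[OF i] sum[OF i] by (simp add: simps)
  qed
  show ?thesis
    unfolding tower_relations_def comp_def
  proof (intro conjI ballI)
    fix i assume i: "i \<in> {1..n}"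
    have "y i \<otimes>\<^bsub>A\<^esub> w = wy i \<odot>\<^bsub>A\<^esub> (w \<otimes>\<^bsub>A\<^esub> y i)" "x i \<otimes>\<^bsub>A\<^esub> w = wx i \<odot>\<^bsub>A\<^esub> (w \<otimes>\<^bsub>A\<^esub> x i)"
      using t i by (simp_all add: tower_relations_def)
    then show "f (y i) \<otimes>\<^bsub>B\<^esub> f w = wy i \<odot>\<^bsub>B\<^esub> (f w \<otimes>\<^bsub>B\<^esub> f (y i))"
      "f (x i) \<otimes>\<^bsub>B\<^esub> f w = wx i \<odot>\<^bsub>B\<^esub> (f w \<otimes>\<^bsub>B\<^esub> f (x i))" using car i by (auto intro: tr)
    show "f (y i) \<in> carrier B" "f (x i) \<in> carrier B" using car i by auto
  next
    fix i j assume i: "i \<in> {1..n}" and j: "j \<in> {1..<i}"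
    then have j': "j \<in> {1..n}" by auto
    have "y i \<otimes>\<^bsub>A\<^esub> y j = yy i j \<odot>\<^bsub>A\<^esub> (y j \<otimes>\<^bsub>A\<^esub> y i)" "x i \<otimes>\<^bsub>A\<^esub> x j = xx i j \<odot>\<^bsub>A\<^esub> (x j \<otimes>\<^bsub>A\<^esub> x i)"
      using t i j by (simp_all add: tower_relations_def)
    then show "f (y i) \<otimes>\<^bsub>B\<^esub> f (y j) = yy i j \<odot>\<^bsub>B\<^esub> (f (y j) \<otimes>\<^bsub>B\<^esub> f (y i))"
      "f (x i) \<otimes>\<^bsub>B\<^esub> f (x j) = xx i j \<odot>\<^bsub>B\<^esub> (f (x j) \<otimes>\<^bsub>B\<^esub> f (x i))"
      using car i j' by (auto intro: tr)
  next
    fix i j assume i: "i \<in> {1..n}" and j: "j \<in> {1..n} - {i}"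
    then have "x i \<otimes>\<^bsub>A\<^esub> y j = xy i j \<odot>\<^bsub>A\<^esub> (y j \<otimes>\<^bsub>A\<^esub> x i)"
      using t by (simp add: tower_relations_def)
    then show "f (x i) \<otimes>\<^bsub>B\<^esub> f (y j) = xy i j \<odot>\<^bsub>B\<^esub> (f (y j) \<otimes>\<^bsub>B\<^esub> f (x i))"
      using car i j by (auto intro: tr)
  qed (use car sp in auto)
qed

text \<open>The order is \<open>w, y 1, x 1, y 2, x 2, ...\<close>. Every term in the relation for
  \<open>x i y i\<close> then starts with a generator that precedes \<open>x i\<close>, as
  \<open>straightening\<close> demands.\<close>

definition tower_gen :: "'a \<Rightarrow> (nat \<Rightarrow> 'a) \<Rightarrow> (nat \<Rightarrow> 'a) \<Rightarrow> nat \<Rightarrow> 'a"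
  where "tower_gen w y x k = (if k = 0 then w else if odd k then y (Suc k div 2) else x (k div 2))"

lemma tower_gen_simps [simp]:
  "tower_gen w y x 0 = w" "tower_gen w y x (2 * i + 1) = y (Suc i)" "tower_gen w y x (2 * i + 2) = x (Suc i)"
  by (simp_all add: tower_gen_def)

lemma tower_gen_image: "tower_gen w y x ` {..<2 * n + 1} = insert w (y ` {1..n} \<union> x ` {1..n})"
proof (intro equalityI subsetI)
  fix t assume "t \<in> tower_gen w y x ` {..<2 * n + 1}"
  then obtain k where k: "k < 2 * n + 1" "t = tower_gen w y x k" by auto
  then have "odd k \<Longrightarrow> Suc k div 2 \<in> {1..n}" "k \<noteq> 0 \<Longrightarrow> even k \<Longrightarrow> k div 2 \<in> {1..n}" by (auto elim!: oddE evenE)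
  with k show "t \<in> insert w (y ` {1..n} \<union> x ` {1..n})" by (auto simp: tower_gen_def)
next
  fix t assume "t \<in> insert w (y ` {1..n} \<union> x ` {1..n})"
  then consider "t = w" | i where "t = y (Suc i)" "i < n" | i where "t = x (Suc i)" "i < n"
    by (auto simp: image_iff Suc_le_eq) (metis Suc_le_lessD Suc_pred atLeastAtMost_iff)+
  then show "t \<in> tower_gen w y x ` {..<2 * n + 1}"
  proof cases
    case 1
    then show ?thesis by (intro image_eqI[of _ _ 0]) auto
  next
    case (2 i)
    then show ?thesis by (intro image_eqI[of _ _ "2 * i + 1"]) (simp_all only: tower_gen_simps, auto)
  next
    case (3 i)
    then show ?thesis by (intro image_eqI[of _ _ "2 * i + 2"]) (simp_all only: tower_gen_simps, auto)
  qed
qed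

lemma (in k_algebra) qc_swap:
  assumes "u \<otimes> v = c \<odot> (v \<otimes> u)" "c \<noteq> 0" "u \<in> carrier A" "v \<in> carrier A"
  shows "v \<otimes> u = inverse c \<odot> (u \<otimes> v)"
  using assms by simp

lemma (in k_algebra) qc_assoc:
  assumes "u \<otimes> v = c \<odot> (v \<otimes> u)" "u \<in> carrier A" "v \<in> carrier A" "t \<in> carrier A"
  shows "u \<otimes> (v \<otimes> t) = c \<odot> (v \<otimes> (u \<otimes> t))"
proof -
  have "u \<otimes> (v \<otimes> t) = (u \<otimes> v) \<otimes> t" using assms(2-4) by (simp add: m_assoc)
  also have "\<dots> = c \<odot> (v \<otimes> (u \<otimes> t))" using assms(2-4) unfolding assms(1) by (simp add: m_assoc sm_mult)
  finally show ?thesis .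
qed

lemma tower_straightening:
  assumes A: "k_algebra A" and t: "tower_relations A n w y x yy xx xy wy wx a c \<kappa>"
    and nz: "\<forall>i\<in>{1..n}. \<forall>l\<in>{1..<i}. xy l i \<noteq> 0"
  shows "straightening A (tower_gen w y x) (2 * n + 1)"
  unfolding straightening_def
proof (intro conjI allI impI)
  interpret k_algebra A by fact
  let ?g = "tower_gen w y x"
  have car: "w \<in> carrier A" "\<And>i. i \<in> {1..n} \<Longrightarrow> y i \<in> carrier A" "\<And>i. i \<in> {1..n} \<Longrightarrow> x i \<in> carrier A"
    using t by (auto simp: tower_relations_def)
  then show "?g ` {..<2 * n + 1} \<subseteq> carrier A" by (simp only: tower_gen_image) auto
  fix i j assume j: "j < 2 * n + 1" and i: "i < j"
  let ?S = "{?g a \<otimes>\<^bsub>A\<^esub> ?g b | a b. a < j \<and> b < 2 * n + 1}"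
  have S: "d \<odot>\<^bsub>A\<^esub> (?g a \<otimes>\<^bsub>A\<^esub> ?g b) \<in> lspan A ?S" if "a < j" "b < 2 * n + 1" for a b d
    using that by (intro lspan.smult lspan.base) blast
  have Sw: "?g j \<otimes>\<^bsub>A\<^esub> ?g i \<in> lspan A ?S" if "?g j \<otimes>\<^bsub>A\<^esub> ?g i = d \<odot>\<^bsub>A\<^esub> (?g i \<otimes>\<^bsub>A\<^esub> ?g j)" for d
    using S[of i j d] that i j by simp
  have "j = 0 \<or> (\<exists>p. j = 2 * p + 1 \<and> p < n) \<or> (\<exists>p. j = 2 * p + 2 \<and> p < n)" using j by presburger
  then consider "j = 0" | p where "j = 2 * p + 1" "p < n" | p where "j = 2 * p + 2" "p < n" by blast
  then show "?g j \<otimes>\<^bsub>A\<^esub> ?g i \<in> lspan A ?S"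
  proof cases
    case (2 p)
    have P: "Suc p \<in> {1..n}" using 2 by auto
    have "i = 0 \<or> (\<exists>q. i = 2 * q + 1 \<and> q < p) \<or> (\<exists>q. i = 2 * q + 2 \<and> q < p)"
      using i 2(1) by presburger
    then consider "i = 0" | q where "i = 2 * q + 1" "q < p" | q where "i = 2 * q + 2" "q < p" by blast
    then show ?thesis
    proof cases
      case 1
      have "y (Suc p) \<otimes>\<^bsub>A\<^esub> w = wy (Suc p) \<odot>\<^bsub>A\<^esub> (w \<otimes>\<^bsub>A\<^esub> y (Suc p))" using t P by (simp add: tower_relations_def)
      with Sw 1 2 show ?thesis by (simp only: tower_gen_simps)
    next
      case (2 q)
      have "y (Suc p) \<otimes>\<^bsub>A\<^esub> y (Suc q) = yy (Suc p) (Suc q) \<odot>\<^bsub>A\<^esub> (y (Suc q) \<otimes>\<^bsub>A\<^esub> y (Suc p))"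
        using t P 2 by (simp add: tower_relations_def)
      with Sw 2 \<open>j = 2 * p + 1\<close> show ?thesis by (simp only: tower_gen_simps)
    next
      case (3 q)
      \<comment> \<open>The relations express \<open>x q y p\<close> for \<open>q < p\<close>,
        whereas straightening needs the reversed product; this is the purpose of
        \<open>nz\<close>.\<close>
      have "x (Suc q) \<otimes>\<^bsub>A\<^esub> y (Suc p) = xy (Suc q) (Suc p) \<odot>\<^bsub>A\<^esub> (y (Suc p) \<otimes>\<^bsub>A\<^esub> x (Suc q))"
        using t P 3 by (simp add: tower_relations_def)
      from qc_swap[OF this] have "y (Suc p) \<otimes>\<^bsub>A\<^esub> x (Suc q) = inverse (xy (Suc q) (Suc p)) \<odot>\<^bsub>A\<^esub> (x (Suc q) \<otimes>\<^bsub>A\<^esub> y (Suc p))"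
        using nz P 3 car by simp
      with Sw 3 \<open>j = 2 * p + 1\<close> show ?thesis by (simp only: tower_gen_simps)
    qed
  next
    case (3 p)
    have P: "Suc p \<in> {1..n}" using 3 by auto
    have "i = 0 \<or> (\<exists>q. i = 2 * q + 1 \<and> q < p) \<or> i = 2 * p + 1 \<or> (\<exists>q. i = 2 * q + 2 \<and> q < p)"
      using i 3(1) by presburger
    then consider "i = 0" | q where "i = 2 * q + 1" "q < p" | "i = 2 * p + 1" | q where "i = 2 * q + 2" "q < p"
      by blast
    then show ?thesis
    proof cases
      case 1
      have "x (Suc p) \<otimes>\<^bsub>A\<^esub> w = wx (Suc p) \<odot>\<^bsub>A\<^esub> (w \<otimes>\<^bsub>A\<^esub> x (Suc p))" using t P by (simp add: tower_relations_def)
      with Sw 1 3 show ?thesis by (simp only: tower_gen_simps)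
    next
      case (2 q)
      have "x (Suc p) \<otimes>\<^bsub>A\<^esub> y (Suc q) = xy (Suc p) (Suc q) \<odot>\<^bsub>A\<^esub> (y (Suc q) \<otimes>\<^bsub>A\<^esub> x (Suc p))"
        using t P 2 by (simp add: tower_relations_def)
      with Sw 2 \<open>j = 2 * p + 2\<close> show ?thesis by (simp only: tower_gen_simps)
    next
      case (4 q)
      have "x (Suc p) \<otimes>\<^bsub>A\<^esub> x (Suc q) = xx (Suc p) (Suc q) \<odot>\<^bsub>A\<^esub> (x (Suc q) \<otimes>\<^bsub>A\<^esub> x (Suc p))"
        using t P 4 by (simp add: tower_relations_def)
      with Sw 4 \<open>j = 2 * p + 2\<close> show ?thesis by (simp only: tower_gen_simps)
    next
      case i: 3
      have yx: "d \<odot>\<^bsub>A\<^esub> (y l \<otimes>\<^bsub>A\<^esub> x l) \<in> lspan A ?S" if "l \<in> {1..Suc p}" for l d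
      proof -
        obtain q where q: "l = Suc q" "q \<le> p" using \<open>l \<in> _\<close> by (cases l) auto
        have "2 * q + 1 < j" "2 * q + 2 < 2 * n + 1" using q \<open>j = _\<close> \<open>p < n\<close> by auto
        from S[OF this, of d] show ?thesis unfolding tower_gen_simps q(1) .
      qed
      have ww: "d \<odot>\<^bsub>A\<^esub> (w \<otimes>\<^bsub>A\<^esub> w) \<in> lspan A ?S" for d using S[of 0 0 d] \<open>j = _\<close> by simp
      have Sc: "?S \<subseteq> carrier A"
        using \<open>?g ` {..<2 * n + 1} \<subseteq> carrier A\<close> j by (fastforce intro!: m_closed)
      have "x (Suc p) \<otimes>\<^bsub>A\<^esub> y (Suc p) = a (Suc p) \<odot>\<^bsub>A\<^esub> (y (Suc p) \<otimes>\<^bsub>A\<^esub> x (Suc p)) \<oplus>\<^bsub>A\<^esub>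
        (\<kappa> \<odot>\<^bsub>A\<^esub> (w \<otimes>\<^bsub>A\<^esub> w) \<oplus>\<^bsub>A\<^esub> (\<Oplus>\<^bsub>A\<^esub>l\<in>{1..<Suc p}. c l \<odot>\<^bsub>A\<^esub> (y l \<otimes>\<^bsub>A\<^esub> x l)))"
        using t P by (simp add: tower_relations_def)
      also have "\<dots> \<in> lspan A ?S"
        using Sc by (intro lspan.add ww lspan_finsum yx) auto
      finally show ?thesis using \<open>j = _\<close> i by (simp only: tower_gen_simps)
    qed
  qed (use i in auto)
qed

lemma (in k_algebra) qcommuteI: "u \<otimes> v = c \<odot> (v \<otimes> u) \<Longrightarrow> c \<noteq> 0 \<Longrightarrow> qcommute A u v"
  by (auto simp: qcommute_def)

lemma (in k_algebra) qcommute_sym: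
  "qcommute A u v \<Longrightarrow> u \<in> carrier A \<Longrightarrow> v \<in> carrier A \<Longrightarrow> qcommute A v u"
  unfolding qcommute_def by (metis qc_swap inverse_nonzero_iff_nonzero)

lemma (in k_algebra) qcommute_refl: "u \<in> carrier A \<Longrightarrow> qcommute A u u"
  by (rule qcommuteI[of _ _ 1]) auto

section \<open>The elements \<Omega> in a division algebra\<close>

locale tower = div_alg D for D :: "('k::field, 'd) module" (structure) +
  fixes n w y x yy xx xy wy wx a c \<kappa>
  assumes rels: "tower_relations D n w y x yy xx xy wy wx a c \<kappa>"
    and scal: "tower_scalars n yy xx xy wy wx a c \<kappa>"
begin

lemma car [simp]: "w \<in> carrier D" "i \<in> {1..n} \<Longrightarrow> y i \<in> carrier D" "i \<in> {1..n} \<Longrightarrow> x i \<in> carrier D"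
  using rels by (auto simp: tower_relations_def)

lemma rel:
  "i \<in> {1..n} \<Longrightarrow> y i \<otimes> w = wy i \<odot> (w \<otimes> y i)" "i \<in> {1..n} \<Longrightarrow> x i \<otimes> w = wx i \<odot> (w \<otimes> x i)"
  "i \<in> {1..n} \<Longrightarrow> j \<in> {1..<i} \<Longrightarrow> y i \<otimes> y j = yy i j \<odot> (y j \<otimes> y i)"
  "i \<in> {1..n} \<Longrightarrow> j \<in> {1..<i} \<Longrightarrow> x i \<otimes> x j = xx i j \<odot> (x j \<otimes> x i)"
  "i \<in> {1..n} \<Longrightarrow> j \<in> {1..n} \<Longrightarrow> i \<noteq> j \<Longrightarrow> x i \<otimes> y j = xy i j \<odot> (y j \<otimes> x i)"
  using rels by (auto simp: tower_relations_def)

lemma sc: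
  "i \<in> {1..n} \<Longrightarrow> a i \<noteq> 0" "i \<in> {1..n} \<Longrightarrow> c i \<noteq> 0" "i \<in> {1..n} \<Longrightarrow> a i - c i \<noteq> 0"
  "i \<in> {1..n} \<Longrightarrow> wx i * wy i = 1" "i \<in> {1..n} \<Longrightarrow> \<kappa> = 0 \<or> wy i * wy i * (a i - c i) = 1"
  using scal by (auto simp: tower_scalars_def)

lemma sc2:
  assumes "i \<in> {1..n}" "l \<in> {1..<i}"
  shows "yy i l \<noteq> 0" "xx i l \<noteq> 0" "xy l i \<noteq> 0" "xy i l \<noteq> 0"
    "xy l i = (a i - c i) * yy i l" "xy i l * yy i l = a l"
    "xy i l * xx i l = a i - c i" "a l * xx i l = xy l i"
  using scal assms unfolding tower_scalars_def by blast+

definition p where "p l = y l \<otimes> x l"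

definition \<Omega> where "\<Omega> m = \<kappa> \<odot> (w \<otimes> w) \<oplus> (\<Oplus>l\<in>{1..m}. c l \<odot> p l)"

lemma p_closed [simp]: "l \<in> {1..n} \<Longrightarrow> p l \<in> carrier D"
  unfolding p_def by (intro m_closed car)

lemma \<Omega>_closed [simp]: "m \<le> n \<Longrightarrow> \<Omega> m \<in> carrier D"
  unfolding \<Omega>_def by (intro a_closed sm_closed m_closed car finsum_closed) auto

lemma \<Omega>_0: "\<Omega> 0 = \<kappa> \<odot> (w \<otimes> w)"
  by (simp add: \<Omega>_def)

lemma \<Omega>_Suc:
  assumes "Suc m \<le> n" shows "\<Omega> (Suc m) = \<Omega> m \<oplus> c (Suc m) \<odot> p (Suc m)"
proof -
  have e: "{1..Suc m} = insert (Suc m) {1..m}" by auto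
  have "(\<lambda>l. c l \<odot> p l) \<in> {1..m} \<rightarrow> carrier D" using assms by auto
  moreover have "p (Suc m) \<in> carrier D" using assms by auto
  ultimately show ?thesis
    unfolding \<Omega>_def e by (subst finsum_insert) (auto simp: a_ac finsum_closed)
qed

lemma x_y: "i \<in> {1..n} \<Longrightarrow> x i \<otimes> y i = a i \<odot> p i \<oplus> \<Omega> (i - 1)"
proof -
  assume i: "i \<in> {1..n}"
  then have "{1..i - 1} = {1..<i}" by auto
  then show ?thesis using rels i unfolding \<Omega>_def p_def tower_relations_def by simp
qed

lemma p_y_low:
  assumes "i \<in> {1..n}" "l \<in> {1..<i}" shows "p l \<otimes> y i = (a i - c i) \<odot> (y i \<otimes> p l)"
proof -
  have l: "l \<in> {1..n}" "l \<noteq> i" using assms by auto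
  have "p l \<otimes> y i = xy l i \<odot> (y l \<otimes> (y i \<otimes> x l))"
    using assms l by (simp add: p_def m_assoc rel(5) sm_mult del: One_nat_def)
  moreover have "y i \<otimes> p l = yy i l \<odot> (y l \<otimes> (y i \<otimes> x l))"
    unfolding p_def using assms l by (intro qc_assoc rel car)
  ultimately show ?thesis using assms l by (simp add: sc2(5)[OF assms] del: One_nat_def)
qed

lemma p_y_high:
  assumes "l \<in> {1..n}" "i \<in> {1..<l}" shows "p l \<otimes> y i = a i \<odot> (y i \<otimes> p l)"
proof -
  have i: "i \<in> {1..n}" "l \<noteq> i" using assms by auto
  have "p l \<otimes> y i = xy l i \<odot> (y l \<otimes> (y i \<otimes> x l))"
    using assms i by (simp add: p_def m_assoc rel(5) sm_mult del: One_nat_def)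
  also have "y l \<otimes> (y i \<otimes> x l) = yy l i \<odot> (y i \<otimes> p l)"
    unfolding p_def using assms i by (intro qc_assoc rel car)
  finally show ?thesis using assms i sc2(6)[OF assms] by (simp del: One_nat_def)
qed

lemma p_x_low:
  assumes "i \<in> {1..n}" "l \<in> {1..<i}" shows "x i \<otimes> p l = (a i - c i) \<odot> (p l \<otimes> x i)"
proof -
  have l: "l \<in> {1..n}" "i \<noteq> l" using assms by auto
  have "x i \<otimes> p l = xy i l \<odot> (y l \<otimes> (x i \<otimes> x l))"
    unfolding p_def using assms l by (intro qc_assoc rel car)
  also have "\<dots> = (xy i l * xx i l) \<odot> (p l \<otimes> x i)"
    using assms l by (simp add: p_def m_assoc rel(4) sm_mult del: One_nat_def)
  finally show ?thesis by (simp only: sc2(7)[OF assms])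
qed

lemma p_x_high:
  assumes "l \<in> {1..n}" "i \<in> {1..<l}" shows "x i \<otimes> p l = a i \<odot> (p l \<otimes> x i)"
proof -
  have i: "i \<in> {1..n}" "i \<noteq> l" using assms by auto
  have "x i \<otimes> p l = xy i l \<odot> (y l \<otimes> (x i \<otimes> x l))"
    unfolding p_def using assms i by (intro qc_assoc rel car)
  moreover have "p l \<otimes> x i = xx l i \<odot> (y l \<otimes> (x i \<otimes> x l))"
    using assms i by (simp add: p_def m_assoc rel(4) sm_mult del: One_nat_def)
  ultimately show ?thesis using assms i sc2(8)[OF assms] by (simp del: One_nat_def)
qed

lemma p_w:
  assumes i: "i \<in> {1..n}" shows "p i \<otimes> w = w \<otimes> p i"
proof -
  have "p i \<otimes> w = (wx i * wy i) \<odot> (w \<otimes> p i)"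
    using i qc_assoc[OF rel(1)[OF i], of "x i"] by (simp add: p_def m_assoc rel sm_mult del: One_nat_def)
  then show ?thesis using i sc(4) by simp
qed

lemma ww_y:
  assumes i: "i \<in> {1..n}" shows "\<Omega> 0 \<otimes> y i = (a i - c i) \<odot> (y i \<otimes> \<Omega> 0)"
proof (cases "\<kappa> = 0")
  case False
  have "y i \<otimes> (w \<otimes> w) = (wy i * wy i) \<odot> (w \<otimes> (w \<otimes> y i))"
    using i qc_assoc[OF rel(1)[OF i], of w] by (simp add: rel sm_mult del: One_nat_def)
  then have "(a i - c i) \<odot> (y i \<otimes> \<Omega> 0) = (\<kappa> * (wy i * wy i * (a i - c i))) \<odot> (w \<otimes> (w \<otimes> y i))"
    using i by (simp add: \<Omega>_0 sm_mult mult_ac)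
  then show ?thesis using sc(5)[OF i] False i by (simp add: \<Omega>_0 sm_mult m_assoc)
next
  case True
  have "\<kappa> \<odot> (w \<otimes> w) = \<zero>" using True by simp
  with \<Omega>_0 have "\<Omega> 0 = \<zero>" by (rule trans)
  then show ?thesis using i by simp
qed

lemma ww_x:
  assumes i: "i \<in> {1..n}" shows "x i \<otimes> \<Omega> 0 = (a i - c i) \<odot> (\<Omega> 0 \<otimes> x i)"
proof (cases "\<kappa> = 0")
  case False
  have "wx i * wx i = wx i * wx i * (wy i * wy i * (a i - c i))" using sc(5)[OF i] False by simp
  also have "\<dots> = (wx i * wy i) * (wx i * wy i) * (a i - c i)" by (simp only: mult_ac)
  finally have e: "wx i * wx i = a i - c i" by (simp only: sc(4)[OF i] mult_1)
  have "x i \<otimes> (w \<otimes> w) = (wx i * wx i) \<odot> (w \<otimes> (w \<otimes> x i))"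
    using i qc_assoc[OF rel(2)[OF i], of w] by (simp add: rel sm_mult del: One_nat_def)
  then show ?thesis using i by (simp add: e \<Omega>_0 sm_mult m_assoc mult_ac)
next
  case True
  have "\<kappa> \<odot> (w \<otimes> w) = \<zero>" using True by simp
  with \<Omega>_0 have "\<Omega> 0 = \<zero>" by (rule trans)
  then show ?thesis using i by simp
qed

text \<open>As long as the indices stay below \<open>i\<close>, all summands of
  \<open>\<Omega> m\<close> pass \<open>y i\<close> with one and the same factor, and so does their
  sum.\<close>

lemma \<Omega>_y_low: "i \<in> {1..n} \<Longrightarrow> m < i \<Longrightarrow> \<Omega> m \<otimes> y i = (a i - c i) \<odot> (y i \<otimes> \<Omega> m)"
proof (induction m)
  case (Suc m)
  then have "p (Suc m) \<otimes> y i = (a i - c i) \<odot> (y i \<otimes> p (Suc m))" by (intro p_y_low) auto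
  moreover have "Suc m \<le> n" "m \<le> n" "Suc m \<in> {1..n}" using Suc by auto
  ultimately show ?case using Suc
    by (simp add: \<Omega>_Suc l_distr r_distr sm_mult sm_add_right mult_ac del: One_nat_def)
qed (simp add: ww_y)

lemma \<Omega>_x_low: "i \<in> {1..n} \<Longrightarrow> m < i \<Longrightarrow> x i \<otimes> \<Omega> m = (a i - c i) \<odot> (\<Omega> m \<otimes> x i)"
proof (induction m)
  case (Suc m)
  then have "x i \<otimes> p (Suc m) = (a i - c i) \<odot> (p (Suc m) \<otimes> x i)" by (intro p_x_low) auto
  moreover have "Suc m \<le> n" "m \<le> n" "Suc m \<in> {1..n}" using Suc by auto
  ultimately show ?case using Suc
    by (simp add: \<Omega>_Suc l_distr r_distr sm_mult sm_add_right mult_ac del: One_nat_def)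
qed (simp add: ww_x)

lemma \<Omega>_pred: "i \<in> {1..n} \<Longrightarrow> \<Omega> i = \<Omega> (i - 1) \<oplus> c i \<odot> p i"
  using \<Omega>_Suc[of "i - 1"] by auto

text \<open>By the relation for \<open>x i y i\<close>, moving the last summand
  \<open>c i y i x i\<close> past \<open>y i\<close> leaves the extra term
  \<open>c i y i \<Omega> (i - 1)\<close>. Together with
  \<open>(a i - c i) y i \<Omega> (i - 1)\<close>, which comes from the lower summands, it makes
  \<open>a i\<close> the factor of both parts.\<close>

lemma \<Omega>_y_eq:
  assumes i: "i \<in> {1..n}" shows "\<Omega> i \<otimes> y i = a i \<odot> (y i \<otimes> \<Omega> i)"
proof -
  have O: "\<Omega> (i - 1) \<in> carrier D" using i by auto
  have "p i \<otimes> y i = y i \<otimes> (a i \<odot> p i \<oplus> \<Omega> (i - 1))"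
    using i by (simp add: p_def m_assoc x_y[unfolded p_def] del: One_nat_def)
  also have "\<dots> = a i \<odot> (y i \<otimes> p i) \<oplus> y i \<otimes> \<Omega> (i - 1)" using i O by (simp add: r_distr sm_mult)
  finally have "\<Omega> i \<otimes> y i = (a i - c i) \<odot> (y i \<otimes> \<Omega> (i - 1)) \<oplus>
      c i \<odot> (a i \<odot> (y i \<otimes> p i) \<oplus> y i \<otimes> \<Omega> (i - 1))"
    using i O \<Omega>_y_low[OF i, of "i - 1"] by (simp add: \<Omega>_pred l_distr sm_mult)
  also have "\<dots> = ((a i - c i) \<odot> (y i \<otimes> \<Omega> (i - 1)) \<oplus> c i \<odot> (y i \<otimes> \<Omega> (i - 1))) \<oplus> (c i * a i) \<odot> (y i \<otimes> p i)"
    using i O by (simp add: sm_add_right a_ac)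
  also have "\<dots> = a i \<odot> (y i \<otimes> \<Omega> (i - 1)) \<oplus> (a i * c i) \<odot> (y i \<otimes> p i)"
    using i O by (simp add: sm_add_left[symmetric] mult.commute)
  also have "\<dots> = a i \<odot> (y i \<otimes> \<Omega> i)"
    using i O by (simp add: \<Omega>_pred r_distr sm_add_right sm_mult)
  finally show ?thesis .
qed

lemma \<Omega>_y_high:
  assumes i: "i \<in> {1..n}"
  shows "i \<le> m \<Longrightarrow> m \<le> n \<Longrightarrow> \<Omega> m \<otimes> y i = a i \<odot> (y i \<otimes> \<Omega> m)"
proof (induction m rule: dec_induct)
  case (step m)
  then have "p (Suc m) \<otimes> y i = a i \<odot> (y i \<otimes> p (Suc m))" using i by (intro p_y_high) auto
  moreover have "Suc m \<in> {1..n}" using step by auto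
  ultimately show ?case using step i
    by (simp add: \<Omega>_Suc l_distr r_distr sm_mult sm_add_right mult_ac del: One_nat_def)
qed (rule \<Omega>_y_eq[OF i])

lemma \<Omega>_x_high:
  assumes i: "i \<in> {1..n}" and y: "y i = \<zero>"
  shows "i \<le> m \<Longrightarrow> m \<le> n \<Longrightarrow> x i \<otimes> \<Omega> m = a i \<odot> (\<Omega> m \<otimes> x i)"
proof (induction m rule: dec_induct)
  case base
  \<comment> \<open>With \<open>y i = 0\<close> the relation for \<open>x i y i\<close> says that
    \<open>\<Omega> (i - 1)\<close> is zero, so that the base case \<open>m = i\<close> is
    trivial.\<close>
  have "p i = \<zero>" using i y by (simp add: p_def)
  moreover from this have "\<Omega> (i - 1) = \<zero>" using x_y[OF i] i y by auto
  ultimately have "\<Omega> i = \<zero>" using \<Omega>_pred[OF i] by simp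
  then show ?case using i by simp
next
  case (step m)
  then have "x i \<otimes> p (Suc m) = a i \<odot> (p (Suc m) \<otimes> x i)" using i by (intro p_x_high) auto
  moreover have "Suc m \<in> {1..n}" using step by auto
  ultimately show ?case using step i
    by (simp add: \<Omega>_Suc l_distr r_distr sm_mult sm_add_right mult_ac del: One_nat_def)
qed

text \<open>The factor \<open>a l - c l\<close> gained at \<open>y l\<close> is lost again at
  \<open>x l\<close>. Since \<open>\<Omega> m'\<close> differs from \<open>\<Omega> m\<close> by
  such products with \<open>l > m\<close>, the elements \<open>\<Omega> m\<close> commute with each
  other.\<close>

lemma \<Omega>_p:
  assumes l: "l \<in> {1..n}" and m: "m < l" shows "\<Omega> m \<otimes> p l = p l \<otimes> \<Omega> m"
proof -
  have O: "\<Omega> m \<in> carrier D" using l m by auto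
  have "\<Omega> m \<otimes> p l = (a l - c l) \<odot> (y l \<otimes> (\<Omega> m \<otimes> x l))"
    unfolding p_def using l m O by (intro qc_assoc \<Omega>_y_low car)
  also have "\<dots> = p l \<otimes> \<Omega> m"
    using l m O \<Omega>_x_low[OF l m] by (simp add: p_def m_assoc sm_mult)
  finally show ?thesis .
qed

lemma \<Omega>_\<Omega>: "m \<le> m' \<Longrightarrow> m' \<le> n \<Longrightarrow> \<Omega> m \<otimes> \<Omega> m' = \<Omega> m' \<otimes> \<Omega> m"
proof (induction m' rule: dec_induct)
  case (step m')
  then have "Suc m' \<in> {1..n}" by auto
  moreover from this have "\<Omega> m \<otimes> p (Suc m') = p (Suc m') \<otimes> \<Omega> m" using step by (intro \<Omega>_p) auto
  ultimately show ?case using step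
    by (simp add: \<Omega>_Suc l_distr r_distr sm_mult del: One_nat_def)
qed simp

lemma \<Omega>_w: "m \<le> n \<Longrightarrow> \<Omega> m \<otimes> w = w \<otimes> \<Omega> m"
proof (induction m)
  case (Suc m)
  then have "Suc m \<in> {1..n}" by auto
  with Suc show ?case
    by (simp add: \<Omega>_Suc l_distr r_distr sm_mult p_w del: One_nat_def)
qed (simp add: \<Omega>_0 sm_mult m_assoc)

definition Z where "Z = insert w (y ` {1..n} \<union> \<Omega> ` {1..n} \<union> x ` {i \<in> {1..n}. y i = \<zero>})"

lemma Z_qcommute:
  assumes "u \<in> Z" "v \<in> Z" shows "qcommute D u v"
proof -
  have w0: "wx i \<noteq> 0" "wy i \<noteq> 0" if "i \<in> {1..n}" for i using sc(4)[OF that] by auto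
  have y_w: "qcommute D (y i) w" "qcommute D (x i) w" if "i \<in> {1..n}" for i
    using that w0 rel qcommuteI by blast+
  have O_w: "qcommute D (\<Omega> m) w" if "m \<in> {1..n}" for m
    using that by (intro qcommuteI[of _ _ 1]) (auto simp: \<Omega>_w)
  \<comment> \<open>The relations are given for \<open>j < i\<close>; symmetry of q-commutation
    supplies the other order.\<close>
  have ord: "P i j" if "\<And>i j. i \<in> {1..n} \<Longrightarrow> j \<in> {1..<i} \<Longrightarrow> P i j \<and> P j i" "\<And>i. i \<in> {1..n} \<Longrightarrow> P i i"
    "i \<in> {1..n}" "j \<in> {1..n}" for P i j
    using that by (cases i j rule: linorder_cases) auto
  have yy: "qcommute D (y i) (y j)" if "i \<in> {1..n}" "j \<in> {1..n}" for i j
    using that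
  proof (rule ord[rotated 2])
    fix i j assume ij: "i \<in> {1..n}" "j \<in> {1..<i}"
    then have "qcommute D (y i) (y j)" "j \<in> {1..n}"
      using qcommuteI[OF rel(3)[OF ij] sc2(1)[OF ij]] by auto
    then show "qcommute D (y i) (y j) \<and> qcommute D (y j) (y i)" using ij by (auto intro!: qcommute_sym)
  qed (intro qcommute_refl car)
  have xx: "qcommute D (x i) (x j)" if "i \<in> {1..n}" "j \<in> {1..n}" for i j
    using that
  proof (rule ord[rotated 2])
    fix i j assume ij: "i \<in> {1..n}" "j \<in> {1..<i}"
    then have "qcommute D (x i) (x j)" "j \<in> {1..n}"
      using qcommuteI[OF rel(4)[OF ij] sc2(2)[OF ij]] by auto
    then show "qcommute D (x i) (x j) \<and> qcommute D (x j) (x i)" using ij by (auto intro!: qcommute_sym)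
  qed (intro qcommute_refl car)
  have xy: "qcommute D (x i) (y j)" if "i \<in> {1..n}" "j \<in> {1..n}" "y i = \<zero>" for i j
  proof (cases "i = j")
    case True
    then show ?thesis using that by (intro qcommuteI[of _ _ 1]) auto
  next
    case False
    then have "xy i j \<noteq> 0" using sc2(3)[of j i] sc2(4)[of i j] that by (cases "i < j") auto
    then show ?thesis using rel(5)[of i j] False that by (intro qcommuteI) auto
  qed
  have Oy: "qcommute D (\<Omega> m) (y i)" if "m \<in> {1..n}" "i \<in> {1..n}" for m i
  proof (cases "m < i")
    case True
    then show ?thesis using that by (intro qcommuteI[OF \<Omega>_y_low] sc) auto
  next
    case False
    then show ?thesis using that by (intro qcommuteI[OF \<Omega>_y_high] sc) auto
  qed
  have xO: "qcommute D (x i) (\<Omega> m)" if "m \<in> {1..n}" "i \<in> {1..n}" "y i = \<zero>" for m i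
  proof (cases "m < i")
    case True
    then show ?thesis using that by (intro qcommuteI[OF \<Omega>_x_low] sc) auto
  next
    case False
    then show ?thesis using that by (intro qcommuteI[OF \<Omega>_x_high] sc) auto
  qed
  have OO: "qcommute D (\<Omega> m) (\<Omega> m')" if "m \<in> {1..n}" "m' \<in> {1..n}" for m m'
    using that \<Omega>_\<Omega>[of m m'] \<Omega>_\<Omega>[of m' m] by (intro qcommuteI[of _ _ 1]) (cases "m \<le> m'"; auto)+
  have O [simp]: "\<Omega> m \<in> carrier D" if "m \<in> {1..n}" for m using that by simp
  note s = qcommute_sym[OF y_w(1)] qcommute_sym[OF y_w(2)] qcommute_sym[OF O_w] qcommute_sym[OF xy]
    qcommute_sym[OF Oy] qcommute_sym[OF xO]
  note all = y_w O_w yy xx xy Oy xO OO s qcommute_refl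
  show ?thesis
    using assms unfolding Z_def
    by (elim insertE UnE imageE CollectE conjE; simp del: One_nat_def atLeastAtMost_iff add: all)
qed

lemma Z_generates:
  assumes H: "div_subalg H D" and Z: "Z \<subseteq> H" and i: "i \<in> {1..n}"
  shows "w \<in> H" "y i \<in> H" "x i \<in> H"
proof -
  have s: "subalg H D" using H by (simp add: div_subalg_def)
  note S = subalgD[OF k_algebra_axioms s]
  show w: "w \<in> H" and y: "y i \<in> H" using Z i by (auto simp: Z_def)
  show "x i \<in> H"
  proof (cases "y i = \<zero>")
    case True
    then show ?thesis using Z i by (auto simp: Z_def)
  next
    case False
    \<comment> \<open>\<open>\<Omega> 0\<close> is not listed in \<open>Z\<close>, but it is a
      multiple of \<open>w w\<close> and so belongs to \<open>H\<close>.\<close>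
    have O: "\<Omega> m \<in> H" if "m \<le> n" for m
      using that Z w by (cases "m = 0") (auto simp: Z_def \<Omega>_0 S)
    have "c i \<odot> p i = \<Omega> i \<ominus> \<Omega> (i - 1)"
    proof -
      have "\<Omega> (i - 1) \<in> carrier D" "c i \<odot> p i \<in> carrier D" using i by auto
      then show ?thesis unfolding \<Omega>_pred[OF i] by (simp add: a_minus_def a_ac r_neg r_neg1 r_neg2)
    qed
    moreover have "\<Omega> i \<ominus> \<Omega> (i - 1) \<in> H" using i by (intro S(5) O) auto
    ultimately have "inverse (c i) \<odot> (c i \<odot> p i) \<in> H" by (auto intro: S(7))
    then have "p i \<in> H" using i sc(2)[OF i] by simp
    moreover have "inv (y i) \<in> H" using y False H by (simp add: div_subalg_def)
    ultimately have "inv (y i) \<otimes> p i \<in> H" by (auto intro: S(6))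
    then show ?thesis using i False by (simp add: p_def)
  qed
qed

end

text \<open>The second alternative in \<open>scal\<close> serves quantum Euclidean space at
  \<open>q = 1\<close>, where all \<open>c i\<close> vanish and the generators commute; their images
  are then taken as the q-commuting elements.\<close>

theorem tower_Gelfand_Kirillov:
  fixes R :: "('k::field, 'a) module"
  assumes R: "k_algebra R" and dom: "nc_domain R"
    and t: "tower_relations R n w y x yy xx xy wy wx a c \<kappa>"
    and nz: "\<forall>i\<in>{1..n}. \<forall>l\<in>{1..<i}. xy l i \<noteq> 0"
    and scal: "tower_scalars n yy xx xy wy wx a c \<kappa> \<or>
      (\<forall>u\<in>insert w (y ` {1..n} \<union> x ` {1..n}). \<forall>v\<in>insert w (y ` {1..n} \<union> x ` {1..n}). u \<otimes>\<^bsub>R\<^esub> v = v \<otimes>\<^bsub>R\<^esub> u)"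
    and gen: "generating R (insert w (y ` {1..n} \<union> x ` {1..n}))"
  shows "Fract_of_quantum_affine_factor R"
proof (rule quantum_Gelfand_Kirillov[OF R dom _ tower_straightening[OF R t nz]])
  show "generating R (tower_gen w y x ` {..<2 * n + 1})" using gen by (simp only: tower_gen_image)
  fix D :: "('k, ('a \<times> 'a) set) module" and \<phi>
  assume D: "div_alg D" and \<phi>: "\<phi> \<in> alg_hom R D"
  interpret D: div_alg D by fact
  interpret \<phi>: alg_hom_loc R D \<phi> by (intro alg_hom_locI R D.k_algebra_axioms \<phi>)
  let ?G = "insert w (y ` {1..n} \<union> x ` {1..n})"
  have im: "(\<phi> \<circ> tower_gen w y x) ` {..<2 * n + 1} = \<phi> ` ?G"
    by (simp only: image_comp[symmetric] tower_gen_image)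
  have "\<exists>Z. finite Z \<and> Z \<subseteq> carrier D \<and> (\<forall>u\<in>Z. \<forall>v\<in>Z. qcommute D u v) \<and>
      (\<forall>H\<in>{H. div_subalg H D \<and> Z \<subseteq> H}. \<phi> ` ?G \<subseteq> H)"
    using scal
  proof
    assume comm: "\<forall>u\<in>?G. \<forall>v\<in>?G. u \<otimes>\<^bsub>R\<^esub> v = v \<otimes>\<^bsub>R\<^esub> u"
    have G: "?G \<subseteq> carrier R" using gen by (simp add: generating_def)
    have q: "qcommute D (\<phi> u) (\<phi> v)" if "u \<in> ?G" "v \<in> ?G" for u v
    proof -
      have "u \<in> carrier R" "v \<in> carrier R" using G that by blast+
      moreover have "u \<otimes>\<^bsub>R\<^esub> v = v \<otimes>\<^bsub>R\<^esub> u" using comm that by blast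
      ultimately show ?thesis by (intro D.qcommuteI[of _ _ 1]) (simp_all flip: \<phi>.mult)
    qed
    moreover have "\<phi> ` ?G \<subseteq> carrier D"
    proof (rule image_subsetI)
      fix u assume "u \<in> ?G"
      with G show "\<phi> u \<in> carrier D" by (intro \<phi>.closed) (rule subsetD)
    qed
    ultimately show ?thesis by (intro exI[of _ "\<phi> ` ?G"]) simp
  next
    assume "tower_scalars n yy xx xy wy wx a c \<kappa>"
    then interpret T: tower D n "\<phi> w" "\<phi> \<circ> y" "\<phi> \<circ> x" yy xx xy wy wx a c \<kappa>
      using tower_relations_image[OF R D.k_algebra_axioms \<phi> t] by unfold_locales
    have "T.Z \<subseteq> carrier D" using T.car T.\<Omega>_closed unfolding T.Z_def by auto
    moreover have "\<phi> ` ?G \<subseteq> H" if "div_subalg H D" "T.Z \<subseteq> H" for H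
    proof -
      have "\<phi> w \<in> H" using that(2) by (auto simp: T.Z_def)
      then show ?thesis using T.Z_generates(2,3)[OF that] by auto
    qed
    moreover have "finite T.Z" by (simp add: T.Z_def)
    ultimately show ?thesis using T.Z_qcommute by (intro exI[of _ T.Z]) simp
  qed
  then obtain Z where Z: "finite Z" "Z \<subseteq> carrier D" "\<forall>u\<in>Z. \<forall>v\<in>Z. qcommute D u v"
    "\<forall>H\<in>{H. div_subalg H D \<and> Z \<subseteq> H}. \<phi> ` ?G \<subseteq> H" by (elim exE conjE)
  obtain zs where "set zs = Z" using finite_list[OF Z(1)] by blast
  with Z show "\<exists>zs. set zs \<subseteq> carrier D \<and> (\<forall>x\<in>set zs. \<forall>y\<in>set zs. qcommute D x y) \<and>
      (\<forall>H\<in>{H. div_subalg H D \<and> set zs \<subseteq> H}. (\<phi> \<circ> tower_gen w y x) ` {..<2 * n + 1} \<subseteq> H)"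
    unfolding im by (intro exI[of _ zs]) simp
qed

section \<open>Quantum matrices\<close>

text \<open>Lexicographic numbering of the positions. Rows have length \<open>n + 1\<close> because
  columns start at 1; a number that belongs to no position is passed over by the deletion.\<close>

definition pos :: "nat \<Rightarrow> nat \<Rightarrow> nat \<Rightarrow> nat"
  where "pos n l m = l * (n + 1) + m"

lemma pos_less:
  "m \<in> {1..n} \<Longrightarrow> j \<in> {1..n} \<Longrightarrow> pos n l m < pos n i j \<longleftrightarrow> l < i \<or> (l = i \<and> m < j)"
proof -
  assume mj: "m \<in> {1..n}" "j \<in> {1..n}"
  have lt: "pos n l m < pos n i j" if "l < i" "m \<in> {1..n}" for l m i j
  proof -
    have "pos n l m < Suc l * (n + 1)" using that by (simp add: pos_def)
    also have "\<dots> \<le> i * (n + 1)" using that by (intro mult_le_mono1) simp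
    finally show ?thesis by (simp add: pos_def)
  qed
  show ?thesis
    using lt[of l i m j] lt[of i l j m] mj by (cases l i rule: linorder_cases) (auto simp: pos_def)
qed

lemma pos_eq: "m \<in> {1..n} \<Longrightarrow> j \<in> {1..n} \<Longrightarrow> pos n l m = pos n i j \<longleftrightarrow> l = i \<and> m = j"
  using pos_less[of m n j l i] pos_less[of j n m i l] by auto

text \<open>For \<open>r\<close> beyond all positions these are the relations of quantum matrices, for \<open>r = 0\<close> those
  of a quantum affine space. Decreasing \<open>r\<close> by one is a step of Cauchon's deleting derivations
  algorithm.\<close>

definition matrix_relations where
  "matrix_relations A n lam p r x \<longleftrightarrow>
    (\<forall>i\<in>{1..n}. \<forall>j\<in>{1..n}. x i j \<in> carrier A) \<and>
    (\<forall>l\<in>{1..n}. \<forall>m\<in>{1..n}. \<forall>i\<in>{1..n}. \<forall>j\<in>{1..n}.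
      (i < l \<and> j < m \<longrightarrow> x l m \<otimes>\<^bsub>A\<^esub> x i j = (p l i * p j m) \<odot>\<^bsub>A\<^esub> (x i j \<otimes>\<^bsub>A\<^esub> x l m) \<oplus>\<^bsub>A\<^esub>
        ((if pos n l m < r then lam - 1 else 0) * p l i) \<odot>\<^bsub>A\<^esub> (x i m \<otimes>\<^bsub>A\<^esub> x l j)) \<and>
      (i < l \<and> m \<le> j \<longrightarrow> x l m \<otimes>\<^bsub>A\<^esub> x i j = (lam * p l i * p j m) \<odot>\<^bsub>A\<^esub> (x i j \<otimes>\<^bsub>A\<^esub> x l m)) \<and>
      (i = l \<and> j < m \<longrightarrow> x l m \<otimes>\<^bsub>A\<^esub> x i j = p j m \<odot>\<^bsub>A\<^esub> (x i j \<otimes>\<^bsub>A\<^esub> x l m)))"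

lemma matrix_relationsD:
  assumes "matrix_relations A n lam p r x" "l \<in> {1..n}" "m \<in> {1..n}" "i \<in> {1..n}" "j \<in> {1..n}"
  shows "x i j \<in> carrier A"
    "i < l \<Longrightarrow> j < m \<Longrightarrow> x l m \<otimes>\<^bsub>A\<^esub> x i j = (p l i * p j m) \<odot>\<^bsub>A\<^esub> (x i j \<otimes>\<^bsub>A\<^esub> x l m) \<oplus>\<^bsub>A\<^esub>
        ((if pos n l m < r then lam - 1 else 0) * p l i) \<odot>\<^bsub>A\<^esub> (x i m \<otimes>\<^bsub>A\<^esub> x l j)"
    "i < l \<Longrightarrow> m \<le> j \<Longrightarrow> x l m \<otimes>\<^bsub>A\<^esub> x i j = (lam * p l i * p j m) \<odot>\<^bsub>A\<^esub> (x i j \<otimes>\<^bsub>A\<^esub> x l m)"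
    "i = l \<Longrightarrow> j < m \<Longrightarrow> x l m \<otimes>\<^bsub>A\<^esub> x i j = p j m \<odot>\<^bsub>A\<^esub> (x i j \<otimes>\<^bsub>A\<^esub> x l m)"
  using assms unfolding matrix_relations_def by blast+

lemma matrix_relations_image:
  assumes "k_algebra A" "k_algebra B" "f \<in> alg_hom A B"
    and t: "matrix_relations A n lam p r x"
  shows "matrix_relations B n lam p r (\<lambda>i j. f (x i j))"
proof -
  interpret alg_hom_loc A B f by (rule alg_hom_locI) fact+
  show ?thesis
    unfolding matrix_relations_def
  proof (intro conjI ballI impI)
    fix i j assume "i \<in> {1..n}" "j \<in> {1..n}"
    then show "f (x i j) \<in> carrier B" using matrix_relationsD(1)[OF t] by blast
  next
    fix l m i j assume r: "l \<in> {1..n}" "m \<in> {1..n}" "i \<in> {1..n}" "j \<in> {1..n}"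
    note D = matrix_relationsD[OF t r]
    have c: "x i j \<in> carrier A" "x l m \<in> carrier A" "x i m \<in> carrier A" "x l j \<in> carrier A"
      using matrix_relationsD(1)[OF t] r by blast+
    { assume "i < l \<and> j < m"
      then have "f (x l m \<otimes>\<^bsub>A\<^esub> x i j) = f ((p l i * p j m) \<odot>\<^bsub>A\<^esub> (x i j \<otimes>\<^bsub>A\<^esub> x l m) \<oplus>\<^bsub>A\<^esub>
        ((if pos n l m < r then lam - 1 else 0) * p l i) \<odot>\<^bsub>A\<^esub> (x i m \<otimes>\<^bsub>A\<^esub> x l j))" using D(2) by simp
      then show "f (x l m) \<otimes>\<^bsub>B\<^esub> f (x i j) = (p l i * p j m) \<odot>\<^bsub>B\<^esub> (f (x i j) \<otimes>\<^bsub>B\<^esub> f (x l m)) \<oplus>\<^bsub>B\<^esub>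
        ((if pos n l m < r then lam - 1 else 0) * p l i) \<odot>\<^bsub>B\<^esub> (f (x i m) \<otimes>\<^bsub>B\<^esub> f (x l j))"
        using c by (simp add: simps del: A.sm_sm B.sm_sm) }
    { assume "i < l \<and> m \<le> j"
      then have "f (x l m \<otimes>\<^bsub>A\<^esub> x i j) = f ((lam * p l i * p j m) \<odot>\<^bsub>A\<^esub> (x i j \<otimes>\<^bsub>A\<^esub> x l m))" using D(3) by simp
      then show "f (x l m) \<otimes>\<^bsub>B\<^esub> f (x i j) = (lam * p l i * p j m) \<odot>\<^bsub>B\<^esub> (f (x i j) \<otimes>\<^bsub>B\<^esub> f (x l m))"
        using c by (simp add: simps) }
    { assume "i = l \<and> j < m"
      then have "f (x l m \<otimes>\<^bsub>A\<^esub> x i j) = f (p j m \<odot>\<^bsub>A\<^esub> (x i j \<otimes>\<^bsub>A\<^esub> x l m))" using D(4) by simp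
      then show "f (x l m) \<otimes>\<^bsub>B\<^esub> f (x i j) = p j m \<odot>\<^bsub>B\<^esub> (f (x i j) \<otimes>\<^bsub>B\<^esub> f (x l m))"
        using c by (simp add: simps) }
  qed
qed

section \<open>One step of the deletion, at a nonzero pivot\<close>

locale matrix_step = div_alg D for D :: "('k::field, 'd) module" (structure) +
  fixes n and lam :: 'k and p :: "nat \<Rightarrow> nat \<Rightarrow> 'k" and r u v x
  assumes rels: "matrix_relations D n lam p (Suc r) x"
    and p: "mult_antisym n p" and lam: "lam \<noteq> 0" "lam \<noteq> 1"
    and r: "r = pos n u v" and uv: "u \<in> {1..n}" "v \<in> {1..n}" and pivot: "x u v \<noteq> \<zero>"
begin

abbreviation "piv \<equiv> x u v"

lemma car [simp]: "i \<in> {1..n} \<Longrightarrow> j \<in> {1..n} \<Longrightarrow> x i j \<in> carrier D"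
  using matrix_relationsD(1)[OF rels] by blast

lemma p_nz: "i \<in> {1..n} \<Longrightarrow> j \<in> {1..n} \<Longrightarrow> p i j \<noteq> 0"
  using p unfolding mult_antisym_def by blast

lemma p_inv: "i \<in> {1..n} \<Longrightarrow> j \<in> {1..n} \<Longrightarrow> inverse (p i j) = p j i"
  using p unfolding mult_antisym_def by metis

lemma p_p: "i \<in> {1..n} \<Longrightarrow> j \<in> {1..n} \<Longrightarrow> p i j * p j i = 1" "i \<in> {1..n} \<Longrightarrow> p i i = 1"
  subgoal using p_nz[of i j] p_inv[of i j] right_inverse[of "p i j"] by metis
  subgoal using p unfolding mult_antisym_def by blast
  done

lemmas piv_closed = car[OF uv]

definition wt :: "'k \<Rightarrow> 'd \<Rightarrow> bool"
  where "wt c z \<longleftrightarrow> z \<in> carrier D \<and> piv \<otimes> z = c \<odot> (z \<otimes> piv)"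

lemma wt_mult: assumes "wt c z" "wt d y" shows "wt (c * d) (z \<otimes> y)"
proof -
  have z: "z \<in> carrier D" "y \<in> carrier D" using assms by (auto simp: wt_def)
  have "piv \<otimes> (z \<otimes> y) = c \<odot> (z \<otimes> (piv \<otimes> y))"
    using assms(1) z piv_closed by (intro qc_assoc) (auto simp: wt_def)
  then show ?thesis using assms(2) z piv_closed by (simp add: wt_def sm_mult m_assoc)
qed

lemma wt_smult: "wt c z \<Longrightarrow> wt c (d \<odot> z)"
  using piv_closed by (auto simp: wt_def sm_mult mult.commute)

lemma wt_add: "wt c z \<Longrightarrow> wt c y \<Longrightarrow> wt c (z \<oplus> y)"
  using piv_closed by (auto simp: wt_def r_distr l_distr sm_add_right)

lemma wt_diff: "wt c z \<Longrightarrow> wt c y \<Longrightarrow> wt c (z \<ominus> y)"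
  using wt_add[of c z "(-1) \<odot> y"] wt_smult[of c y "-1"]
  by (auto simp: wt_def sm_minus_left a_minus_def)

lemma wt_zero: "wt c \<zero>"
  using piv_closed by (simp add: wt_def)

text \<open>Eigenvectors for the eigenvalues \<open>c\<close> and \<open>lam * c\<close> are
  independent, since \<open>c \<noteq> 0\<close> and \<open>lam \<noteq> 1\<close> make these
  eigenvalues different.\<close>

lemma wt_independent:
  assumes "wt c z" "wt (lam * c) y" "c \<noteq> 0" "z \<oplus> y = \<zero>"
  shows "z = \<zero>"
proof -
  have zc: "z \<in> carrier D" "y \<in> carrier D" using assms by (auto simp: wt_def)
  have "y = \<ominus> z" using assms(4) zc by (metis a_comm minus_equality minus_minus)
  then have "piv \<otimes> (\<ominus> z) = (lam * c) \<odot> ((\<ominus> z) \<otimes> piv)" using assms(2) by (simp add: wt_def)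
  then have "\<ominus> (piv \<otimes> z) = \<ominus> ((lam * c) \<odot> (z \<otimes> piv))"
    using zc piv_closed by (simp add: r_minus l_minus sm_minus_right)
  then have "piv \<otimes> z = (lam * c) \<odot> (z \<otimes> piv)"
    using zc piv_closed by (metis m_closed minus_minus sm_closed)
  then have "(lam * c - c) \<odot> (z \<otimes> piv) = \<zero>"
    using assms(1) zc piv_closed by (simp add: wt_def sm_diff_left)
  moreover have "lam * c - c \<noteq> 0" using assms(3) lam by (simp add: algebra_simps)
  ultimately have "z \<otimes> piv = \<zero>" using zc piv_closed by (subst (asm) sm_eq_zero) auto
  then show ?thesis using zc piv_closed pivot by simp
qed

lemma add_eq_diff:
  assumes "z1 \<in> carrier D" "z2 \<in> carrier D" "z3 \<in> carrier D" "z4 \<in> carrier D" "z1 \<oplus> z2 = z3 \<oplus> z4"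
  shows "(z1 \<ominus> z3) \<oplus> (z2 \<ominus> z4) = \<zero>"
proof -
  have "(z1 \<ominus> z3) \<oplus> (z2 \<ominus> z4) = (z1 \<oplus> z2) \<ominus> (z3 \<oplus> z4)"
    using assms(1-4) by (simp add: a_minus_def minus_add a_ac)
  then show ?thesis using assms by simp
qed

text \<open>Both sides split into components of three weights, of which the last cancels by \<open>top\<close>; this
  also covers \<open>lam\<^sup>2 = 1\<close>, where the first and the last weight agree.\<close>

lemma low_component:
  assumes wa: "wt wa z1" "wt (lam * wa) t1" and wb: "wt wb z2" "wt (lam * wb) t2"
    and wd: "wt wd z3" "wt (lam * wd) t3" and we: "wt we z4" "wt (lam * we) t4"
    and nz: "wa \<noteq> 0" "wb \<noteq> 0" and W: "\<beta> = 0 \<or> wd * we = wa * wb"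
    and full: "(z1 \<oplus> t1) \<otimes> (z2 \<oplus> t2) = \<alpha> \<odot> ((z2 \<oplus> t2) \<otimes> (z1 \<oplus> t1)) \<oplus> \<beta> \<odot> ((z3 \<oplus> t3) \<otimes> (z4 \<oplus> t4))"
    and top: "t1 \<otimes> t2 = \<alpha> \<odot> (t2 \<otimes> t1) \<oplus> \<beta> \<odot> (t3 \<otimes> t4)"
  shows "z1 \<otimes> z2 = \<alpha> \<odot> (z2 \<otimes> z1) \<oplus> \<beta> \<odot> (z3 \<otimes> z4)"
proof -
  have c [simp]: "z1 \<in> carrier D" "z2 \<in> carrier D" "z3 \<in> carrier D" "z4 \<in> carrier D"
    "t1 \<in> carrier D" "t2 \<in> carrier D" "t3 \<in> carrier D" "t4 \<in> carrier D"
    using wa wb wd we by (auto simp: wt_def)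
  \<comment> \<open>Index 1 marks the product of two factors \<open>z\<close>, index 2 the mixed
    products, whose weight is \<open>lam\<close> times as large; the products of two factors
    \<open>t\<close> drop out by \<open>top\<close>.\<close>
  define P1 P2 where "P1 = z1 \<otimes> z2" and "P2 = z1 \<otimes> t2 \<oplus> t1 \<otimes> z2"
  define Q1 Q2 where "Q1 = z2 \<otimes> z1" and "Q2 = z2 \<otimes> t1 \<oplus> t2 \<otimes> z1"
  define R1 R2 where "R1 = z3 \<otimes> z4" and "R2 = z3 \<otimes> t4 \<oplus> t3 \<otimes> z4"
  have PQR [simp]: "P1 \<in> carrier D" "P2 \<in> carrier D" "Q1 \<in> carrier D" "Q2 \<in> carrier D" "R1 \<in> carrier D" "R2 \<in> carrier D"
    by (simp_all add: P1_def P2_def Q1_def Q2_def R1_def R2_def)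
  have "(P1 \<oplus> P2) \<oplus> t1 \<otimes> t2 = \<alpha> \<odot> ((Q1 \<oplus> Q2) \<oplus> t2 \<otimes> t1) \<oplus> \<beta> \<odot> ((R1 \<oplus> R2) \<oplus> t3 \<otimes> t4)"
    using full by (simp add: P1_def P2_def Q1_def Q2_def R1_def R2_def l_distr r_distr a_ac)
  then have "(P1 \<oplus> P2) \<oplus> t1 \<otimes> t2 = ((\<alpha> \<odot> Q1 \<oplus> \<beta> \<odot> R1) \<oplus> (\<alpha> \<odot> Q2 \<oplus> \<beta> \<odot> R2)) \<oplus> (\<alpha> \<odot> (t2 \<otimes> t1) \<oplus> \<beta> \<odot> (t3 \<otimes> t4))"
    by (simp add: sm_add_right a_ac)
  then have "(P1 \<oplus> P2) \<oplus> t1 \<otimes> t2 = ((\<alpha> \<odot> Q1 \<oplus> \<beta> \<odot> R1) \<oplus> (\<alpha> \<odot> Q2 \<oplus> \<beta> \<odot> R2)) \<oplus> t1 \<otimes> t2"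
    by (simp only: top[symmetric])
  then have "P1 \<oplus> P2 = (\<alpha> \<odot> Q1 \<oplus> \<beta> \<odot> R1) \<oplus> (\<alpha> \<odot> Q2 \<oplus> \<beta> \<odot> R2)"
    by (subst (asm) add.right_cancel) auto
  then have sum: "(P1 \<ominus> (\<alpha> \<odot> Q1 \<oplus> \<beta> \<odot> R1)) \<oplus> (P2 \<ominus> (\<alpha> \<odot> Q2 \<oplus> \<beta> \<odot> R2)) = \<zero>"
    by (intro add_eq_diff) auto
  have Q: "wt (wa * wb) Q1" "wt (lam * (wa * wb)) Q2"
    using wt_mult[OF wb(1) wa(1)] wt_add[OF wt_mult[OF wb(1) wa(2)]] wt_mult[OF wb(2) wa(1)]
    by (simp_all add: Q1_def Q2_def mult_ac)
  have P: "wt (wa * wb) P1" "wt (lam * (wa * wb)) P2"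
    using wt_mult[OF wa(1) wb(1)] wt_add[OF wt_mult[OF wa(1) wb(2)]] wt_mult[OF wa(2) wb(1)]
    by (simp_all add: P1_def P2_def mult_ac)
  have R: "wt (wa * wb) (\<beta> \<odot> R1)" "wt (lam * (wa * wb)) (\<beta> \<odot> R2)"
  proof -
    have *: "wt (wd * we) R1" "wt (lam * (wd * we)) R2"
      using wt_mult[OF wd(1) we(1)] wt_add[OF wt_mult[OF wd(1) we(2)]] wt_mult[OF wd(2) we(1)]
      by (simp_all add: R1_def R2_def mult_ac)
    show "wt (wa * wb) (\<beta> \<odot> R1)" "wt (lam * (wa * wb)) (\<beta> \<odot> R2)"
      using W *[THEN wt_smult, of \<beta>] wt_zero by (cases "\<beta> = 0"; simp)+
  qed
  have "P1 \<ominus> (\<alpha> \<odot> Q1 \<oplus> \<beta> \<odot> R1) = \<zero>"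
    by (rule wt_independent[OF wt_diff[OF P(1) wt_add[OF wt_smult[OF Q(1)] R(1)]]
        wt_diff[OF P(2) wt_add[OF wt_smult[OF Q(2)] R(2)]] _ sum]) (use nz in simp)
  then show ?thesis by (simp add: P1_def Q1_def R1_def)
qed

definition t where "t i j = (if i < u \<and> j < v then x i v \<otimes> (inv piv \<otimes> x u j) else \<zero>)"

definition x' where "x' i j = x i j \<ominus> t i j"

lemma t_closed [simp]: "i \<in> {1..n} \<Longrightarrow> j \<in> {1..n} \<Longrightarrow> t i j \<in> carrier D"
  using uv pivot piv_closed by (simp add: t_def)

lemma x'_closed [simp]: "i \<in> {1..n} \<Longrightarrow> j \<in> {1..n} \<Longrightarrow> x' i j \<in> carrier D"
  by (simp add: x'_def)

lemma x_decomp: "i \<in> {1..n} \<Longrightarrow> j \<in> {1..n} \<Longrightarrow> x i j = x' i j \<oplus> t i j"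
  by (simp add: x'_def a_minus_def a_assoc l_neg del: atLeastAtMost_iff)

lemma x'_eq: "i \<in> {1..n} \<Longrightarrow> j \<in> {1..n} \<Longrightarrow> \<not> (i < u \<and> j < v) \<Longrightarrow> x' i j = x i j"
  by (auto simp: x'_def t_def a_minus_def simp del: atLeastAtMost_iff)

text \<open>Read off from the relation between the pivot and \<open>x i j\<close>. The factor
  \<open>lam\<close> occurs to the upper right of the pivot and \<open>inverse lam\<close> to the
  lower left, in both cases including the column of the pivot.\<close>

definition weight where "weight i j = p u i * p j v *
  (if i < u \<and> v \<le> j then lam else if u < i \<and> j \<le> v then inverse lam else 1)"

lemma weight_nz: "i \<in> {1..n} \<Longrightarrow> j \<in> {1..n} \<Longrightarrow> weight i j \<noteq> 0"
  using p_nz uv lam by (simp add: weight_def)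

lemma col: "i \<in> {1..n} \<Longrightarrow> i < u \<Longrightarrow> piv \<otimes> x i v = (lam * p u i) \<odot> (x i v \<otimes> piv)"
  using matrix_relationsD(3)[OF rels uv(1) uv(2) _ uv(2), of i] by (simp add: p_p(2)[OF uv(2)])

lemma row: "j \<in> {1..n} \<Longrightarrow> j < v \<Longrightarrow> piv \<otimes> x u j = p j v \<odot> (x u j \<otimes> piv)"
  using matrix_relationsD(4)[OF rels uv(1) uv(2) uv(1), of j] by simp

lemma row': "j \<in> {1..n} \<Longrightarrow> j < v \<Longrightarrow> x u j \<otimes> piv = p v j \<odot> (piv \<otimes> x u j)"
  using qc_swap[OF row, of j] p_nz[of j v] p_inv[of j v] uv by simp

lemma t_piv:
  assumes ij: "i \<in> {1..n}" "j \<in> {1..n}" "i < u" "j < v"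
  shows "piv \<otimes> t i j = (lam * p u i) \<odot> (x i v \<otimes> x u j)" "t i j \<otimes> piv = p v j \<odot> (x i v \<otimes> x u j)"
proof -
  have c: "x i v \<in> carrier D" "x u j \<in> carrier D" "piv \<in> carrier D" "inv piv \<in> carrier D"
    using ij uv pivot by auto
  have "piv \<otimes> t i j = (lam * p u i) \<odot> (x i v \<otimes> (piv \<otimes> (inv piv \<otimes> x u j)))"
    using ij c unfolding t_def by (simp del: inv_r') (intro qc_assoc col c m_closed ij)
  then show "piv \<otimes> t i j = (lam * p u i) \<odot> (x i v \<otimes> x u j)" using c pivot by simp
  have "t i j \<otimes> piv = x i v \<otimes> (inv piv \<otimes> (x u j \<otimes> piv))" using ij c by (simp add: t_def m_assoc)
  also have "\<dots> = p v j \<odot> (x i v \<otimes> x u j)" using row'[OF ij(2,4)] c pivot by (simp add: sm_mult)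
  finally show "t i j \<otimes> piv = p v j \<odot> (x i v \<otimes> x u j)" .
qed

text \<open>In the nontrivial case \<open>x i v\<close> has weight \<open>lam * p u i\<close>,
  \<open>x u j\<close> has weight \<open>p j v\<close> and the inverse of the pivot has weight 1.
  The extra factor \<open>lam\<close> is what separates the correction \<open>t i j\<close> from
  \<open>x' i j\<close>.\<close>

lemma wt_t:
  assumes ij: "i \<in> {1..n}" "j \<in> {1..n}" shows "wt (lam * weight i j) (t i j)"
proof (cases "i < u \<and> j < v")
  case True
  have c: "x i v \<in> carrier D" "x u j \<in> carrier D" using ij uv by auto
  have "p j v * p v j = 1" using p_p(1) ij uv by blast
  then have e: "lam * weight i j * p v j = lam * p u i" using True by (simp add: weight_def mult.assoc)
  have "(lam * weight i j) \<odot> (t i j \<otimes> piv) = (lam * weight i j * p v j) \<odot> (x i v \<otimes> x u j)"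
    using True t_piv(2)[OF ij] c by simp
  then show ?thesis unfolding e wt_def using True t_piv(1)[OF ij] ij by simp
next
  case False
  then have "t i j = \<zero>" unfolding t_def by (rule if_not_P)
  then show ?thesis using wt_zero by simp
qed

lemma wt_x':
  assumes ij: "i \<in> {1..n}" "j \<in> {1..n}" shows "wt (weight i j) (x' i j)"
proof -
  have c: "x i j \<in> carrier D" "x i v \<in> carrier D" "x u j \<in> carrier D" "piv \<in> carrier D" using ij uv by auto
  have i': "inverse (p i u) = p u i" "inverse (p v j) = p j v" using p_inv ij uv by auto
  have nz: "p i u \<noteq> 0" "p v j \<noteq> 0" using p_nz ij uv by auto
  consider "i < u" "j < v" | "i < u" "v \<le> j" | "i = u" "j < v" | "i = u" "j = v" | "i = u" "v < j"
    | "u < i" "j \<le> v" | "u < i" "v < j" by linarith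
  then show ?thesis
  proof cases
    case 1
    \<comment> \<open>To the upper left of the pivot the relation has the extra term
      \<open>(lam - 1) p u i ?Y\<close>. Subtracting \<open>t i j\<close> turns its coefficient
      \<open>lam - 1\<close> into \<open>-1\<close>, and \<open>- p u i ?Y\<close> is exactly the
      contribution of \<open>- t i j\<close> on the right-hand side.\<close>
    let ?Y = "x i v \<otimes> x u j"
    have Y: "?Y \<in> carrier D" using c by simp
    have "pos n u v < Suc r" by (simp add: r)
    then have "piv \<otimes> x i j = (p u i * p j v) \<odot> (x i j \<otimes> piv) \<oplus> ((lam - 1) * p u i) \<odot> ?Y"
      using matrix_relationsD(2)[OF rels uv ij 1] by simp
    then have "piv \<otimes> x' i j = (p u i * p j v) \<odot> (x i j \<otimes> piv) \<oplus> (((lam - 1) * p u i) \<odot> ?Y \<ominus> (lam * p u i) \<odot> ?Y)"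
      using t_piv(1)[OF ij 1] c ij Y by (simp add: x'_def a_minus_def r_distr r_minus a_ac)
    also have "((lam - 1) * p u i) \<odot> ?Y \<ominus> (lam * p u i) \<odot> ?Y = \<ominus> (p u i \<odot> ?Y)"
      using Y by (simp flip: sm_diff_left sm_minus_left add: algebra_simps)
    also have "p u i \<odot> ?Y = (p u i * p j v) \<odot> (t i j \<otimes> piv)"
    proof -
      have "p j v * p v j = 1" using p_p(1) ij uv by blast
      then have e: "p u i * p j v * p v j = p u i" by (simp add: mult.assoc)
      have "(p u i * p j v) \<odot> (t i j \<otimes> piv) = (p u i * p j v * p v j) \<odot> ?Y"
        using t_piv(2)[OF ij 1] Y by simp
      then show ?thesis by (simp only: e)
    qed
    finally have "piv \<otimes> x' i j = (p u i * p j v) \<odot> (x' i j \<otimes> piv)"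
      using c ij by (simp add: x'_def a_minus_def l_distr l_minus sm_add_right sm_minus_right)
    then show ?thesis using 1 ij by (simp add: wt_def weight_def)
  next
    case 2
    then show ?thesis using matrix_relationsD(3)[OF rels uv ij] c ij
      by (simp add: wt_def weight_def x'_eq mult_ac)
  next
    case 3
    then show ?thesis using row[OF ij(2)] c ij p_p(2)[OF uv(1)] by (simp add: wt_def weight_def x'_eq)
  next
    case 4
    then show ?thesis using c ij p_p(2)[OF uv(1)] p_p(2)[OF uv(2)] by (simp add: wt_def weight_def x'_eq)
  next
    case 5
    have "x i j \<otimes> piv = p v j \<odot> (piv \<otimes> x i j)" using matrix_relationsD(4)[OF rels ij uv] 5 by simp
    from qc_swap[OF this nz(2)] show ?thesis using 5 c ij p_p(2)[OF uv(1)]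
      by (simp add: wt_def weight_def x'_eq i')
  next
    case 6
    have "x i j \<otimes> piv = (lam * p i u * p v j) \<odot> (piv \<otimes> x i j)" using matrix_relationsD(3)[OF rels ij uv] 6 by simp
    from qc_swap[OF this] show ?thesis using 6 c ij nz lam
      by (simp add: wt_def weight_def x'_eq i' mult_ac)
  next
    case 7
    \<comment> \<open>Positions below the row of the pivot come after the pivot, so their relations
      have already lost the extra term.\<close>
    then have "\<not> pos n i j < Suc r" using pos_less[OF uv(2) ij(2), of u i] by (auto simp: r)
    then have "x i j \<otimes> piv = (p i u * p v j) \<odot> (piv \<otimes> x i j)"
      using matrix_relationsD(2)[OF rels ij uv] 7 c by simp
    from qc_swap[OF this] show ?thesis using 7 c ij nz
      by (simp add: wt_def weight_def x'_eq i' mult_ac)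
  qed
qed

text \<open>Normal form: entries of column \<open>v\<close>, two inverse pivots, entries of row
  \<open>u\<close>. The scalars from moving \<open>x c v\<close> to the left and
  \<open>inv piv\<close> past \<open>x u b\<close> cancel. Relations among the \<open>t i j\<close>
  thus reduce to relations within one column and within one row.\<close>

lemma t_mult_t:
  assumes ij: "a \<in> {1..n}" "b \<in> {1..n}" "c \<in> {1..n}" "d \<in> {1..n}" "a < u" "c < u" "b < v" "d < v"
  shows "t a b \<otimes> t c d = (x a v \<otimes> x c v) \<otimes> ((inv piv \<otimes> inv piv) \<otimes> (x u b \<otimes> x u d))"
proof -
  let ?I = "inv piv"
  have cc: "x a v \<in> carrier D" "x c v \<in> carrier D" "x u b \<in> carrier D" "x u d \<in> carrier D"
    "piv \<in> carrier D" "?I \<in> carrier D" using ij uv pivot by auto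
  have nz: "lam * p u c \<noteq> 0" using lam p_nz ij uv by simp
  have RC: "x u b \<otimes> x c v = (lam * p u c * p v b) \<odot> (x c v \<otimes> x u b)"
    using matrix_relationsD(3)[OF rels uv(1) ij(2) ij(3) uv(2)] ij by simp
  have "?I \<otimes> (piv \<otimes> x c v) \<otimes> ?I = (lam * p u c) \<odot> (?I \<otimes> x c v)"
    using col[OF ij(3,6)] cc pivot by (simp add: sm_mult m_assoc)
  then have IC: "x c v \<otimes> ?I = (lam * p u c) \<odot> (?I \<otimes> x c v)" using cc pivot by simp
  have "?I \<otimes> (piv \<otimes> x u b) \<otimes> ?I = p b v \<odot> (?I \<otimes> x u b)"
    using row[OF ij(2,7)] cc pivot by (simp add: sm_mult m_assoc)
  then have IR: "x u b \<otimes> ?I = p b v \<odot> (?I \<otimes> x u b)" using cc pivot by simp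
  have e: "p v b * p b v = 1" using p_p(1) ij uv by blast
  have "t a b \<otimes> t c d = x a v \<otimes> (?I \<otimes> (x u b \<otimes> (x c v \<otimes> (?I \<otimes> x u d))))"
    using ij cc by (simp add: t_def m_assoc)
  also have "x u b \<otimes> (x c v \<otimes> (?I \<otimes> x u d)) = (lam * p u c * p v b) \<odot> (x c v \<otimes> (x u b \<otimes> (?I \<otimes> x u d)))"
    using cc by (intro qc_assoc RC) auto
  also have "x u b \<otimes> (?I \<otimes> x u d) = p b v \<odot> (?I \<otimes> (x u b \<otimes> x u d))"
    using cc by (intro qc_assoc IR) auto
  also have "(lam * p u c * p v b) \<odot> (x c v \<otimes> (p b v \<odot> (?I \<otimes> (x u b \<otimes> x u d)))) = (lam * p u c) \<odot> (x c v \<otimes> (?I \<otimes> (x u b \<otimes> x u d)))"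
    using cc e by (simp add: sm_mult mult.assoc)
  also have "?I \<otimes> ((lam * p u c) \<odot> (x c v \<otimes> (?I \<otimes> (x u b \<otimes> x u d)))) = (lam * p u c) \<odot> (?I \<otimes> (x c v \<otimes> (?I \<otimes> (x u b \<otimes> x u d))))"
    using cc by (simp add: sm_mult)
  also have "\<dots> = x c v \<otimes> (?I \<otimes> (?I \<otimes> (x u b \<otimes> x u d)))"
  proof -
    have "(x c v \<otimes> ?I) \<otimes> (?I \<otimes> (x u b \<otimes> x u d)) = ((lam * p u c) \<odot> (?I \<otimes> x c v)) \<otimes> (?I \<otimes> (x u b \<otimes> x u d))"
      by (simp only: IC)
    then show ?thesis using cc by (simp add: m_assoc sm_mult)
  qed
  finally show ?thesis using cc by (simp add: m_assoc)
qed

text \<open>By \<open>t_mult_t\<close> the products in each relation are multiples of a single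
  element. In the first relation the coefficients match because \<open>1 + (lam - 1) = lam\<close>,
  the factor contributed by column \<open>v\<close>.\<close>

lemma tt_relations:
  assumes r: "l \<in> {1..n}" "m \<in> {1..n}" "i \<in> {1..n}" "j \<in> {1..n}"
  shows "i < l \<Longrightarrow> j < m \<Longrightarrow> l < u \<Longrightarrow> m < v \<Longrightarrow>
      t l m \<otimes> t i j = (p l i * p j m) \<odot> (t i j \<otimes> t l m) \<oplus> ((lam - 1) * p l i) \<odot> (t i m \<otimes> t l j)"
    and "i < l \<Longrightarrow> m \<le> j \<Longrightarrow> l < u \<Longrightarrow> j < v \<Longrightarrow>
      t l m \<otimes> t i j = (lam * p l i * p j m) \<odot> (t i j \<otimes> t l m)"
    and "i = l \<Longrightarrow> j < m \<Longrightarrow> l < u \<Longrightarrow> m < v \<Longrightarrow> t l m \<otimes> t i j = p j m \<odot> (t i j \<otimes> t l m)"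
proof -
  let ?C = "\<lambda>i. x i v" and ?R = "\<lambda>j. x u j" and ?I = "inv piv \<otimes> inv piv"
  have c [simp]: "?C l \<in> carrier D" "?C i \<in> carrier D" "?R m \<in> carrier D" "?R j \<in> carrier D" "?I \<in> carrier D"
    using r uv pivot by auto
  have CC: "?C l \<otimes> ?C i = (lam * p l i) \<odot> (?C i \<otimes> ?C l)" if "i < l"
    using matrix_relationsD(3)[OF rels r(1) uv(2) r(3) uv(2) that] by (simp add: p_p(2)[OF uv(2)])
  have RR: "?R m \<otimes> ?R j = p j m \<odot> (?R j \<otimes> ?R m)"
  proof (cases m j rule: linorder_cases)
    case less
    have "?R j \<otimes> ?R m = p m j \<odot> (?R m \<otimes> ?R j)"
      using matrix_relationsD(4)[OF rels uv(1) r(4) uv(1) r(2)] less by simp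
    from qc_swap[OF this p_nz[OF r(2,4)]] show ?thesis by (simp add: p_inv[OF r(2,4)])
  next
    case equal
    then show ?thesis using p_p(2)[OF r(4)] by simp
  next
    case greater
    then show ?thesis using matrix_relationsD(4)[OF rels uv(1) r(2) uv(1) r(4)] by simp
  qed
  { assume a: "i < l" "j < m" "l < u" "m < v"
    then have b: "i < u" "j < v" by auto
    show "t l m \<otimes> t i j = (p l i * p j m) \<odot> (t i j \<otimes> t l m) \<oplus> ((lam - 1) * p l i) \<odot> (t i m \<otimes> t l j)"
      unfolding t_mult_t[OF r(1,2,3,4) a(3) b(1) a(4) b(2)] t_mult_t[OF r(3,4,1,2) b(1) a(3) b(2) a(4)]
        t_mult_t[OF r(3,2,1,4) b(1) a(3) a(4) b(2)] CC[OF a(1)] RR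
      by (simp add: sm_mult sm_add_left[symmetric] algebra_simps) }
  { assume a: "i < l" "m \<le> j" "l < u" "j < v"
    then have b: "i < u" "m < v" by auto
    show "t l m \<otimes> t i j = (lam * p l i * p j m) \<odot> (t i j \<otimes> t l m)"
      unfolding t_mult_t[OF r(1,2,3,4) a(3) b(1) b(2) a(4)] t_mult_t[OF r(3,4,1,2) b(1) a(3) a(4) b(2)] CC[OF a(1)] RR
      by (simp add: sm_mult mult_ac) }
  { assume a: "i = l" "j < m" "l < u" "m < v"
    then have b: "i < u" "j < v" by auto
    show "t l m \<otimes> t i j = p j m \<odot> (t i j \<otimes> t l m)"
      unfolding t_mult_t[OF r(1,2,3,4) a(3) b(1) a(4) b(2)] t_mult_t[OF r(3,4,1,2) b(1) a(3) b(2) a(4)] RR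
      using a by (simp add: sm_mult) }
qed

text \<open>The instance of \<open>low_component\<close> for matrix entries. \<open>W\<close> says
  that the extra term has the weight of the other terms; relations without extra term are the
  instances with \<open>\<beta> = 0\<close>.\<close>

lemma x'_relation:
  assumes q: "l \<in> {1..n}" "m \<in> {1..n}" "i \<in> {1..n}" "j \<in> {1..n}"
    and W: "\<beta> = 0 \<or> weight i m * weight l j = weight l m * weight i j"
    and full: "x l m \<otimes> x i j = \<alpha> \<odot> (x i j \<otimes> x l m) \<oplus> \<beta> \<odot> (x i m \<otimes> x l j)"
    and top: "t l m \<otimes> t i j = \<alpha> \<odot> (t i j \<otimes> t l m) \<oplus> \<beta> \<odot> (t i m \<otimes> t l j)"
  shows "x' l m \<otimes> x' i j = \<alpha> \<odot> (x' i j \<otimes> x' l m) \<oplus> \<beta> \<odot> (x' i m \<otimes> x' l j)"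
  by (rule low_component[OF wt_x'[OF q(1,2)] wt_t[OF q(1,2)] wt_x'[OF q(3,4)] wt_t[OF q(3,4)]
        wt_x'[OF q(3,2)] wt_t[OF q(3,2)] wt_x'[OF q(1,4)] wt_t[OF q(1,4)]
        weight_nz[OF q(1,2)] weight_nz[OF q(3,4)] W _ top])
    (use full x_decomp[OF q(1,2)] x_decomp[OF q(3,4)] x_decomp[OF q(3,2)] x_decomp[OF q(1,4)] in simp)

lemma matrix_relations_x': "matrix_relations D n lam p r x'"
  unfolding matrix_relations_def
proof (intro conjI ballI impI)
  fix l m i j assume q: "l \<in> {1..n}" "m \<in> {1..n}" "i \<in> {1..n}" "j \<in> {1..n}"
  note M = matrix_relationsD[OF rels q]
  have c: "x i j \<in> carrier D" "x l m \<in> carrier D" "x i m \<in> carrier D" "x l j \<in> carrier D"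
    "t i j \<in> carrier D" "t l m \<in> carrier D" "t i m \<in> carrier D" "t l j \<in> carrier D"
    "x' i j \<in> carrier D" "x' l m \<in> carrier D" "x' i m \<in> carrier D" "x' l j \<in> carrier D" using q by auto
  have z: "t l m = \<zero>" if "u \<le> l \<or> v \<le> m" for l m using that by (auto simp: t_def)
  { assume o: "i < l \<and> j < m"
    show "x' l m \<otimes> x' i j = (p l i * p j m) \<odot> (x' i j \<otimes> x' l m) \<oplus>
        ((if pos n l m < r then lam - 1 else 0) * p l i) \<odot> (x' i m \<otimes> x' l j)"
    proof (cases "pos n l m = r")
      \<comment> \<open>At the pivot itself the extra term has to disappear; the new relation says
        that \<open>x' i j\<close> is an eigenvector.\<close>
      case True
      then have lm: "l = u" "m = v" using pos_eq[OF q(2) uv(2)] r by auto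
      have "piv \<otimes> x' i j = (p u i * p j v) \<odot> (x' i j \<otimes> piv)"
        using wt_x'[OF q(3,4)] o lm by (simp add: wt_def weight_def)
      then show ?thesis using c uv True by (simp add: lm x'_eq)
    next
      case False
      then have ex: "pos n l m < Suc r \<longleftrightarrow> pos n l m < r" by auto
      note lt = pos_less[OF q(2) uv(2), of l u, folded r]
      show ?thesis
      proof (rule x'_relation[OF q _ M(2)[unfolded ex]])
        \<comment> \<open>After the pivot the coefficient is zero. Before it, either all four
          entries lie above row \<open>u\<close>, where the \<open>lam\<close> in
          \<open>weight\<close> depends on the column alone, or \<open>l = u\<close> and both
          columns are left of \<open>v\<close>, where no \<open>lam\<close> occurs.\<close>
        show "(if pos n l m < r then lam - 1 else 0) * p l i = 0 \<or>
            weight i m * weight l j = weight l m * weight i j"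
          using o unfolding lt by (auto simp: weight_def mult_ac)
        show "t l m \<otimes> t i j = (p l i * p j m) \<odot> (t i j \<otimes> t l m) \<oplus>
            ((if pos n l m < r then lam - 1 else 0) * p l i) \<odot> (t i m \<otimes> t l j)"
        proof (cases "l < u \<and> m < v")
          case True
          then have "pos n l m < r" using lt by simp
          then show ?thesis using tt_relations(1)[OF q] o True by simp
        next
          case False
          \<comment> \<open>\<open>l \<ge> u\<close> makes \<open>t l m\<close> and
            \<open>t l j\<close> vanish, \<open>m \<ge> v\<close> makes \<open>t l m\<close> and
            \<open>t i m\<close> vanish; in both cases all terms are zero.\<close>
          then have "t l m = \<zero>" "t i m = \<zero> \<or> t l j = \<zero>" using z by (auto simp: not_less)
          then show ?thesis using c by auto
        qed
      qed (use o in auto)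
    qed }
  { assume o: "i < l \<and> m \<le> j"
    have "x' l m \<otimes> x' i j = (lam * p l i * p j m) \<odot> (x' i j \<otimes> x' l m) \<oplus> 0 \<odot> (x' i m \<otimes> x' l j)"
    proof (rule x'_relation[OF q])
      show "x l m \<otimes> x i j = (lam * p l i * p j m) \<odot> (x i j \<otimes> x l m) \<oplus> 0 \<odot> (x i m \<otimes> x l j)"
        using M(3) o c by simp
      have "t l m \<otimes> t i j = (lam * p l i * p j m) \<odot> (t i j \<otimes> t l m)"
      proof (cases "l < u \<and> j < v")
        case True
        then show ?thesis using tt_relations(2)[OF q] o by simp
      next
        case False
        then have "t l m = \<zero> \<or> t i j = \<zero>" using z by (auto simp: not_less)
        then show ?thesis using c by auto
      qed
      then show "t l m \<otimes> t i j = (lam * p l i * p j m) \<odot> (t i j \<otimes> t l m) \<oplus> 0 \<odot> (t i m \<otimes> t l j)"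
        using c by simp
    qed simp
    then show "x' l m \<otimes> x' i j = (lam * p l i * p j m) \<odot> (x' i j \<otimes> x' l m)" using c by simp }
  { assume o: "i = l \<and> j < m"
    have "x' l m \<otimes> x' i j = p j m \<odot> (x' i j \<otimes> x' l m) \<oplus> 0 \<odot> (x' i m \<otimes> x' l j)"
    proof (rule x'_relation[OF q])
      show "x l m \<otimes> x i j = p j m \<odot> (x i j \<otimes> x l m) \<oplus> 0 \<odot> (x i m \<otimes> x l j)"
        using M(4) o c by simp
      have "t l m \<otimes> t i j = p j m \<odot> (t i j \<otimes> t l m)"
      proof (cases "l < u \<and> m < v")
        case True
        then show ?thesis using tt_relations(3)[OF q] o by simp
      next
        case False
        then have "t l m = \<zero>" using z by (auto simp: not_less)
        then show ?thesis using c by auto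
      qed
      then show "t l m \<otimes> t i j = p j m \<odot> (t i j \<otimes> t l m) \<oplus> 0 \<odot> (t i m \<otimes> t l j)"
        using c by simp
    qed simp
    then show "x' l m \<otimes> x' i j = p j m \<odot> (x' i j \<otimes> x' l m)" using c by simp }
qed (rule x'_closed)

lemma x'_generates:
  assumes H: "div_subalg H D" and x': "\<And>i j. i \<in> {1..n} \<Longrightarrow> j \<in> {1..n} \<Longrightarrow> x' i j \<in> H"
    and ij: "i \<in> {1..n}" "j \<in> {1..n}"
  shows "x i j \<in> H"
proof -
  have s: "subalg H D" using H by (simp add: div_subalg_def)
  note S = subalgD[OF k_algebra_axioms s]
  \<comment> \<open>Row \<open>u\<close> and column \<open>v\<close> are unchanged by the deletion,
    so the correction \<open>t i j\<close> can be rebuilt from the new elements.\<close>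
  have "x u j \<in> H" "x i v \<in> H" "piv \<in> H"
    using x'[OF uv(1) ij(2)] x'[OF ij(1) uv(2)] x'[OF uv] ij uv by (simp_all add: x'_eq)
  moreover from this have "inv piv \<in> H" using H pivot by (simp add: div_subalg_def)
  ultimately have "t i j \<in> H" by (auto simp: t_def intro!: S(3,6))
  then show ?thesis using x_decomp[OF ij] S(4)[OF x'[OF ij]] by simp
qed

end

lemma matrix_delete:
  fixes D :: "('k::field, 'd) module"
  assumes D: "div_alg D" and p: "mult_antisym n p" and lam: "lam \<noteq> 0"
    and rels: "matrix_relations D n lam p r x"
  shows "\<exists>x'. matrix_relations D n lam p 0 x' \<and>
    (\<forall>H\<in>{H. div_subalg H D \<and> (\<forall>i\<in>{1..n}. \<forall>j\<in>{1..n}. x' i j \<in> H)}. \<forall>i\<in>{1..n}. \<forall>j\<in>{1..n}. x i j \<in> H)"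
  using rels
proof (induction r arbitrary: x)
  case 0
  then show ?case by (intro exI[of _ x]) simp
next
  case (Suc r)
  interpret D: div_alg D by fact
  have "\<exists>x'. matrix_relations D n lam p r x' \<and>
    (\<forall>H\<in>{H. div_subalg H D \<and> (\<forall>i\<in>{1..n}. \<forall>j\<in>{1..n}. x' i j \<in> H)}. \<forall>i\<in>{1..n}. \<forall>j\<in>{1..n}. x i j \<in> H)"
  proof (cases "lam \<noteq> 1 \<and> (\<exists>u\<in>{1..n}. \<exists>v\<in>{1..n}. r = pos n u v \<and> x u v \<noteq> \<zero>\<^bsub>D\<^esub>)")
    case True
    then obtain u v where uv: "lam \<noteq> 1" "u \<in> {1..n}" "v \<in> {1..n}" "r = pos n u v" "x u v \<noteq> \<zero>\<^bsub>D\<^esub>" by blast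
    interpret matrix_step D n lam p r u v x
      by unfold_locales (use Suc.prems p lam uv in auto)
    show ?thesis using matrix_relations_x' x'_generates by (intro exI[of _ x']) simp
  next
    \<comment> \<open>Here \<open>x\<close> is kept: \<open>r\<close> is the number of no position,
      or \<open>lam = 1\<close> and the extra terms have coefficient zero, or the entry at position
      \<open>r\<close> is zero and both sides of its new relation vanish.\<close>
    case False
    have "matrix_relations D n lam p r x"
      unfolding matrix_relations_def
    proof (intro conjI ballI impI)
      fix l m i j assume q: "l \<in> {1..n}" "m \<in> {1..n}" "i \<in> {1..n}" "j \<in> {1..n}"
      note M = matrix_relationsD[OF Suc.prems q]
      have c: "x i j \<in> carrier D" "x l m \<in> carrier D" "x i m \<in> carrier D" "x l j \<in> carrier D"
        using matrix_relationsD(1)[OF Suc.prems] q by blast+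
      show "i < l \<and> m \<le> j \<Longrightarrow> x l m \<otimes>\<^bsub>D\<^esub> x i j = (lam * p l i * p j m) \<odot>\<^bsub>D\<^esub> (x i j \<otimes>\<^bsub>D\<^esub> x l m)"
        "i = l \<and> j < m \<Longrightarrow> x l m \<otimes>\<^bsub>D\<^esub> x i j = p j m \<odot>\<^bsub>D\<^esub> (x i j \<otimes>\<^bsub>D\<^esub> x l m)"
        using M(3,4) by blast+
      assume o: "i < l \<and> j < m"
      show "x l m \<otimes>\<^bsub>D\<^esub> x i j = (p l i * p j m) \<odot>\<^bsub>D\<^esub> (x i j \<otimes>\<^bsub>D\<^esub> x l m) \<oplus>\<^bsub>D\<^esub>
        ((if pos n l m < r then lam - 1 else 0) * p l i) \<odot>\<^bsub>D\<^esub> (x i m \<otimes>\<^bsub>D\<^esub> x l j)"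
      proof (cases "pos n l m = r \<and> lam \<noteq> 1")
        case True
        then have "x l m = \<zero>\<^bsub>D\<^esub>" using False q by blast
        then show ?thesis using c True by simp
      next
        case False
        then have "(if pos n l m < r then lam - 1 else 0) = (if pos n l m < Suc r then lam - 1 else 0)" by auto
        then show ?thesis using M(2) o by simp
      qed
    qed (use matrix_relationsD(1)[OF Suc.prems] in blast)
    then show ?thesis by (intro exI[of _ x]) simp
  qed
  then obtain x1 where x1: "matrix_relations D n lam p r x1"
    "\<forall>H\<in>{H. div_subalg H D \<and> (\<forall>i\<in>{1..n}. \<forall>j\<in>{1..n}. x1 i j \<in> H)}. \<forall>i\<in>{1..n}. \<forall>j\<in>{1..n}. x i j \<in> H"
    by (elim exE conjE)
  obtain x2 where x2: "matrix_relations D n lam p 0 x2"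
    "\<forall>H\<in>{H. div_subalg H D \<and> (\<forall>i\<in>{1..n}. \<forall>j\<in>{1..n}. x2 i j \<in> H)}. \<forall>i\<in>{1..n}. \<forall>j\<in>{1..n}. x1 i j \<in> H"
    using Suc.IH[OF x1(1)] by (elim exE conjE)
  show ?case using x1(2) x2 by (intro exI[of _ x2]) simp
qed

lemma matrix_qcommute:
  fixes D :: "('k::field, 'd) module"
  assumes D: "k_algebra D" and p: "mult_antisym n p" and lam: "lam \<noteq> 0"
    and rels: "matrix_relations D n lam p 0 x"
    and q: "l \<in> {1..n}" "m \<in> {1..n}" "i \<in> {1..n}" "j \<in> {1..n}"
  shows "qcommute D (x l m) (x i j)"
proof -
  interpret k_algebra D by fact
  have c: "x i j \<in> carrier D" if "i \<in> {1..n}" "j \<in> {1..n}" for i j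
    using matrix_relationsD(1)[OF rels] that by blast
  have nz: "p i j \<noteq> 0" if "i \<in> {1..n}" "j \<in> {1..n}" for i j using p that unfolding mult_antisym_def by blast
  have *: "qcommute D (x l m) (x i j)"
    if q: "l \<in> {1..n}" "m \<in> {1..n}" "i \<in> {1..n}" "j \<in> {1..n}" and o: "i < l \<or> i = l \<and> j < m" for l m i j
  proof -
    note M = matrix_relationsD[OF rels q]
    consider "i < l" "j < m" | "i < l" "m \<le> j" | "i = l" "j < m" using o by linarith
    then show ?thesis
    proof cases
      case 1
      have "x l m \<otimes>\<^bsub>D\<^esub> x i j = (p l i * p j m) \<odot>\<^bsub>D\<^esub> (x i j \<otimes>\<^bsub>D\<^esub> x l m)"
        using M(2)[OF 1] c q by simp
      then show ?thesis by (rule qcommuteI) (use nz q in simp)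
    next
      case 2
      show ?thesis by (rule qcommuteI[OF M(3)[OF 2]]) (use nz q lam in simp)
    next
      case 3
      show ?thesis by (rule qcommuteI[OF M(4)[OF 3]]) (use nz q in simp)
    qed
  qed
  consider "i < l \<or> i = l \<and> j < m" | "l < i \<or> l = i \<and> m < j" | "i = l" "j = m" by linarith
  then show ?thesis
  proof cases
    case 2
    show ?thesis by (rule qcommute_sym[OF *[OF q(3,4,1,2) 2]]) (use c q in auto)
  qed (use * q c qcommute_refl in auto)
qed

section \<open>Enumeration of the matrix entries and conclusion for quantum matrices\<close>

definition matrix_gen :: "nat \<Rightarrow> (nat \<Rightarrow> nat \<Rightarrow> 'a) \<Rightarrow> nat \<Rightarrow> 'a"
  where "matrix_gen n x k = x (Suc (k div n)) (Suc (k mod n))"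

lemma index_less:
  assumes "i < n" "j < (n::nat)" shows "i * n + j < n * n"
proof -
  have "i * n + j < Suc i * n" using assms by simp
  also have "\<dots> \<le> n * n" using assms by (intro mult_le_mono1) simp
  finally show ?thesis .
qed

lemma matrix_gen_eq:
  assumes "i \<in> {1..n}" "j \<in> {1..n}"
  shows "matrix_gen n x ((i - 1) * n + (j - 1)) = x i j" "(i - 1) * n + (j - 1) < n * n"
proof -
  obtain a b where ab: "i = Suc a" "j = Suc b" "a < n" "b < n"
    using assms by (cases i; cases j) auto
  then show "matrix_gen n x ((i - 1) * n + (j - 1)) = x i j" "(i - 1) * n + (j - 1) < n * n"
    using index_less[of a n b] by (simp_all add: matrix_gen_def)
qed

lemma matrix_gen_index: "k < n * n \<Longrightarrow> Suc (k div n) \<in> {1..n} \<and> Suc (k mod n) \<in> {1..n}"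
  using less_mult_imp_div_less[of k n n] by (cases "n = 0") (auto simp: Suc_le_eq)

lemma matrix_gen_image: "matrix_gen n x ` {..<n * n} = {x i j | i j. i \<in> {1..n} \<and> j \<in> {1..n}}"
proof (intro equalityI subsetI)
  fix s assume "s \<in> matrix_gen n x ` {..<n * n}"
  then obtain k where "k < n * n" "s = matrix_gen n x k" by auto
  with matrix_gen_index[of k n] show "s \<in> {x i j | i j. i \<in> {1..n} \<and> j \<in> {1..n}}"
    unfolding matrix_gen_def by blast
next
  fix s assume "s \<in> {x i j | i j. i \<in> {1..n} \<and> j \<in> {1..n}}"
  then obtain i j where "s = x i j" "i \<in> {1..n}" "j \<in> {1..n}" by blast
  with matrix_gen_eq[of i n j] show "s \<in> matrix_gen n x ` {..<n * n}" by (metis image_eqI lessThan_iff)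
qed

text \<open>In the numbering row by row the extra term \<open>x i m x l j\<close> begins in an
  earlier row than \<open>x l m\<close>, and the main term begins with \<open>x i j\<close>, which
  precedes \<open>x l m\<close>; both are admissible.\<close>

lemma matrix_straightening:
  assumes A: "k_algebra A" and rels: "matrix_relations A n lam p r x"
  shows "straightening A (matrix_gen n x) (n * n)"
  unfolding straightening_def
proof (intro conjI allI impI)
  interpret k_algebra A by fact
  show "matrix_gen n x ` {..<n * n} \<subseteq> carrier A"
    unfolding matrix_gen_image using matrix_relationsD(1)[OF rels] by blast
  fix k' k assume k: "k < n * n" "k' < k"
  let ?S = "{matrix_gen n x a \<otimes>\<^bsub>A\<^esub> matrix_gen n x b | a b. a < k \<and> b < n * n}"
  define l m i j where "l = Suc (k div n)" and "m = Suc (k mod n)" and "i = Suc (k' div n)" and "j = Suc (k' mod n)"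
  have q: "l \<in> {1..n}" "m \<in> {1..n}" "i \<in> {1..n}" "j \<in> {1..n}"
    using matrix_gen_index[of k n] matrix_gen_index[of k' n] k by (auto simp: l_def m_def i_def j_def)
  have g: "matrix_gen n x k = x l m" "matrix_gen n x k' = x i j"
    by (simp_all add: matrix_gen_def l_def m_def i_def j_def)
  have il: "i \<le> l" using k div_le_mono[of k' k n] by (simp add: i_def l_def)
  have eq: "j < m" if "i = l"
  proof -
    have "k = (l - 1) * n + (m - 1)" "k' = (i - 1) * n + (j - 1)" by (simp_all add: l_def m_def i_def j_def)
    then show ?thesis using k(2) that q by auto
  qed
  have S1: "d \<odot>\<^bsub>A\<^esub> (x i j \<otimes>\<^bsub>A\<^esub> x l m) \<in> lspan A ?S" for d
  proof -
    have "matrix_gen n x k' \<otimes>\<^bsub>A\<^esub> matrix_gen n x k \<in> ?S" using k by blast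
    then show ?thesis unfolding g by (intro lspan.smult lspan.base)
  qed
  have S2: "d \<odot>\<^bsub>A\<^esub> (x i m \<otimes>\<^bsub>A\<^esub> x l j) \<in> lspan A ?S" if "i < l" for d
  proof (intro lspan.smult lspan.base CollectI exI conjI)
    show "x i m \<otimes>\<^bsub>A\<^esub> x l j = matrix_gen n x ((i - 1) * n + (m - 1)) \<otimes>\<^bsub>A\<^esub> matrix_gen n x ((l - 1) * n + (j - 1))"
      by (simp only: matrix_gen_eq(1)[OF q(3,2)] matrix_gen_eq(1)[OF q(1,4)])
    show "(l - 1) * n + (j - 1) < n * n" by (rule matrix_gen_eq(2)[OF q(1,4)])
    have "m - 1 < n" using q by auto
    then have "(i - 1) * n + (m - 1) < Suc (i - 1) * n" unfolding mult_Suc by linarith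
    also have "\<dots> \<le> (l - 1) * n" using that q by (intro mult_le_mono1) auto
    also have "\<dots> \<le> k" by (simp add: l_def)
    finally show "(i - 1) * n + (m - 1) < k" .
  qed
  note M = matrix_relationsD[OF rels q]
  consider "i < l" "j < m" | "i < l" "m \<le> j" | "i = l" "j < m" using il eq by linarith
  then show "matrix_gen n x k \<otimes>\<^bsub>A\<^esub> matrix_gen n x k' \<in> lspan A ?S"
  proof cases
    case 1
    show ?thesis unfolding g M(2)[OF 1] by (intro lspan.add S1 S2 1)
  next
    case 2
    show ?thesis unfolding g M(3)[OF 2] by (rule S1)
  next
    case 3
    show ?thesis unfolding g M(4)[OF 3] by (rule S1)
  qed
qed

theorem matrix_Gelfand_Kirillov:
  fixes R :: "('k::field, 'a) module"
  assumes R: "k_algebra R" and dom: "nc_domain R"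
    and p: "mult_antisym n p" and lam: "lam \<noteq> 0"
    and t: "matrix_relations R n lam p r x"
    and gen: "generating R {x i j | i j. i \<in> {1..n} \<and> j \<in> {1..n}}"
  shows "Fract_of_quantum_affine_factor R"
proof (rule quantum_Gelfand_Kirillov[OF R dom _ matrix_straightening[OF R t]])
  show "generating R (matrix_gen n x ` {..<n * n})" using gen by (simp only: matrix_gen_image)
  fix D :: "('k, ('a \<times> 'a) set) module" and \<phi>
  assume D: "div_alg D" and \<phi>: "\<phi> \<in> alg_hom R D"
  interpret D: div_alg D by fact
  obtain x' where x': "matrix_relations D n lam p 0 x'"
    "\<forall>H\<in>{H. div_subalg H D \<and> (\<forall>i\<in>{1..n}. \<forall>j\<in>{1..n}. x' i j \<in> H)}. \<forall>i\<in>{1..n}. \<forall>j\<in>{1..n}. \<phi> (x i j) \<in> H"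
    using matrix_delete[OF D p lam matrix_relations_image[OF R D.k_algebra_axioms \<phi> t]] by (elim exE conjE)
  let ?Z = "(\<lambda>(i, j). x' i j) ` ({1..n} \<times> {1..n})"
  have "finite ?Z" by simp
  then obtain zs where zs: "set zs = ?Z" using finite_list by blast
  have "?Z \<subseteq> carrier D" using matrix_relationsD(1)[OF x'(1)] by auto
  moreover have "\<forall>u\<in>?Z. \<forall>v\<in>?Z. qcommute D u v"
    using matrix_qcommute[OF D.k_algebra_axioms p lam x'(1)] by auto
  moreover have "(\<phi> \<circ> matrix_gen n x) ` {..<n * n} \<subseteq> H" if H: "div_subalg H D" "?Z \<subseteq> H" for H
  proof -
    have "\<forall>i\<in>{1..n}. \<forall>j\<in>{1..n}. x' i j \<in> H" using H(2) by auto
    then have "\<forall>i\<in>{1..n}. \<forall>j\<in>{1..n}. \<phi> (x i j) \<in> H" using x'(2) H(1) by simp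
    then show ?thesis using matrix_gen_index by (auto simp: matrix_gen_def)
  qed
  ultimately show "\<exists>zs. set zs \<subseteq> carrier D \<and> (\<forall>x\<in>set zs. \<forall>y\<in>set zs. qcommute D x y) \<and>
      (\<forall>H\<in>{H. div_subalg H D \<and> set zs \<subseteq> H}. (\<phi> \<circ> matrix_gen n x) ` {..<n * n} \<subseteq> H)"
    by (intro exI[of _ zs]) (simp add: zs)
qed

section \<open>The four families\<close>

lemma skew_polynomial_ringD:
  assumes "skew_polynomial_ring A R x \<tau> \<delta> S"
  shows "subalg R A" "subalg S A" "R \<subseteq> S" "x \<in> S"
    "r \<in> R \<Longrightarrow> x \<otimes>\<^bsub>A\<^esub> r = \<tau> r \<otimes>\<^bsub>A\<^esub> x \<oplus>\<^bsub>A\<^esub> \<delta> r"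
  using assms unfolding skew_polynomial_ring_def by blast+

lemma (in k_algebra) subalg_finsum:
  assumes H: "subalg H A" and "\<And>i. i \<in> I \<Longrightarrow> f i \<in> H"
  shows "(\<Oplus>i\<in>I. f i) \<in> H"
  using assms(2)
proof (induction I rule: infinite_finite_induct)
  case (insert i I)
  note S = subalgD[OF k_algebra_axioms H]
  have "f i \<in> carrier A" "f \<in> I \<rightarrow> carrier A" using insert S(1) by auto
  with insert show ?case by (simp add: finsum_insert S(4))
qed (use subalgD(3)[OF k_algebra_axioms H] in auto)

text \<open>Elements of \<open>S\<close> are finite sums of terms \<open>c i x^i\<close>. Climbing
  the tower with this inclusion shows that the base ring and the variables generate the
  algebra.\<close>

lemma skew_polynomial_ring_subset:
  assumes A: "k_algebra A" and sk: "skew_polynomial_ring A R x \<tau> \<delta> S"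
    and H: "subalg H A" "R \<subseteq> H" "x \<in> H"
  shows "S \<subseteq> H"
proof
  interpret k_algebra A by fact
  note D = subalgD[OF A H(1)]
  have pow: "x [^]\<^bsub>A\<^esub> i \<in> H" for i :: nat by (induction i) (use D(2,6) H in auto)
  fix s assume "s \<in> S"
  then have "\<exists>!c :: nat \<Rightarrow> 'a. range c \<subseteq> R \<and> finite {i. c i \<noteq> \<zero>\<^bsub>A\<^esub>} \<and>
       s = (\<Oplus>\<^bsub>A\<^esub>i \<in> {i. c i \<noteq> \<zero>\<^bsub>A\<^esub>}. c i \<otimes>\<^bsub>A\<^esub> x [^]\<^bsub>A\<^esub> i)"
    using sk unfolding skew_polynomial_ring_def by blast
  then obtain c :: "nat \<Rightarrow> 'a" where c: "range c \<subseteq> R"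
    "s = (\<Oplus>\<^bsub>A\<^esub>i \<in> {i. c i \<noteq> \<zero>\<^bsub>A\<^esub>}. c i \<otimes>\<^bsub>A\<^esub> x [^]\<^bsub>A\<^esub> i)" by (elim ex1E conjE)
  have "c i \<in> H" for i using c(1) H(2) by auto
  then show "s \<in> H" unfolding c(2) by (intro subalg_finsum[OF H(1)] D(6) pow)
qed

text \<open>The data that the sequel takes from a tower: commutation rules of each new variable with
  the earlier generators, and generation. The summand \<open>\<zero>\<close> in the first rule is
  the zero derivation that accompanies \<open>\<sigma> i\<close>.\<close>

lemma skew_towerD:
  assumes A: "k_algebra A" and t: "skew_tower A n R0 y x \<sigma> \<tau> \<delta>" and n: "n \<ge> 1"
  shows "\<And>i r. i \<in> {1..n} \<Longrightarrow> r \<in> R0 \<union> y ` {1..<i} \<union> x ` {1..<i} \<Longrightarrow> y i \<otimes>\<^bsub>A\<^esub> r = \<sigma> i r \<otimes>\<^bsub>A\<^esub> y i \<oplus>\<^bsub>A\<^esub> \<zero>\<^bsub>A\<^esub>"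
    and "\<And>i r. i \<in> {1..n} \<Longrightarrow> r \<in> R0 \<union> y ` {1..i} \<union> x ` {1..<i} \<Longrightarrow> x i \<otimes>\<^bsub>A\<^esub> r = \<tau> i r \<otimes>\<^bsub>A\<^esub> x i \<oplus>\<^bsub>A\<^esub> \<delta> i r"
    and "\<And>i. i \<in> {1..n} \<Longrightarrow> y i \<in> carrier A" "\<And>i. i \<in> {1..n} \<Longrightarrow> x i \<in> carrier A"
    and "\<And>H. subalg H A \<Longrightarrow> R0 \<subseteq> H \<Longrightarrow> y ` {1..n} \<subseteq> H \<Longrightarrow> x ` {1..n} \<subseteq> H \<Longrightarrow> carrier A \<subseteq> H"
proof -
  obtain R S where RS: "R 0 = R0" "R n = carrier A"
    "\<And>i. i \<in> {1..n} \<Longrightarrow> skew_polynomial_ring A (R (i - 1)) (y i) (\<sigma> i) (\<lambda>_. \<zero>\<^bsub>A\<^esub>) (S i)"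
    "\<And>i. i \<in> {1..n} \<Longrightarrow> skew_polynomial_ring A (S i) (x i) (\<tau> i) (\<delta> i) (R i)"
    using t unfolding skew_tower_def by blast
  note Y = skew_polynomial_ringD[OF RS(3)] and Z = skew_polynomial_ringD[OF RS(4)]
  have R: "R0 \<union> y ` {1..i} \<union> x ` {1..i} \<subseteq> R i" if "i \<le> n" for i
    using that
  proof (induction i)
    case 0
    then show ?case using RS(1) by simp
  next
    case (Suc i)
    have i: "Suc i \<in> {1..n}" using Suc.prems by auto
    have "R i \<subseteq> R (Suc i)" using Y(3)[OF i] Z(3)[OF i] by simp
    moreover have "y (Suc i) \<in> R (Suc i)" using Y(4)[OF i] Z(3)[OF i] by blast
    moreover have "x (Suc i) \<in> R (Suc i)" using Z(4)[OF i] .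
    moreover have "{1..Suc i} = insert (Suc i) {1..i}" by auto
    ultimately show ?case using Suc by auto
  qed
  have R': "R0 \<union> y ` {1..<i} \<union> x ` {1..<i} \<subseteq> R (i - 1)" if "i \<in> {1..n}" for i
  proof -
    have "{1..<i} = {1..i - 1}" "i - 1 \<le> n" using that by auto
    then show ?thesis using R[of "i - 1"] by simp
  qed
  show "y i \<otimes>\<^bsub>A\<^esub> r = \<sigma> i r \<otimes>\<^bsub>A\<^esub> y i \<oplus>\<^bsub>A\<^esub> \<zero>\<^bsub>A\<^esub>"
    if "i \<in> {1..n}" "r \<in> R0 \<union> y ` {1..<i} \<union> x ` {1..<i}" for i r
    using Y(5)[OF that(1)] R'[OF that(1)] that(2) by blast
  show "x i \<otimes>\<^bsub>A\<^esub> r = \<tau> i r \<otimes>\<^bsub>A\<^esub> x i \<oplus>\<^bsub>A\<^esub> \<delta> i r"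
    if i: "i \<in> {1..n}" and r: "r \<in> R0 \<union> y ` {1..i} \<union> x ` {1..<i}" for i r
  proof (rule Z(5)[OF i])
    have "{1..i} = insert i {1..<i}" using i by auto
    then show "r \<in> S i" using R'[OF i] Y(3,4)[OF i] r by auto
  qed
  show "y i \<in> carrier A" "x i \<in> carrier A" if i: "i \<in> {1..n}" for i
    using Y(4)[OF i] Z(4)[OF i] subalgD(1)[OF A Y(2)[OF i]] subalgD(1)[OF A Z(2)[OF i]] by blast+
  fix H assume H: "subalg H A" "R0 \<subseteq> H" "y ` {1..n} \<subseteq> H" "x ` {1..n} \<subseteq> H"
  have "R i \<subseteq> H" if "i \<le> n" for i
    using that
  proof (induction i)
    case 0
    then show ?case using RS(1) H by simp
  next
    case (Suc i)
    have i: "Suc i \<in> {1..n}" using Suc.prems by auto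
    have yx: "y (Suc i) \<in> H" "x (Suc i) \<in> H" using H(3,4) i by blast+
    have "S (Suc i) \<subseteq> H"
      using skew_polynomial_ring_subset[OF A RS(3)[OF i] H(1) _ yx(1)] Suc by simp
    then show ?case by (rule skew_polynomial_ring_subset[OF A RS(4)[OF i] H(1) _ yx(2)])
  qed
  then show "carrier A \<subseteq> H" using RS(2) by blast
qed

lemma scalars_subset: "k_algebra A \<Longrightarrow> subalg H A \<Longrightarrow> scalars A \<subseteq> H"
  unfolding scalars_def using subalgD(2,7)[of A H] by blast

lemma mult_antisymD:
  assumes "mult_antisym n G" "i \<in> {1..n}" "j \<in> {1..n}"
  shows "G i j \<noteq> 0" "inverse (G i j) = G j i" "G i j * G j i = 1"
proof -
  show 1: "G i j \<noteq> 0" using assms unfolding mult_antisym_def by blast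
  show 2: "inverse (G i j) = G j i" using assms unfolding mult_antisym_def by metis
  show "G i j * G j i = 1" using 1 2[symmetric] by simp
qed

lemma tower_factor:
  fixes A :: "('k::field, 'a) module" (structure)
  assumes A: "k_algebra A" and I: "completely_prime I A"
    and t: "tower_relations A n w y x yy xx xy wy wx a c \<kappa>"
    and nz: "\<forall>i\<in>{1..n}. \<forall>l\<in>{1..<i}. xy l i \<noteq> 0"
    and scal: "tower_scalars n yy xx xy wy wx a c \<kappa> \<or>
      (\<forall>u\<in>insert w (y ` {1..n} \<union> x ` {1..n}). \<forall>v\<in>insert w (y ` {1..n} \<union> x ` {1..n}). u \<otimes> v = v \<otimes> u)"
    and gen: "generating A (insert w (y ` {1..n} \<union> x ` {1..n}))"
  shows "Fract_of_quantum_affine_factor (alg_quot A I)"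
proof -
  let ?G = "insert w (y ` {1..n} \<union> x ` {1..n})"
  note R = completely_primeD[OF A I]
  define f where "f = (+>) I"
  note R = R[folded f_def]
  interpret alg_hom_loc A "alg_quot A I" f by (intro alg_hom_locI A R)
  have im: "f ` ?G = insert (f w) ((f \<circ> y) ` {1..n} \<union> (f \<circ> x) ` {1..n})"
    by (simp add: image_Un image_comp)
  have G: "?G \<subseteq> carrier A" using gen by (simp add: generating_def)
  have comm: "\<forall>u\<in>f ` ?G. \<forall>v\<in>f ` ?G. u \<otimes>\<^bsub>alg_quot A I\<^esub> v = v \<otimes>\<^bsub>alg_quot A I\<^esub> u"
    if c: "\<forall>u\<in>?G. \<forall>v\<in>?G. u \<otimes> v = v \<otimes> u"
  proof (intro ballI)
    fix u v assume "u \<in> f ` ?G" "v \<in> f ` ?G"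
    then obtain u' v' where uv: "u = f u'" "v = f v'" "u' \<in> ?G" "v' \<in> ?G" by (elim imageE)
    have "u' \<in> carrier A" "v' \<in> carrier A" using subsetD[OF G uv(3)] subsetD[OF G uv(4)] .
    moreover have "u' \<otimes> v' = v' \<otimes> u'" using c uv(3,4) by blast
    ultimately show "u \<otimes>\<^bsub>alg_quot A I\<^esub> v = v \<otimes>\<^bsub>alg_quot A I\<^esub> u" by (simp add: uv(1,2) flip: mult)
  qed
  show ?thesis
  proof (rule tower_Gelfand_Kirillov[OF R(1,2) tower_relations_image[OF A R(1,3) t] nz])
    show "tower_scalars n yy xx xy wy wx a c \<kappa> \<or>
      (\<forall>u\<in>insert (f w) ((f \<circ> y) ` {1..n} \<union> (f \<circ> x) ` {1..n}).
       \<forall>v\<in>insert (f w) ((f \<circ> y) ` {1..n} \<union> (f \<circ> x) ` {1..n}). u \<otimes>\<^bsub>alg_quot A I\<^esub> v = v \<otimes>\<^bsub>alg_quot A I\<^esub> u)"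
      unfolding im[symmetric] using scal comm by blast
    show "generating (alg_quot A I) (insert (f w) ((f \<circ> y) ` {1..n} \<union> (f \<circ> x) ` {1..n}))"
      unfolding im[symmetric] by (rule generating_image[OF A R(1,3,4) gen])
  qed
qed

theorem quantum_euclidean_factor:
  fixes A :: "('k::field, 'a) module" (structure)
  assumes A: "k_algebra A" and n: "n \<ge> 1" and I: "completely_prime I A"
    and q: "q \<noteq> 0" "s\<^sup>2 = q" "q\<^sup>2 = 1 \<longrightarrow> q = 1" and E: "is_quantum_euclidean n q s A"
  shows "Fract_of_quantum_affine_factor (alg_quot A I)"
proof -
  interpret k_algebra A by fact
  obtain w W y x \<sigma> \<tau> \<delta> where sk: "skew_polynomial_ring A (scalars A) w id (\<lambda>_. \<zero>) W"
    and tw: "skew_tower A n W y x \<sigma> \<tau> \<delta>"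
    and r: "\<And>i. i \<in> {1..n} \<Longrightarrow>
         \<sigma> i w = inverse q \<odot> w \<and> \<tau> i w = q \<odot> w \<and> \<delta> i w = \<zero> \<and>
         (\<forall>j \<in> {1..<i}.
            \<sigma> i (y j) = inverse q \<odot> y j \<and> \<sigma> i (x j) = inverse q \<odot> x j \<and>
            \<tau> i (y j) = q \<odot> y j \<and> \<tau> i (x j) = q \<odot> x j \<and>
            \<delta> i (y j) = \<zero> \<and> \<delta> i (x j) = \<zero>) \<and>
         \<tau> i (y i) = y i \<and>
         \<delta> i (y i) = (s - s ^ 3) \<odot> (w \<otimes> w) \<oplus>
           (1 - q\<^sup>2) \<odot> (\<Oplus>l \<in> {1..<i}. y l \<otimes> x l)"
    using E unfolding is_quantum_euclidean_def by blast
  note T = skew_towerD[OF A tw n]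
  have wW: "w \<in> W" by (rule skew_polynomial_ringD(4)[OF sk])
  have w [simp]: "w \<in> carrier A" using subalgD(1)[OF A skew_polynomial_ringD(2)[OF sk] wW] .
  have yx [simp]: "y i \<in> carrier A" "x i \<in> carrier A" if "i \<in> {1..n}" for i using T(3,4) that by auto
  \<comment> \<open>\<open>\<tau> i\<close> fixes \<open>y i\<close>, so \<open>a\<close> is 1; with
    \<open>c = 1 - q^2\<close> this gives \<open>a - c = q^2\<close>, which is also the factor with
    which \<open>w^2\<close> passes \<open>y i\<close>.\<close>
  define yy where "yy = (\<lambda>(i::nat) (j::nat). inverse q)"
  define xx where "xx = (\<lambda>(i::nat) (j::nat). q)"
  define wy where "wy = (\<lambda>i :: nat. inverse q)"
  define wx where "wx = (\<lambda>i :: nat. q)"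
  define a where "a = (\<lambda>i :: nat. 1 :: 'k)"
  define c where "c = (\<lambda>i :: nat. 1 - q\<^sup>2)"
  note d = yy_def xx_def wy_def wx_def a_def c_def
  have rels: "tower_relations A n w y x yy xx xx wy wx a c (s - s ^ 3)"
    unfolding tower_relations_def
  proof (intro conjI ballI)
    fix i assume i: "i \<in> {1..n}"
    show "y i \<otimes> w = wy i \<odot> (w \<otimes> y i)" "x i \<otimes> w = wx i \<odot> (w \<otimes> x i)"
      using T(1)[OF i, of w] T(2)[OF i, of w] wW r[OF i] yx[OF i] by (simp_all add: d sm_mult)
    have sum: "(1 - q\<^sup>2) \<odot> (\<Oplus>l \<in> {1..<i}. y l \<otimes> x l) = (\<Oplus>l \<in> {1..<i}. c l \<odot> (y l \<otimes> x l))"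
      unfolding d using i by (intro sm_finsum) auto
    have "x i \<otimes> y i = \<tau> i (y i) \<otimes> x i \<oplus> \<delta> i (y i)" using i by (intro T(2)) auto
    then show "x i \<otimes> y i = a i \<odot> (y i \<otimes> x i) \<oplus>
        ((s - s ^ 3) \<odot> (w \<otimes> w) \<oplus> (\<Oplus>l \<in> {1..<i}. c l \<odot> (y l \<otimes> x l)))"
      using r[OF i] yx[OF i] by (simp add: sum[symmetric] a_def del: One_nat_def)
  next
    fix i j assume i: "i \<in> {1..n}" and j: "j \<in> {1..<i}"
    then have j': "j \<in> {1..n}" by auto
    show "y i \<otimes> y j = yy i j \<odot> (y j \<otimes> y i)" "x i \<otimes> x j = xx i j \<odot> (x j \<otimes> x i)"
      using T(1)[OF i, of "y j"] T(2)[OF i, of "x j"] r[OF i] j yx[OF i] yx[OF j'] by (simp_all add: d sm_mult)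
  next
    fix i j assume i: "i \<in> {1..n}" and j: "j \<in> {1..n} - {i}"
    show "x i \<otimes> y j = xx i j \<odot> (y j \<otimes> x i)"
    proof (cases "j < i")
      case True
      then show ?thesis using T(2)[OF i, of "y j"] r[OF i] j yx[OF i] yx[of j] by (simp add: d sm_mult)
    next
      case False
      have j': "j \<in> {1..n}" using j by simp
      \<comment> \<open>For \<open>j > i\<close> the relation comes from the adjunction of
        \<open>y j\<close> and has to be reversed.\<close>
      have "y j \<otimes> x i = inverse q \<odot> (x i \<otimes> y j)"
        using T(1)[OF j', of "x i"] r[OF j'] i j False yx[OF i] yx[OF j'] by (simp add: sm_mult)
      from qc_swap[OF this] show ?thesis using q yx[OF i] yx[OF j'] by (simp add: d)
    qed
  qed (use yx w in auto)
  let ?G = "insert w (y ` {1..n} \<union> x ` {1..n})"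
  have scal: "tower_scalars n yy xx xx wy wx a c (s - s ^ 3) \<or> (\<forall>u\<in>?G. \<forall>v\<in>?G. u \<otimes> v = v \<otimes> u)"
  proof (cases "q = 1")
    case False
    then have "q * q \<noteq> 1" using q by (simp add: power2_eq_square)
    moreover have "inverse q * inverse q * (q * q) = 1" using q(1) by (simp add: field_simps)
    ultimately have "tower_scalars n yy xx xx wy wx a c (s - s ^ 3)"
      unfolding tower_scalars_def d using q(1) by (simp add: power2_eq_square)
    then show ?thesis ..
  next
    case True
    \<comment> \<open>For \<open>q = 1\<close>, which includes \<open>q = -1\<close> in
      characteristic 2, both \<open>s - s^3\<close> and \<open>1 - q^2\<close> vanish, and the
      generators commute.\<close>
    have "s * (s * s) = s" using q True by (simp add: power2_eq_square)
    then have z: "s - s ^ 3 = 0" by (simp add: power3_eq_cube mult.assoc)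
    have wc: "y i \<otimes> w = w \<otimes> y i" "x i \<otimes> w = w \<otimes> x i" if "i \<in> {1..n}" for i
      using rels that yx[OF that] by (simp_all add: tower_relations_def d True)
    have yc: "y i \<otimes> y j = y j \<otimes> y i" "x i \<otimes> x j = x j \<otimes> x i"
      if "i \<in> {1..n}" "j \<in> {1..n}" for i j
    proof -
      have *: "y i \<otimes> y j = y j \<otimes> y i \<and> x i \<otimes> x j = x j \<otimes> x i"
        if ij: "i \<in> {1..n}" "j \<in> {1..<i}" for i j
      proof -
        have j: "j \<in> {1..n}" using ij by auto
        have "y i \<otimes> y j = yy i j \<odot> (y j \<otimes> y i)" "x i \<otimes> x j = xx i j \<odot> (x j \<otimes> x i)"
          using rels ij(1) ij(2) unfolding tower_relations_def by simp_all
        then show ?thesis using yx[OF ij(1)] yx[OF j] by (simp add: d True)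
      qed
      show "y i \<otimes> y j = y j \<otimes> y i" "x i \<otimes> x j = x j \<otimes> x i"
      proof -
        have "y i \<otimes> y j = y j \<otimes> y i \<and> x i \<otimes> x j = x j \<otimes> x i"
        proof (cases i j rule: linorder_cases)
          case less
          then have "i \<in> {1..<j}" using that by simp
          note h = *[OF that(2) this]
          from h[THEN conjunct1, symmetric] h[THEN conjunct2, symmetric] show ?thesis by (rule conjI)
        next
          case greater
          then have "j \<in> {1..<i}" using that by simp
          from *[OF that(1) this] show ?thesis .
        qed simp
        then show "y i \<otimes> y j = y j \<otimes> y i" "x i \<otimes> x j = x j \<otimes> x i" by blast+
      qed
    qed
    have xc: "x i \<otimes> y j = y j \<otimes> x i" if ij: "i \<in> {1..n}" "j \<in> {1..n}" for i j
    proof (cases "i = j")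
      case True
      have "(\<Oplus>l \<in> {1..<i}. c l \<odot> (y l \<otimes> x l)) = (\<Oplus>l \<in> {1..<i}. \<zero>)"
        using ij \<open>q = 1\<close> by (intro finsum_cong') (auto simp: d)
      also have "\<dots> = \<zero>" by (rule finsum_zero)
      finally have "(\<Oplus>l \<in> {1..<i}. c l \<odot> (y l \<otimes> x l)) = \<zero>" .
      moreover have "x i \<otimes> y i = a i \<odot> (y i \<otimes> x i) \<oplus>
        ((s - s ^ 3) \<odot> (w \<otimes> w) \<oplus> (\<Oplus>l \<in> {1..<i}. c l \<odot> (y l \<otimes> x l)))"
        using rels ij(1) unfolding tower_relations_def by blast
      ultimately show ?thesis using True yx[OF ij(1)] by (simp add: z a_def)
    next
      case False
      then have "x i \<otimes> y j = xx i j \<odot> (y j \<otimes> x i)"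
        using rels ij unfolding tower_relations_def by blast
      then show ?thesis using yx[OF ij(1)] yx[OF ij(2)] by (simp add: d True)
    qed
    have "\<forall>u\<in>?G. \<forall>v\<in>?G. u \<otimes> v = v \<otimes> u"
      by (intro ballI; elim insertE UnE imageE; simp del: atLeastAtMost_iff One_nat_def add: wc yc xc)
    then show ?thesis ..
  qed
  have gen: "generating A ?G"
    unfolding generating_def
  proof (intro conjI ballI)
    show "?G \<subseteq> carrier A" using yx w by auto
    fix H assume "H \<in> {S. subalg S A \<and> ?G \<subseteq> S}"
    then have H: "subalg H A" "w \<in> H" "y ` {1..n} \<subseteq> H" "x ` {1..n} \<subseteq> H" by auto
    have "W \<subseteq> H" by (rule skew_polynomial_ring_subset[OF A sk H(1) scalars_subset[OF A H(1)] H(2)])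
    then show "carrier A \<subseteq> H" using T(5) H by blast
  qed
  show ?thesis
    by (rule tower_factor[OF A I rels _ scal gen]) (use q in \<open>simp add: d\<close>)
qed

theorem quantized_weyl_algebra_factor:
  fixes A :: "('k::field, 'a) module" (structure)
  assumes A: "k_algebra A" and n: "n \<ge> 1" and I: "completely_prime I A"
    and Q: "\<forall>i \<in> {1..n}. Q i \<noteq> 0 \<and> Q i \<noteq> 1" and \<Gamma>: "mult_antisym n \<Gamma>"
    and W: "is_quantized_weyl_algebra n Q \<Gamma> A"
  shows "Fract_of_quantum_affine_factor (alg_quot A I)"
proof -
  interpret k_algebra A by fact
  obtain y x \<sigma> \<tau> \<delta> where tw: "skew_tower A n (scalars A) y x \<sigma> \<tau> \<delta>"
    and r: "\<And>i. i \<in> {1..n} \<Longrightarrow>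
         (\<forall>j \<in> {1..<i}.
            \<sigma> i (y j) = \<Gamma> i j \<odot> y j \<and> \<sigma> i (x j) = \<Gamma> j i \<odot> x j \<and>
            \<tau> i (y j) = (Q j * \<Gamma> j i) \<odot> y j \<and>
            \<tau> i (x j) = (inverse (Q j) * \<Gamma> i j) \<odot> x j \<and>
            \<delta> i (y j) = \<zero> \<and> \<delta> i (x j) = \<zero>) \<and>
         \<tau> i (y i) = Q i \<odot> y i \<and>
         \<delta> i (y i) = \<one> \<oplus> (\<Oplus>l \<in> {1..<i}. (Q l - 1) \<odot> (y l \<otimes> x l))"
    using W unfolding is_quantized_weyl_algebra_def by blast
  note T = skew_towerD[OF A tw n]
  have yx [simp]: "y i \<in> carrier A" "x i \<in> carrier A" if "i \<in> {1..n}" for i using T(3,4) that by auto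
  \<comment> \<open>Here \<open>w = 1\<close>, \<open>\<kappa> = 1\<close>, \<open>a = Q\<close> and
    \<open>c = Q - 1\<close>, so \<open>a - c = 1\<close>. For \<open>j < i\<close> the scalar
    \<open>xy i j\<close> comes from \<open>\<tau> i\<close>, for \<open>j > i\<close> from
    inverting the action of \<open>\<sigma> j\<close>.\<close>
  define xx where "xx = (\<lambda>i j. inverse (Q j) * \<Gamma> i j)"
  define xy where "xy = (\<lambda>i j. if j < i then Q j * \<Gamma> j i else \<Gamma> j i)"
  define w1 where "w1 = (\<lambda>i :: nat. 1 :: 'k)"
  define c where "c = (\<lambda>i. Q i - 1)"
  note d = xx_def xy_def w1_def c_def
  have rels: "tower_relations A n \<one> y x \<Gamma> xx xy w1 w1 Q c 1"
    unfolding tower_relations_def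
  proof (intro conjI ballI)
    fix i assume i: "i \<in> {1..n}"
    have "x i \<otimes> y i = \<tau> i (y i) \<otimes> x i \<oplus> \<delta> i (y i)" using i by (intro T(2)) auto
    then show "x i \<otimes> y i = Q i \<odot> (y i \<otimes> x i) \<oplus>
        (1 \<odot> (\<one> \<otimes> \<one>) \<oplus> (\<Oplus>l \<in> {1..<i}. c l \<odot> (y l \<otimes> x l)))"
      using r[OF i] yx[OF i] by (simp add: d sm_mult)
  next
    fix i j assume i: "i \<in> {1..n}" and j: "j \<in> {1..<i}"
    then have j': "j \<in> {1..n}" by auto
    show "y i \<otimes> y j = \<Gamma> i j \<odot> (y j \<otimes> y i)" "x i \<otimes> x j = xx i j \<odot> (x j \<otimes> x i)"
      using T(1)[OF i, of "y j"] T(2)[OF i, of "x j"] r[OF i] j yx[OF i] yx[OF j'] by (simp_all add: d sm_mult)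
  next
    fix i j assume i: "i \<in> {1..n}" and j: "j \<in> {1..n} - {i}"
    show "x i \<otimes> y j = xy i j \<odot> (y j \<otimes> x i)"
    proof (cases "j < i")
      case True
      then show ?thesis using T(2)[OF i, of "y j"] r[OF i] j yx[OF i] yx[of j] by (simp add: d sm_mult)
    next
      case False
      have j': "j \<in> {1..n}" using j by simp
      have "y j \<otimes> x i = \<Gamma> i j \<odot> (x i \<otimes> y j)"
        using T(1)[OF j', of "x i"] r[OF j'] i j False yx[OF i] yx[OF j'] by (simp add: sm_mult)
      from qc_swap[OF this mult_antisymD(1)[OF \<Gamma> i j'] yx(1)[OF j'] yx(2)[OF i]] show ?thesis
        using False by (simp add: d mult_antisymD(2)[OF \<Gamma> i j'])
    qed
  qed (use yx in \<open>auto simp: w1_def\<close>)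
  have scal: "tower_scalars n \<Gamma> xx xy w1 w1 Q c 1"
    unfolding tower_scalars_def
  proof (intro conjI ballI)
    fix i l assume i: "i \<in> {1..n}" and l: "l \<in> {1..<i}"
    then have l': "l \<in> {1..n}" and li: "l < i" by auto
    note G = mult_antisymD[OF \<Gamma> i l'] mult_antisymD(1,3)[OF \<Gamma> l' i]
    have Ql: "Q l \<noteq> 0" using Q l' by blast
    show "\<Gamma> i l \<noteq> 0" by (rule G)
    show "xx i l \<noteq> 0" "xy l i \<noteq> 0" "xy i l \<noteq> 0" using G Ql li by (simp_all add: d)
    show "xy l i = (Q i - c i) * \<Gamma> i l" using li by (simp add: d)
    show "xy i l * \<Gamma> i l = Q l" using li G(5) by (simp add: d mult.assoc)
    have "xy i l * xx i l = (Q l * inverse (Q l)) * (\<Gamma> l i * \<Gamma> i l)" using li by (simp add: d)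
    then show "xy i l * xx i l = Q i - c i" using G(5) Ql by (simp add: d)
    show "Q l * xx i l = xy l i" using li Ql by (simp add: d)
  qed (use Q in \<open>auto simp: d\<close>)
  have gen: "generating A (insert \<one> (y ` {1..n} \<union> x ` {1..n}))"
    unfolding generating_def
  proof (intro conjI ballI)
    show "insert \<one> (y ` {1..n} \<union> x ` {1..n}) \<subseteq> carrier A" using yx by auto
    fix H assume "H \<in> {S. subalg S A \<and> insert \<one> (y ` {1..n} \<union> x ` {1..n}) \<subseteq> S}"
    then have H: "subalg H A" "y ` {1..n} \<subseteq> H" "x ` {1..n} \<subseteq> H" by auto
    then show "carrier A \<subseteq> H" using T(5) scalars_subset[OF A] by blast
  qed
  have "\<forall>i\<in>{1..n}. \<forall>l\<in>{1..<i}. xy l i \<noteq> 0" using scal unfolding tower_scalars_def by blast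
  then show ?thesis by (intro tower_factor[OF A I rels _ disjI1[OF scal] gen])
qed

section \<open>Quantum matrices and the algebra \<open>K\<close> from their presentations\<close>

locale presentation =
  fixes G :: "'x set" and Rel :: "('k::field, 'x) free_poly set"
  assumes Rel: "Rel \<subseteq> carrier (free_algebra G)"
begin

abbreviation "P \<equiv> presented_algebra G Rel"

definition pr :: "('k, 'x) free_poly \<Rightarrow> ('k, 'x) free_poly set"
  where "pr = (+>\<^bsub>free_algebra G\<^esub>) (Idl\<^bsub>free_algebra G\<^esub> Rel)"

lemmas pres = presented_algebra[OF Rel, folded pr_def]

sublocale P: k_algebra P by (rule pres)

sublocale pr: alg_hom_loc "free_algebra G" P pr
  by (intro alg_hom_locI k_algebra_free pres)

lemma pr_add:
  "f \<in> carrier (free_algebra G) \<Longrightarrow> g \<in> carrier (free_algebra G) \<Longrightarrow> pr (f + g) = pr f \<oplus>\<^bsub>P\<^esub> pr g"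
  using pr.add[of f g] by (simp add: free_algebra_simps(2-6))

lemma pr_mult:
  "f \<in> carrier (free_algebra G) \<Longrightarrow> g \<in> carrier (free_algebra G) \<Longrightarrow> pr (f * g) = pr f \<otimes>\<^bsub>P\<^esub> pr g"
  using pr.mult[of f g] by (simp add: free_algebra_simps(2-6))

lemma pr_const: "f \<in> carrier (free_algebra G) \<Longrightarrow> pr (const c * f) = c \<odot>\<^bsub>P\<^esub> pr f"
  using pr.smult[of f c] by (simp add: free_algebra_simps(2-6))

lemma pr_gen: "x \<in> G \<Longrightarrow> pr (gen x) \<in> carrier P"
  by (intro pr.closed gen_in_free)

lemma pr_monomial:
  assumes "x \<in> G" "y \<in> G"
  shows "const c * gen x * gen y \<in> carrier (free_algebra G)"
    "pr (const c * gen x * gen y) = c \<odot>\<^bsub>P\<^esub> (pr (gen x) \<otimes>\<^bsub>P\<^esub> pr (gen y))"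
    "gen x * gen y \<in> carrier (free_algebra G)"
    "pr (gen x * gen y) = pr (gen x) \<otimes>\<^bsub>P\<^esub> pr (gen y)"
proof -
  note g = gen_in_free[OF assms(1)] gen_in_free[OF assms(2)]
  show "const c * gen x * gen y \<in> carrier (free_algebra G)" "gen x * gen y \<in> carrier (free_algebra G)"
    by (intro free_mult_closed g const_in_free)+
  show "pr (gen x * gen y) = pr (gen x) \<otimes>\<^bsub>P\<^esub> pr (gen y)" by (rule pr_mult[OF g])
  then show "pr (const c * gen x * gen y) = c \<odot>\<^bsub>P\<^esub> (pr (gen x) \<otimes>\<^bsub>P\<^esub> pr (gen y))"
    unfolding mult.assoc by (simp add: pr_const[OF free_mult_closed[OF g]])
qed

lemma pr_sum:
  assumes "\<And>i. i \<in> I \<Longrightarrow> f i \<in> carrier (free_algebra G)"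
  shows "(\<Sum>i\<in>I. f i) \<in> carrier (free_algebra G)" "pr (\<Sum>i\<in>I. f i) = (\<Oplus>\<^bsub>P\<^esub>i\<in>I. pr (f i))"
proof -
  have "(\<Sum>i\<in>I. f i) \<in> carrier (free_algebra G) \<and> pr (\<Sum>i\<in>I. f i) = (\<Oplus>\<^bsub>P\<^esub>i\<in>I. pr (f i))"
    using assms
  proof (induction I rule: infinite_finite_induct)
    case (insert i I)
    then have "(\<lambda>i. pr (f i)) \<in> I \<rightarrow> carrier P" "pr (f i) \<in> carrier P" by auto
    with insert show ?case by (simp add: P.finsum_insert pr_add free_add_closed)
  qed (use pr.zero pr.A.zero_closed in \<open>simp_all add: free_algebra_simps(2-6)\<close>)
  then show "(\<Sum>i\<in>I. f i) \<in> carrier (free_algebra G)" "pr (\<Sum>i\<in>I. f i) = (\<Oplus>\<^bsub>P\<^esub>i\<in>I. pr (f i))" by auto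
qed

lemma rel_qcommute:
  assumes "x \<in> G" "y \<in> G" "gen x * gen y - const c * gen y * gen x \<in> Rel"
  shows "pr (gen x) \<otimes>\<^bsub>P\<^esub> pr (gen y) = c \<odot>\<^bsub>P\<^esub> (pr (gen y) \<otimes>\<^bsub>P\<^esub> pr (gen x))"
  using pres(5)[OF assms(3) pr_monomial(3)[OF assms(1,2)] pr_monomial(1)[OF assms(2,1)]]
  by (simp add: pr_monomial assms)

end

lemmas free_closed = free_minus_closed free_add_closed free_mult_closed const_in_free gen_in_free

lemma alg_isoD: "f \<in> alg_iso A B \<Longrightarrow> f \<in> alg_hom A B" "f \<in> alg_iso A B \<Longrightarrow> f ` carrier A = carrier B"
  by (auto simp: alg_iso_def bij_betw_def)

theorem quantum_matrices_factor:
  fixes A :: "('k::field, 'a) module"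
  assumes A: "k_algebra A" and I: "completely_prime I A"
    and lam: "lam \<noteq> 0" and p: "mult_antisym n p" and iso: "alg_isomorphic (quantum_matrices n lam p) A"
  shows "Fract_of_quantum_affine_factor (alg_quot A I)"
proof -
  let ?G = "{1..n} \<times> {1..n}"
  define R1 :: "('k, nat \<times> nat) free_poly set" where
    "R1 = {gen (l, m) * gen (i, j) - (const (p l i * p j m) * gen (i, j) * gen (l, m)
        + const ((lam - 1) * p l i) * gen (i, m) * gen (l, j)) | l m i j.
        {l, m, i, j} \<subseteq> {1..n} \<and> l > i \<and> m > j}"
  define R2 :: "('k, nat \<times> nat) free_poly set" where
    "R2 = {gen (l, m) * gen (i, j) - const (lam * p l i * p j m) * gen (i, j) * gen (l, m) | l m i j.
        {l, m, i, j} \<subseteq> {1..n} \<and> l > i \<and> m \<le> j}"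
  define R3 :: "('k, nat \<times> nat) free_poly set" where
    "R3 = {gen (l, m) * gen (i, j) - const (p j m) * gen (i, j) * gen (l, m) | l m i j.
        {l, m, i, j} \<subseteq> {1..n} \<and> l = i \<and> m > j}"
  have M: "quantum_matrices n lam p = presented_algebra ?G (R1 \<union> R2 \<union> R3)"
    unfolding quantum_matrices_def R1_def R2_def R3_def ..
  have "R1 \<subseteq> carrier (free_algebra ?G)" "R2 \<subseteq> carrier (free_algebra ?G)" "R3 \<subseteq> carrier (free_algebra ?G)"
    unfolding R1_def R2_def R3_def by (clarify, intro free_closed; simp)+
  then interpret pres: presentation ?G "R1 \<union> R2 \<union> R3" by unfold_locales simp
  let ?P = "presented_algebra ?G (R1 \<union> R2 \<union> R3)"
  define x where "x = (\<lambda>i j. pres.pr (gen (i, j)))"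
  have xc: "x i j \<in> carrier ?P" if "i \<in> {1..n}" "j \<in> {1..n}" for i j
    unfolding x_def using that by (intro pres.pr_gen) simp
  \<comment> \<open>The largest number of a position is
    \<open>n (n + 1) + n = (n + 1)^2 - 1\<close>, so for \<open>r = (n + 1)^2\<close> all relations
    carry their extra term.\<close>
  have rels: "matrix_relations ?P n lam p ((n + 1) * (n + 1)) x"
    unfolding matrix_relations_def
  proof (intro conjI ballI impI)
    fix l m i j assume q: "l \<in> {1..n}" "m \<in> {1..n}" "i \<in> {1..n}" "j \<in> {1..n}"
    have g: "(l, m) \<in> ?G" "(i, j) \<in> ?G" "(i, m) \<in> ?G" "(l, j) \<in> ?G" using q by auto
    note mon = pres.pr_monomial[OF g(1,2)] pres.pr_monomial[OF g(2,1)] pres.pr_monomial[OF g(3,4)]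
    { assume o: "i < l \<and> j < m"
      have "pos n l m < pos n (n + 1) 1"
        using q by (subst pos_less) auto
      also have "pos n (n + 1) 1 = (n + 1) * (n + 1) + 1" by (simp add: pos_def)
      finally have "pos n l m \<le> (n + 1) * (n + 1)" by simp
      moreover have "pos n l m \<noteq> (n + 1) * (n + 1)"
      proof -
        have "pos n l m \<le> n * (n + 1) + n" unfolding pos_def using q by (intro add_mono mult_le_mono1) auto
        then show ?thesis by simp
      qed
      ultimately have e: "pos n l m < (n + 1) * (n + 1)" by simp
      have "gen (l, m) * gen (i, j) - (const (p l i * p j m) * gen (i, j) * gen (l, m)
        + const ((lam - 1) * p l i) * gen (i, m) * gen (l, j)) \<in> R1 \<union> R2 \<union> R3"
        unfolding R1_def using q o by blast
      from pres.pres(5)[OF this mon(3) free_add_closed[OF mon(5,9)]]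
      show "x l m \<otimes>\<^bsub>?P\<^esub> x i j = (p l i * p j m) \<odot>\<^bsub>?P\<^esub> (x i j \<otimes>\<^bsub>?P\<^esub> x l m) \<oplus>\<^bsub>?P\<^esub>
        ((if pos n l m < (n + 1) * (n + 1) then lam - 1 else 0) * p l i) \<odot>\<^bsub>?P\<^esub> (x i m \<otimes>\<^bsub>?P\<^esub> x l j)"
        unfolding if_P[OF e] by (simp only: pres.pr_add[OF mon(5,9)] mon(4,6,10) x_def) }
    { assume o: "i < l \<and> m \<le> j"
      have "gen (l, m) * gen (i, j) - const (lam * p l i * p j m) * gen (i, j) * gen (l, m) \<in> R1 \<union> R2 \<union> R3"
        unfolding R2_def using q o by blast
      from pres.rel_qcommute[OF g(1,2) this]
      show "x l m \<otimes>\<^bsub>?P\<^esub> x i j = (lam * p l i * p j m) \<odot>\<^bsub>?P\<^esub> (x i j \<otimes>\<^bsub>?P\<^esub> x l m)" by (simp only: x_def) }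
    { assume o: "i = l \<and> j < m"
      have "gen (l, m) * gen (i, j) - const (p j m) * gen (i, j) * gen (l, m) \<in> R1 \<union> R2 \<union> R3"
        unfolding R3_def using q o by blast
      from pres.rel_qcommute[OF g(1,2) this]
      show "x l m \<otimes>\<^bsub>?P\<^esub> x i j = p j m \<odot>\<^bsub>?P\<^esub> (x i j \<otimes>\<^bsub>?P\<^esub> x l m)" by (simp only: x_def) }
  qed (rule xc)
  have gen: "generating ?P {x i j | i j. i \<in> {1..n} \<and> j \<in> {1..n}}"
  proof -
    have "(pres.pr \<circ> gen) ` ?G = {x i j | i j. i \<in> {1..n} \<and> j \<in> {1..n}}"
      unfolding x_def comp_def by blast
    then show ?thesis using pres.pres(6) by simp
  qed
  obtain f where f: "f \<in> alg_iso ?P A" using iso unfolding alg_isomorphic_def M by blast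
  note R = completely_primeD[OF A I]
  define g where "g = (+>\<^bsub>A\<^esub>) I \<circ> f"
  have g: "g \<in> alg_hom ?P (alg_quot A I)"
    unfolding g_def by (rule alg_hom_comp[OF alg_isoD(1)[OF f] R(3)])
  have "g ` carrier ?P = carrier (alg_quot A I)"
    unfolding g_def image_comp[symmetric] alg_isoD(2)[OF f] by (rule R(4))
  from generating_image[OF pres.P.k_algebra_axioms R(1) g this gen]
  have gg: "generating (alg_quot A I) {g (x i j) | i j. i \<in> {1..n} \<and> j \<in> {1..n}}"
    by (rule back_subst[of "generating (alg_quot A I)"]) blast
  show ?thesis
    by (rule matrix_Gelfand_Kirillov[OF R(1,2) p lam matrix_relations_image[OF pres.P.k_algebra_axioms R(1) g rels] gg])
qed

theorem K_algebra_factor: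
  fixes A :: "('k::field, 'a) module"
  assumes A: "k_algebra A" and I: "completely_prime I A"
    and PQ: "\<forall>i \<in> {1..n}. P i \<noteq> 0 \<and> Q i \<noteq> 0 \<and> P i \<noteq> Q i" and \<Gamma>: "mult_antisym n \<Gamma>"
    and iso: "alg_isomorphic (K_algebra n P Q \<Gamma>) A"
  shows "Fract_of_quantum_affine_factor (alg_quot A I)"
proof -
  let ?G = "XG ` {1..n} \<union> YG ` {1..n}"
  define R1 :: "('k, K_gen) free_poly set" where
    "R1 = {gen (YG i) * gen (YG j) - const (\<Gamma> i j) * gen (YG j) * gen (YG i) | i j. {i, j} \<subseteq> {1..n}}"
  define R2 :: "('k, K_gen) free_poly set" where
    "R2 = {gen (XG i) * gen (XG j) - const (Q i * inverse (P j) * \<Gamma> i j) * gen (XG j) * gen (XG i) | i j.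
        {i, j} \<subseteq> {1..n} \<and> i < j}"
  define R3 :: "('k, K_gen) free_poly set" where
    "R3 = {gen (XG i) * gen (YG j) - const (P j * \<Gamma> j i) * gen (YG j) * gen (XG i) | i j.
        {i, j} \<subseteq> {1..n} \<and> i < j}"
  define R4 :: "('k, K_gen) free_poly set" where
    "R4 = {gen (XG i) * gen (YG j) - const (Q j * \<Gamma> j i) * gen (YG j) * gen (XG i) | i j.
        {i, j} \<subseteq> {1..n} \<and> i > j}"
  define R5 :: "('k, K_gen) free_poly set" where
    "R5 = {gen (XG i) * gen (YG i) - (const (Q i) * gen (YG i) * gen (XG i)
        + (\<Sum>l \<in> {1..<i}. const (Q l - P l) * gen (YG l) * gen (XG l))) | i. i \<in> {1..n}}"
  let ?R = "R1 \<union> R2 \<union> R3 \<union> R4 \<union> R5"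
  have K: "K_algebra n P Q \<Gamma> = presented_algebra ?G ?R"
    unfolding K_algebra_def R1_def R2_def R3_def R4_def R5_def ..
  \<comment> \<open>The instance without relations provides \<open>pr_sum\<close> for sums in the
    free algebra before \<open>?R\<close> is known to consist of elements of that algebra.\<close>
  interpret F: presentation ?G "{} :: ('k, K_gen) free_poly set" by unfold_locales simp
  have XY: "XG i \<in> ?G" "YG i \<in> ?G" if "i \<in> {1..n}" for i using that by auto
  have "R1 \<subseteq> carrier (free_algebra ?G)" "R2 \<subseteq> carrier (free_algebra ?G)" "R3 \<subseteq> carrier (free_algebra ?G)"
    "R4 \<subseteq> carrier (free_algebra ?G)"
    unfolding R1_def R2_def R3_def R4_def by (clarify, intro free_closed; simp)+
  moreover have "R5 \<subseteq> carrier (free_algebra ?G)"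
    unfolding R5_def by (clarify, intro free_closed F.pr_sum; auto)
  ultimately interpret pres: presentation ?G ?R by unfold_locales simp
  let ?P = "presented_algebra ?G ?R"
  define x y where "x = (\<lambda>i. pres.pr (gen (XG i)))" and "y = (\<lambda>i. pres.pr (gen (YG i)))"
  have yx: "y i \<in> carrier ?P" "x i \<in> carrier ?P" if "i \<in> {1..n}" for i
    unfolding x_def y_def using XY[OF that] by (simp_all only: pres.pr_gen)
  \<comment> \<open>Here \<open>w = 1\<close>, \<open>\<kappa> = 0\<close>, \<open>a = Q\<close> and
    \<open>c = Q - P\<close>, so \<open>a - c = P\<close>. The relation of \<open>x i\<close> and
    \<open>x j\<close> is given for \<open>i < j\<close> while the tower asks for
    \<open>j < i\<close>; hence the inverse.\<close>
  define xx where "xx = (\<lambda>i j. inverse (Q j * inverse (P i) * \<Gamma> j i))"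
  define xy where "xy = (\<lambda>i j. (if i < j then P j else Q j) * \<Gamma> j i)"
  define w1 where "w1 = (\<lambda>i :: nat. 1 :: 'k)"
  define c where "c = (\<lambda>i. Q i - P i)"
  note d = xx_def xy_def w1_def c_def
  have pq: "P i \<noteq> 0" "Q i \<noteq> 0" "Q i \<noteq> P i" if "i \<in> {1..n}" for i using bspec[OF PQ that] by auto
  have rels: "tower_relations ?P n \<one>\<^bsub>?P\<^esub> y x \<Gamma> xx xy w1 w1 Q c 0"
    unfolding tower_relations_def
  proof (intro conjI ballI)
    fix i assume i: "i \<in> {1..n}"
    have sub: "{1..<i} \<subseteq> {1..n}" using i by auto
    have sc: "const (Q l - P l) * gen (YG l) * gen (XG l) \<in> carrier (free_algebra ?G)"
      "pres.pr (const (Q l - P l) * gen (YG l) * gen (XG l)) = c l \<odot>\<^bsub>?P\<^esub> (y l \<otimes>\<^bsub>?P\<^esub> x l)"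
      if "l \<in> {1..<i}" for l
    proof -
      have l: "l \<in> {1..n}" using that sub by blast
      show "const (Q l - P l) * gen (YG l) * gen (XG l) \<in> carrier (free_algebra ?G)"
        "pres.pr (const (Q l - P l) * gen (YG l) * gen (XG l)) = c l \<odot>\<^bsub>?P\<^esub> (y l \<otimes>\<^bsub>?P\<^esub> x l)"
        unfolding x_def y_def c_def by (rule pres.pr_monomial[OF XY(2,1)[OF l]])+
    qed
    have s: "(\<Sum>l \<in> {1..<i}. const (Q l - P l) * gen (YG l) * gen (XG l)) \<in> carrier (free_algebra ?G)"
      "pres.pr (\<Sum>l \<in> {1..<i}. const (Q l - P l) * gen (YG l) * gen (XG l)) =
        (\<Oplus>\<^bsub>?P\<^esub>l\<in>{1..<i}. pres.pr (const (Q l - P l) * gen (YG l) * gen (XG l)))"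
      by (rule pres.pr_sum; rule sc(1); assumption)+
    note mon = pres.pr_monomial[OF XY[OF i]] pres.pr_monomial[OF XY(2,1)[OF i]]
    have cl: "c l \<odot>\<^bsub>?P\<^esub> (y l \<otimes>\<^bsub>?P\<^esub> x l) \<in> carrier ?P" if "l \<in> {1..<i}" for l
      using subsetD[OF sub that] by (intro pres.P.sm_closed pres.P.m_closed yx)
    have sum: "pres.pr (\<Sum>l \<in> {1..<i}. const (Q l - P l) * gen (YG l) * gen (XG l)) =
        (\<Oplus>\<^bsub>?P\<^esub>l\<in>{1..<i}. c l \<odot>\<^bsub>?P\<^esub> (y l \<otimes>\<^bsub>?P\<^esub> x l))"
      unfolding s(2) using cl by (intro pres.P.finsum_cong') (simp_all only: sc(2) Pi_iff, simp)
    have sumc: "(\<Oplus>\<^bsub>?P\<^esub>l\<in>{1..<i}. c l \<odot>\<^bsub>?P\<^esub> (y l \<otimes>\<^bsub>?P\<^esub> x l)) \<in> carrier ?P"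
      using cl by (intro pres.P.finsum_closed Pi_I)
    have "gen (XG i) * gen (YG i) - (const (Q i) * gen (YG i) * gen (XG i)
        + (\<Sum>l \<in> {1..<i}. const (Q l - P l) * gen (YG l) * gen (XG l))) \<in> ?R"
      unfolding R5_def using i by blast
    from pres.pres(5)[OF this mon(3) free_add_closed[OF mon(5) s(1)]]
    have "x i \<otimes>\<^bsub>?P\<^esub> y i = Q i \<odot>\<^bsub>?P\<^esub> (y i \<otimes>\<^bsub>?P\<^esub> x i) \<oplus>\<^bsub>?P\<^esub> (\<Oplus>\<^bsub>?P\<^esub>l\<in>{1..<i}. c l \<odot>\<^bsub>?P\<^esub> (y l \<otimes>\<^bsub>?P\<^esub> x l))"
      by (simp only: pres.pr_add[OF mon(5) s(1)] mon(4,6) sum x_def[symmetric] y_def[symmetric]) (simp add: x_def y_def)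
    then show "x i \<otimes>\<^bsub>?P\<^esub> y i = Q i \<odot>\<^bsub>?P\<^esub> (y i \<otimes>\<^bsub>?P\<^esub> x i) \<oplus>\<^bsub>?P\<^esub>
        (0 \<odot>\<^bsub>?P\<^esub> (\<one>\<^bsub>?P\<^esub> \<otimes>\<^bsub>?P\<^esub> \<one>\<^bsub>?P\<^esub>) \<oplus>\<^bsub>?P\<^esub> (\<Oplus>\<^bsub>?P\<^esub>l\<in>{1..<i}. c l \<odot>\<^bsub>?P\<^esub> (y l \<otimes>\<^bsub>?P\<^esub> x l)))"
      using sumc by (simp del: One_nat_def)
  next
    fix i j assume i: "i \<in> {1..n}" and j: "j \<in> {1..<i}"
    then have j': "j \<in> {1..n}" by auto
    have "gen (YG i) * gen (YG j) - const (\<Gamma> i j) * gen (YG j) * gen (YG i) \<in> R1"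
      unfolding R1_def using i j' by blast
    then have "gen (YG i) * gen (YG j) - const (\<Gamma> i j) * gen (YG j) * gen (YG i) \<in> ?R" by simp
    from pres.rel_qcommute[OF XY(2)[OF i] XY(2)[OF j'] this]
    show "y i \<otimes>\<^bsub>?P\<^esub> y j = \<Gamma> i j \<odot>\<^bsub>?P\<^esub> (y j \<otimes>\<^bsub>?P\<^esub> y i)" by (simp only: y_def)
    have "j < i" using j by simp
    then have "gen (XG j) * gen (XG i) - const (Q j * inverse (P i) * \<Gamma> j i) * gen (XG i) * gen (XG j) \<in> ?R"
      unfolding R2_def using i j' by blast
    from pres.rel_qcommute[OF XY(1)[OF j'] XY(1)[OF i] this]
    have "x j \<otimes>\<^bsub>?P\<^esub> x i = (Q j * inverse (P i) * \<Gamma> j i) \<odot>\<^bsub>?P\<^esub> (x i \<otimes>\<^bsub>?P\<^esub> x j)" by (simp only: x_def)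
    moreover have "Q j * inverse (P i) * \<Gamma> j i \<noteq> 0"
      using pq(1)[OF i] pq(2)[OF j'] mult_antisymD(1)[OF \<Gamma> j' i] by simp
    ultimately show "x i \<otimes>\<^bsub>?P\<^esub> x j = xx i j \<odot>\<^bsub>?P\<^esub> (x j \<otimes>\<^bsub>?P\<^esub> x i)"
      unfolding xx_def by (rule pres.P.qc_swap[OF _ _ yx(2)[OF j'] yx(2)[OF i]])
  next
    fix i j assume i: "i \<in> {1..n}" and "j \<in> {1..n} - {i}"
    then have j: "j \<in> {1..n}" "j \<noteq> i" by auto
    have "gen (XG i) * gen (YG j) - const (xy i j) * gen (YG j) * gen (XG i) \<in> ?R"
    proof (cases "i < j")
      case True
      then show ?thesis unfolding R3_def xy_def if_P[OF True] using i j by blast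
    next
      case False
      then have "j < i" using j by simp
      then show ?thesis unfolding R4_def xy_def if_not_P[OF False] using i j by blast
    qed
    from pres.rel_qcommute[OF XY(1)[OF i] XY(2)[OF j(1)] this]
    show "x i \<otimes>\<^bsub>?P\<^esub> y j = xy i j \<odot>\<^bsub>?P\<^esub> (y j \<otimes>\<^bsub>?P\<^esub> x i)" by (simp only: x_def y_def)
  qed (simp_all add: w1_def yx del: One_nat_def atLeastAtMost_iff)
  have scal: "tower_scalars n \<Gamma> xx xy w1 w1 Q c 0"
    unfolding tower_scalars_def
  proof (intro conjI ballI)
    fix i l assume i: "i \<in> {1..n}" and l: "l \<in> {1..<i}"
    then have l': "l \<in> {1..n}" and li: "l < i" by auto
    note G = mult_antisymD[OF \<Gamma> i l'] mult_antisymD[OF \<Gamma> l' i]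
    note z = pq[OF i] pq[OF l']
    have xxe: "xx i l = inverse (Q l) * P i * \<Gamma> i l" using G(5) by (simp add: xx_def)
    show "\<Gamma> i l \<noteq> 0" by (rule G)
    show "xx i l \<noteq> 0" "xy l i \<noteq> 0" "xy i l \<noteq> 0" using G z li by (simp_all add: d)
    show "xy l i = (Q i - c i) * \<Gamma> i l" using li by (simp add: d)
    show "xy i l * \<Gamma> i l = Q l" using li G(6) by (simp add: d mult.assoc)
    have "xy i l * xx i l = (Q l * inverse (Q l)) * P i * (\<Gamma> l i * \<Gamma> i l)" using li by (simp add: xxe xy_def)
    then show "xy i l * xx i l = Q i - c i" using G(6) z by (simp add: c_def)
    show "Q l * xx i l = xy l i" using li z by (simp add: xxe xy_def)
  qed (use pq in \<open>simp_all add: c_def w1_def del: One_nat_def atLeastAtMost_iff\<close>)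
  have nz: "\<forall>i\<in>{1..n}. \<forall>l\<in>{1..<i}. xy l i \<noteq> 0" using scal unfolding tower_scalars_def by blast
  obtain f where f: "f \<in> alg_iso ?P A" using iso unfolding alg_isomorphic_def K by blast
  interpret f: alg_hom_loc ?P A f by (intro alg_hom_locI pres.P.k_algebra_axioms A alg_isoD(1)[OF f])
  have "generating ?P (y ` {1..n} \<union> x ` {1..n})"
    using pres.pres(6) by (simp add: image_Un image_image x_def y_def comp_def Un_commute)
  \<comment> \<open>The tower counts \<open>w = 1\<close> among its generators, so \<open>1\<close>
    is added to the generating set.\<close>
  from generating_image[OF pres.P.k_algebra_axioms A alg_isoD[OF f] this]
  have "generating A (insert (f \<one>\<^bsub>?P\<^esub>) ((f \<circ> y) ` {1..n} \<union> (f \<circ> x) ` {1..n}))"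
  proof (rule generating_mono)
    show "f ` (y ` {1..n} \<union> x ` {1..n}) \<subseteq> insert (f \<one>\<^bsub>?P\<^esub>) ((f \<circ> y) ` {1..n} \<union> (f \<circ> x) ` {1..n})" by auto
    show "insert (f \<one>\<^bsub>?P\<^esub>) ((f \<circ> y) ` {1..n} \<union> (f \<circ> x) ` {1..n}) \<subseteq> carrier A"
      using yx f.closed[OF pres.P.one_closed] by (auto simp del: One_nat_def)
  qed
  then show ?thesis
    by (rule tower_factor[OF A I tower_relations_image[OF pres.P.k_algebra_axioms A alg_isoD(1)[OF f] rels] nz disjI1[OF scal]])
qed

theorem corollary6p4:
  fixes A :: "('k::field, 'a) module" and I :: "'a set" and n :: nat
  assumes "k_algebra A" and "n \<ge> 1"
    and "(\<exists>q s. q \<noteq> 0 \<and> s\<^sup>2 = q \<and> (q\<^sup>2 = 1 \<longrightarrow> q = 1) \<and> is_quantum_euclidean n q s A) \<or>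
      (\<exists>Q \<Gamma>. (\<forall>i \<in> {1..n}. Q i \<noteq> 0 \<and> Q i \<noteq> 1) \<and> mult_antisym n \<Gamma> \<and>
        is_quantized_weyl_algebra n Q \<Gamma> A) \<or>
      (\<exists>lam p. lam \<noteq> 0 \<and> mult_antisym n p \<and> alg_isomorphic (quantum_matrices n lam p) A) \<or>
      (\<exists>P Q \<Gamma>. (\<forall>i \<in> {1..n}. P i \<noteq> 0 \<and> Q i \<noteq> 0 \<and> P i \<noteq> Q i) \<and> mult_antisym n \<Gamma> \<and>
        alg_isomorphic (K_algebra n P Q \<Gamma>) A)"
    and "completely_prime I A"
  shows "\<exists>N lam J. N \<ge> 1 \<and> mult_antisym N (lam :: nat \<Rightarrow> nat \<Rightarrow> 'k) \<and>
    completely_prime J (quantum_affine_space N lam) \<and>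
    isomorphic_Fract (alg_quot A I) (alg_quot (quantum_affine_space N lam) J)"
proof -
  have "Fract_of_quantum_affine_factor (alg_quot A I)"
    using assms(3)
  proof (elim disjE exE conjE)
    fix q s assume "q \<noteq> 0" "s\<^sup>2 = q" "q\<^sup>2 = 1 \<longrightarrow> q = 1" "is_quantum_euclidean n q s A"
    then show ?thesis by (rule quantum_euclidean_factor[OF assms(1,2,4)])
  next
    fix Q \<Gamma> assume "\<forall>i \<in> {1..n}. Q i \<noteq> 0 \<and> Q i \<noteq> 1" "mult_antisym n \<Gamma>" "is_quantized_weyl_algebra n Q \<Gamma> A"
    then show ?thesis by (rule quantized_weyl_algebra_factor[OF assms(1,2,4)])
  next
    fix lam p assume "lam \<noteq> 0" "mult_antisym n p" "alg_isomorphic (quantum_matrices n lam p) A"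
    then show ?thesis by (rule quantum_matrices_factor[OF assms(1,4)])
  next
    fix P Q \<Gamma> assume "\<forall>i \<in> {1..n}. P i \<noteq> 0 \<and> Q i \<noteq> 0 \<and> P i \<noteq> Q i" "mult_antisym n \<Gamma>"
      "alg_isomorphic (K_algebra n P Q \<Gamma>) A"
    then show ?thesis by (rule K_algebra_factor[OF assms(1,4)])
  qed
  then show ?thesis by (simp only: Fract_of_quantum_affine_factor_def)
qed

end
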